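(* There is an algorithm which, given a $\mathcal{DL}\langle\mathsf{4LQS^{R,\times}}\rangle(\mathbf{D})$-knowledge base $\mathcal{KB}$ and a $\mathcal{DL}\langle\mathsf{4LQS^{R,\times}}\rangle(\mathbf{D})$-conjunctive query $Q$, computes the answer set of $Q$ with respect to $\mathcal{KB}$. That is, the CQA problem for $Q$ w.r.t. $\mathcal{KB}$ can be solved effectively.
   Context: Datatype map: $\mathbf{D}=(N_D,N_C,N_F,\cdot^{\mathbf{D}})$ with $N_D$ a finite set of datatypes, $N_C(d)$ a set of constants and $N_F(d)$ a set of facets for each $d\in N_D$; $\cdot^{\mathbf{D}}$ assigns to each $d$ a nonempty set $d^{\mathbf{D}}$ (these being pairwise disjoint), to each $f\in N_F(d)$ a set $f^{\mathbf{D}}\subseteq d^{\mathbf{D}}$, and to each $e_d\in N_C(d)$ a value $e_d^{\mathbf{D}}\in d^{\mathbf{D}}$. Facet expressions for $d$ are built from $N_F(d)\cup\{\top_d,\bot_d\}$ by $\neg,\wedge,\vee$, interpreted with $\top_d^{\mathbf{D}}=d^{\mathbf{D}}$, $\bot_d^{\mathbf{D}}=\emptyset$, $(\neg f)^{\mathbf{D}}=d^{\mathbf{D}}\setminus f^{\mathbf{D}}$, and intersection/union. A data range is a datatype, a finite set $\{e_{d_1},\dots,e_{d_n}\}$ of constants, a facet expression, or the complement $\neg dr$ of a data range. Let $\mathbf{R_A}$ (containing the universal role $U$), $\mathbf{R_D}$, $\mathbf{C}$, $\mathbf{Ind}$ be pairwise disjoint countable sets of abstract role, concrete role, concept and individual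 names. Terms: datatype terms $t::=dr\mid\neg t\mid t_1\sqcap t_2\mid t_1\sqcup t_2\mid\{e_d\}$; concepts $C::=A\mid\top\mid\bot\mid\neg C\mid C_1\sqcup C_2\mid C_1\sqcap C_2\mid\{a\}\mid\exists R.\mathit{Self}\mid\exists R.\{a\}\mid\exists P.\{e_d\}$ ($A$ a concept name, $a$ an individual); abstract roles $R::=S\mid U\mid R^-\mid\neg R\mid R_1\sqcup R_2\mid R_1\sqcap R_2\mid R_{C|}\mid R_{|C}\mid R_{C_1|C_2}\mid id(C)\mid C_1\times C_2$ ($S$ an abstract role name); concrete roles $P::=T\mid\neg P\mid P_1\sqcup P_2\mid P_1\sqcap P_2\mid P_{C|}\mid P_{|t}\mid P_{C|t}$ ($T$ a concrete role name). A knowledge base is $(\mathcal{R},\mathcal{T},\mathcal{A})$: the RBox $\mathcal{R}$ consists of statements $R_1\equiv R_2$, $R_1\sqsubseteq R_2$, $R_1\cdots R_n\sqsubseteq R_{n+1}$, $\mathsf{Sym}(R)$, $\mathsf{Asym}(R)$, $\mathsf{Ref}(R)$, $\mathsf{Irref}(R)$, $\mathsf{Dis}(R_1,R_2)$, $\mathsf{Tra}(R)$, $\mathsf{Fun}(R)$, $R\equiv C_1\times C_2$, $P_1\equiv P_2$, $P_1\sqsubseteq P_2$, $\mathsf{Dis}(P_1,P_2)$, $\mathsf{Fun}(P)$; the TBox $\mathcal{T}$ of statements $C_1\equiv C_2$, $C_1\sqsubseteq C_2$, $C_1\sqsubseteq\forall R.C_2$, $\exists R.C_1\sqsubseteq C_2$,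 ${\geq_n}R.C_1\sqsubseteq C_2$, $C_1\sqsubseteq{\leq_n}R.C_2$, $t_1\equiv t_2$, $t_1\sqsubseteq t_2$, $C\sqsubseteq\forall P.t$, $\exists P.t\sqsubseteq C$, ${\geq_n}P.t\sqsubseteq C$, $C\sqsubseteq{\leq_n}P.t$; the ABox $\mathcal{A}$ of assertions $a:C$, $(a,b):R$, $a=b$, $e_d:t$, $(a,e_d):P$. Semantics: an interpretation $\mathbf{I}=(\Delta^{\mathbf{I}},\Delta_{\mathbf{D}},\cdot^{\mathbf{I}})$ has disjoint nonempty domains with $d^{\mathbf{D}}\subseteq\Delta_{\mathbf{D}}$ for all $d$; $A^{\mathbf{I}}\subseteq\Delta^{\mathbf{I}}$, $a^{\mathbf{I}}\in\Delta^{\mathbf{I}}$, abstract roles are subsets of $\Delta^{\mathbf{I}}\times\Delta^{\mathbf{I}}$, concrete roles subsets of $\Delta^{\mathbf{I}}\times\Delta_{\mathbf{D}}$, datatype terms subsets of $\Delta_{\mathbf{D}}$ (with $\neg$ as complement in $\Delta_{\mathbf{D}}$, data ranges interpreted via $\mathbf{D}$). Concept constructors are interpreted in the standard way ($\neg$ as complement in $\Delta^{\mathbf{I}}$, $\{a\}^{\mathbf{I}}=\{a^{\mathbf{I}}\}$, $(\exists R.\mathit{Self})^{\mathbf{I}}=\{x:\langle x,x\rangle\in R^{\mathbf{I}}\}$, $(\exists R.\{a\})^{\mathbf{I}}=\{x:\langle x,a^{\mathbf{I}}\rangle\in R^{\mathbf{I}}\}$, $(\exists P.\{e_d\})^{\mathbf{I}}=\{x:\langle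 x,e_d^{\mathbf{D}}\rangle\in P^{\mathbf{I}}\}$). Roles: $U^{\mathbf{I}}=\Delta^{\mathbf{I}}\times\Delta^{\mathbf{I}}$, $R^-$ inverse, $\neg R$ complement in $\Delta^{\mathbf{I}}\times\Delta^{\mathbf{I}}$, $\neg P$ complement in $\Delta^{\mathbf{I}}\times\Delta_{\mathbf{D}}$, $\sqcup,\sqcap$ union/intersection, $R_{C|}$ (resp. $R_{|C}$, $R_{C_1|C_2}$) restricts first (resp. second, both) components to $C^{\mathbf{I}}$ (resp. $C_1^{\mathbf{I}},C_2^{\mathbf{I}}$), $id(C)^{\mathbf{I}}=\{\langle x,x\rangle:x\in C^{\mathbf{I}}\}$, $(C_1\times C_2)^{\mathbf{I}}=C_1^{\mathbf{I}}\times C_2^{\mathbf{I}}$, $P_{C|}, P_{|t}, P_{C|t}$ restrict first component to $C^{\mathbf{I}}$ and/or second to $t^{\mathbf{D}}$. Axioms: $\sqsubseteq$ and $\equiv$ are set inclusion/equality; $R_1\cdots R_n\sqsubseteq R$ means $R_1^{\mathbf{I}}\circ\dots\circ R_n^{\mathbf{I}}\subseteq R^{\mathbf{I}}$; $\mathsf{Sym},\mathsf{Asym},\mathsf{Tra},\mathsf{Ref},\mathsf{Irref},\mathsf{Dis},\mathsf{Fun}$ have their usual meaning (symmetric, asymmetric, transitive, reflexive on $\Delta^{\mathbf{I}}$, irreflexive, disjoint, functional); $\forall R.C$, $\geq_n R.C$, $\leq_n R.C$ (and for $P,t$) are the standard value and qualified number restrictions; assertions: $a^{\mathbf{I}}\in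 C^{\mathbf{I}}$, $\langle a^{\mathbf{I}},b^{\mathbf{I}}\rangle\in R^{\mathbf{I}}$, $a^{\mathbf{I}}=b^{\mathbf{I}}$, $e_d^{\mathbf{D}}\in t^{\mathbf{D}}$, $\langle a^{\mathbf{I}},e_d^{\mathbf{D}}\rangle\in P^{\mathbf{I}}$. $\mathbf{I}\models_{\mathbf{D}}\mathcal{KB}$ if it satisfies all statements of $\mathcal{KB}$. Queries: let $\mathcal{V}$ be an infinite set of variables disjoint from $\mathbf{Ind}$ and from all $N_C(d)$. Atomic formulae are $R(w_1,w_2)$, $P(w_1,u_1)$, $C(w_1)$, $w_1=w_2$, $u_1=u_2$ with $w_i\in\mathcal{V}\cup\mathbf{Ind}$, $u_i\in\mathcal{V}\cup\bigcup_d N_C(d)$; a literal is an atomic formula or its negation; a conjunctive query is a conjunction $Q$ of literals. A substitution $\sigma=\{v_1/o_1,\dots,v_n/o_n\}$ with $o_i\in\mathbf{Ind}\cup\bigcup_d N_C(d)$ acts by replacement. A substitution involving exactly the variables of $Q$ is a solution for $Q$ w.r.t. $\mathcal{KB}$ if there exists an interpretation $\mathbf{I}$ with $\mathbf{I}\models_{\mathbf{D}}\mathcal{KB}$ and $\mathbf{I}\models_{\mathbf{D}}Q\sigma$; the answer set of $Q$ w.r.t. $\mathcal{KB}$ is the set of all such solutions.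
   Formalization: Satisfiability over D of finite conjunctions of "x in dr" and "x ≠ y" is assumed decidable (else false: facets with undecidable emptiness); infinitely many non-data elements are assumed; the answer set is computed by deciding membership, and listed if there are finitely many individuals and constants. *)

theory Defs
  imports Main "HOL-Library.Nat_Bijection"
begin

section \<open>Algorithms\<close>

text \<open>
  Partial recursive functions, in the presentation as unary functions on \<open>nat\<close> that are
  closed under pairing, composition, primitive recursion and minimisation; the pairing is the
  Cantor pairing \<^const>\<open>prod_encode\<close>. \<open>None\<close> stands for divergence.
\<close>

inductive partrec :: "(nat \<Rightarrow> nat option) \<Rightarrow> bool" where
  zero: "partrec (\<lambda>n. Some 0)"
| succ: "partrec (\<lambda>n. Some (Suc n))"
| left: "partrec (\<lambda>n. Some (fst (prod_decode n)))"
| right: "partrec (\<lambda>n. Some (snd (prod_decode n)))"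
| pair: "partrec f \<Longrightarrow> partrec g \<Longrightarrow>
    partrec (\<lambda>n. Option.bind (f n) (\<lambda>a. Option.bind (g n) (\<lambda>b. Some (prod_encode (a, b)))))"
| comp: "partrec f \<Longrightarrow> partrec g \<Longrightarrow> partrec (\<lambda>n. Option.bind (g n) f)"
| prec: "partrec f \<Longrightarrow> partrec g \<Longrightarrow>
    partrec (\<lambda>n. rec_nat (f (fst (prod_decode n)))
      (\<lambda>k r. Option.bind r
        (\<lambda>i. g (prod_encode (fst (prod_decode n), prod_encode (k, i)))))
      (snd (prod_decode n)))"
| rfind: "partrec f \<Longrightarrow>
    partrec (\<lambda>n. if \<exists>k. f (prod_encode (n, k)) = Some 0 \<and> (\<forall>j<k. f (prod_encode (n, j)) \<noteq> None)
      then Some (LEAST k. f (prod_encode (n, k)) = Some 0) else None)"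

definition node :: "nat \<Rightarrow> nat list \<Rightarrow> nat" where
  "node k xs = prod_encode (k, list_encode xs)"

lemma node_eq_iff [simp]: "node k xs = node l ys \<longleftrightarrow> k = l \<and> xs = ys"
  by (simp add: node_def list_encode_eq)


section \<open>Datatype maps, facets and data ranges\<close>

text \<open>
  Names of every kind are natural numbers. A constant \<open>e\<^sub>d\<close> is the pair \<open>(d, e)\<close>.
  The type \<open>'u\<close> plays the role of the universe of sets: it contains the values of the
  datatypes as well as the elements of the domains of interpretations.
\<close>

type_synonym dconst = "nat \<times> nat"

record 'u datatype_map =
  dtypes :: "nat set"
  consts_of :: "nat \<Rightarrow> nat set"
  facets_of :: "nat \<Rightarrow> nat set"
  dtype_int :: "nat \<Rightarrow> 'u set"
  facet_int :: "nat \<Rightarrow> nat \<Rightarrow> 'u set"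
  const_int :: "nat \<Rightarrow> nat \<Rightarrow> 'u"

definition datatype_map :: "'u datatype_map \<Rightarrow> bool" where
  "datatype_map D \<longleftrightarrow>
     finite (dtypes D) \<and>
     (\<forall>d\<in>dtypes D. dtype_int D d \<noteq> {}) \<and>
     (\<forall>d\<in>dtypes D. \<forall>d'\<in>dtypes D. d \<noteq> d' \<longrightarrow> dtype_int D d \<inter> dtype_int D d' = {}) \<and>
     (\<forall>d\<in>dtypes D. \<forall>f\<in>facets_of D d. facet_int D d f \<subseteq> dtype_int D d) \<and>
     (\<forall>d\<in>dtypes D. \<forall>e\<in>consts_of D d. const_int D d e \<in> dtype_int D d)"

definition data_values :: "'u datatype_map \<Rightarrow> 'u set" where
  "data_values D = (\<Union>d\<in>dtypes D. dtype_int D d)"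

definition all_consts :: "'u datatype_map \<Rightarrow> dconst set" where
  "all_consts D = {(d, e). d \<in> dtypes D \<and> e \<in> consts_of D d}"

definition const_val :: "'u datatype_map \<Rightarrow> dconst \<Rightarrow> 'u" where
  "const_val D c = const_int D (fst c) (snd c)"

datatype facet_expr =
    Facet nat | FTop | FBot | FNeg facet_expr
  | FAnd facet_expr facet_expr | FOr facet_expr facet_expr

primrec facet_names :: "facet_expr \<Rightarrow> nat set" where
  "facet_names (Facet f) = {f}"
| "facet_names FTop = {}"
| "facet_names FBot = {}"
| "facet_names (FNeg x) = facet_names x"
| "facet_names (FAnd x y) = facet_names x \<union> facet_names y"
| "facet_names (FOr x y) = facet_names x \<union> facet_names y"

primrec facet_sem :: "'u datatype_map \<Rightarrow> nat \<Rightarrow> facet_expr \<Rightarrow> 'u set" where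
  "facet_sem D d (Facet f) = facet_int D d f"
| "facet_sem D d FTop = dtype_int D d"
| "facet_sem D d FBot = {}"
| "facet_sem D d (FNeg x) = dtype_int D d - facet_sem D d x"
| "facet_sem D d (FAnd x y) = facet_sem D d x \<inter> facet_sem D d y"
| "facet_sem D d (FOr x y) = facet_sem D d x \<union> facet_sem D d y"

datatype data_range =
    Dtype nat | DEnum "dconst list" | DFacet nat facet_expr | DNeg data_range

primrec wf_range :: "'u datatype_map \<Rightarrow> data_range \<Rightarrow> bool" where
  "wf_range D (Dtype d) \<longleftrightarrow> d \<in> dtypes D"
| "wf_range D (DEnum cs) \<longleftrightarrow> set cs \<subseteq> all_consts D"
| "wf_range D (DFacet d x) \<longleftrightarrow> d \<in> dtypes D \<and> facet_names x \<subseteq> facets_of D d"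
| "wf_range D (DNeg r) \<longleftrightarrow> wf_range D r"

text \<open>The second argument is the data domain, relative to which complements are taken.\<close>

primrec range_sem :: "'u datatype_map \<Rightarrow> 'u set \<Rightarrow> data_range \<Rightarrow> 'u set" where
  "range_sem D V (Dtype d) = dtype_int D d"
| "range_sem D V (DEnum cs) = const_val D ` set cs"
| "range_sem D V (DFacet d x) = facet_sem D d x"
| "range_sem D V (DNeg r) = V - range_sem D V r"

primrec enc_facet :: "facet_expr \<Rightarrow> nat" where
  "enc_facet (Facet f) = node 0 [f]"
| "enc_facet FTop = node 1 []"
| "enc_facet FBot = node 2 []"
| "enc_facet (FNeg x) = node 3 [enc_facet x]"
| "enc_facet (FAnd x y) = node 4 [enc_facet x, enc_facet y]"
| "enc_facet (FOr x y) = node 5 [enc_facet x, enc_facet y]"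

primrec enc_range :: "data_range \<Rightarrow> nat" where
  "enc_range (Dtype d) = node 0 [d]"
| "enc_range (DEnum cs) = node 1 (map prod_encode cs)"
| "enc_range (DFacet d x) = node 2 [d, enc_facet x]"
| "enc_range (DNeg r) = node 3 [enc_range r]"


section \<open>Effectively given datatype maps\<close>

text \<open>
  A data conjunction is a finite conjunction of assertions \<open>x \<in> dr\<close> and \<open>x \<noteq> y\<close> with \<open>x, y\<close>
  ranging over the data values. This is the satisfiability problem that a datatype checker
  for \<open>D\<close> has to solve; equalities of and with constants are expressible through singleton
  enumerations. Decidability of this problem is the only information about \<open>D\<close> that is
  available to an algorithm.
\<close>

datatype data_lit = InRange nat data_range | Distinct nat nat

primrec wf_data_lit :: "'u datatype_map \<Rightarrow> data_lit \<Rightarrow> bool" where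
  "wf_data_lit D (InRange x r) \<longleftrightarrow> wf_range D r"
| "wf_data_lit D (Distinct x y) \<longleftrightarrow> True"

primrec data_lit_holds :: "'u datatype_map \<Rightarrow> (nat \<Rightarrow> 'u) \<Rightarrow> data_lit \<Rightarrow> bool" where
  "data_lit_holds D v (InRange x r) \<longleftrightarrow> v x \<in> range_sem D (data_values D) r"
| "data_lit_holds D v (Distinct x y) \<longleftrightarrow> v x \<noteq> v y"

definition data_conj_sat :: "'u datatype_map \<Rightarrow> data_lit list \<Rightarrow> bool" where
  "data_conj_sat D ls \<longleftrightarrow>
     (\<exists>v. (\<forall>x. v x \<in> data_values D) \<and> (\<forall>l\<in>set ls. data_lit_holds D v l))"

primrec enc_data_lit :: "data_lit \<Rightarrow> nat" where
  "enc_data_lit (InRange x r) = node 0 [x, enc_range r]"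
| "enc_data_lit (Distinct x y) = node 1 [x, y]"

definition effective_datatype_map :: "'u datatype_map \<Rightarrow> bool" where
  "effective_datatype_map D \<longleftrightarrow>
     (\<exists>f. partrec f \<and>
       (\<forall>ls. (\<forall>l\<in>set ls. wf_data_lit D l) \<longrightarrow>
         f (list_encode (map enc_data_lit ls)) = Some (of_bool (data_conj_sat D ls))))"


section \<open>Syntax of the description logic\<close>

datatype dterm =
    TRange data_range | TNeg dterm | TAnd dterm dterm | TOr dterm dterm | TConst dconst

datatype concept =
    CName nat
  | CTop
  | CBot
  | CNeg concept
  | COr concept concept
  | CAnd concept concept
  | CNom nat                               \<comment> \<open>\<open>{a}\<close>\<close>
  | CSelf arole                            \<comment> \<open>\<open>\<exists>R.Self\<close>\<close>
  | CHasInd arole nat                      \<comment> \<open>\<open>\<exists>R.{a}\<close>\<close>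
  | CHasConst crole dconst                 \<comment> \<open>\<open>\<exists>P.{e\<^sub>d}\<close>\<close>
and arole =
    RName nat
  | RUniv
  | RInv arole
  | RNeg arole
  | ROr arole arole
  | RAnd arole arole
  | RDom arole concept                     \<comment> \<open>\<open>R\<close> with first component restricted\<close>
  | RRan arole concept                     \<comment> \<open>\<open>R\<close> with second component restricted\<close>
  | RDomRan arole concept concept
  | RId concept
  | RProd concept concept
and crole =
    PName nat
  | PNeg crole
  | POr crole crole
  | PAnd crole crole
  | PDom crole concept
  | PRan crole dterm
  | PDomRan crole concept dterm

datatype rbox_ax =
    REquiv arole arole
  | RSub arole arole
  | RChain "arole list" arole              \<comment> \<open>\<open>R\<^sub>1 \<dots> R\<^sub>n \<sqsubseteq> R\<close>\<close>
  | RSym arole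
  | RAsym arole
  | RRef arole
  | RIrref arole
  | RDis arole arole
  | RTra arole
  | RFun arole
  | REquivProd arole concept concept       \<comment> \<open>\<open>R \<equiv> C\<^sub>1 \<times> C\<^sub>2\<close>\<close>
  | PEquiv crole crole
  | PSub crole crole
  | PDis crole crole
  | PFun crole

datatype tbox_ax =
    CEquiv concept concept
  | CSub concept concept
  | CSubAll concept arole concept          \<comment> \<open>\<open>C\<^sub>1 \<sqsubseteq> \<forall>R.C\<^sub>2\<close>\<close>
  | ExSub arole concept concept            \<comment> \<open>\<open>\<exists>R.C\<^sub>1 \<sqsubseteq> C\<^sub>2\<close>\<close>
  | AtLeastSub nat arole concept concept   \<comment> \<open>\<open>\<ge>\<^sub>n R.C\<^sub>1 \<sqsubseteq> C\<^sub>2\<close>\<close>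
  | SubAtMost concept nat arole concept    \<comment> \<open>\<open>C\<^sub>1 \<sqsubseteq> \<le>\<^sub>n R.C\<^sub>2\<close>\<close>
  | TEquiv dterm dterm
  | TSub dterm dterm
  | CSubAllD concept crole dterm           \<comment> \<open>\<open>C \<sqsubseteq> \<forall>P.t\<close>\<close>
  | ExSubD crole dterm concept             \<comment> \<open>\<open>\<exists>P.t \<sqsubseteq> C\<close>\<close>
  | AtLeastSubD nat crole dterm concept    \<comment> \<open>\<open>\<ge>\<^sub>n P.t \<sqsubseteq> C\<close>\<close>
  | SubAtMostD concept nat crole dterm     \<comment> \<open>\<open>C \<sqsubseteq> \<le>\<^sub>n P.t\<close>\<close>

datatype abox_as =
    IsA nat concept                        \<comment> \<open>\<open>a : C\<close>\<close>
  | Related nat nat arole                  \<comment> \<open>\<open>(a, b) : R\<close>\<close>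
  | Same nat nat                           \<comment> \<open>\<open>a = b\<close>\<close>
  | ConstIsA dconst dterm                  \<comment> \<open>\<open>e\<^sub>d : t\<close>\<close>
  | RelatedD nat dconst crole              \<comment> \<open>\<open>(a, e\<^sub>d) : P\<close>\<close>

type_synonym kb = "rbox_ax list \<times> tbox_ax list \<times> abox_as list"

text \<open>
  The sets of abstract role, concrete role, concept and individual names; they are disjoint
  because the syntax tags each kind of name by its constructor. The universal role is the
  constructor \<^const>\<open>RUniv\<close>, not a member of \<open>arole_names\<close>.
\<close>

record signature =
  arole_names :: "nat set"
  crole_names :: "nat set"
  concept_names :: "nat set"
  inds :: "nat set"

primrec wf_dterm :: "'u datatype_map \<Rightarrow> dterm \<Rightarrow> bool" where
  "wf_dterm D (TRange r) \<longleftrightarrow> wf_range D r"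
| "wf_dterm D (TNeg t) \<longleftrightarrow> wf_dterm D t"
| "wf_dterm D (TAnd s t) \<longleftrightarrow> wf_dterm D s \<and> wf_dterm D t"
| "wf_dterm D (TOr s t) \<longleftrightarrow> wf_dterm D s \<and> wf_dterm D t"
| "wf_dterm D (TConst c) \<longleftrightarrow> c \<in> all_consts D"

primrec
  wf_concept :: "signature \<Rightarrow> 'u datatype_map \<Rightarrow> concept \<Rightarrow> bool" and
  wf_arole :: "signature \<Rightarrow> 'u datatype_map \<Rightarrow> arole \<Rightarrow> bool" and
  wf_crole :: "signature \<Rightarrow> 'u datatype_map \<Rightarrow> crole \<Rightarrow> bool" where
  "wf_concept S D (CName A) \<longleftrightarrow> A \<in> concept_names S"
| "wf_concept S D CTop \<longleftrightarrow> True"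
| "wf_concept S D CBot \<longleftrightarrow> True"
| "wf_concept S D (CNeg C) \<longleftrightarrow> wf_concept S D C"
| "wf_concept S D (COr B C) \<longleftrightarrow> wf_concept S D B \<and> wf_concept S D C"
| "wf_concept S D (CAnd B C) \<longleftrightarrow> wf_concept S D B \<and> wf_concept S D C"
| "wf_concept S D (CNom a) \<longleftrightarrow> a \<in> inds S"
| "wf_concept S D (CSelf R) \<longleftrightarrow> wf_arole S D R"
| "wf_concept S D (CHasInd R a) \<longleftrightarrow> wf_arole S D R \<and> a \<in> inds S"
| "wf_concept S D (CHasConst P c) \<longleftrightarrow> wf_crole S D P \<and> c \<in> all_consts D"
| "wf_arole S D (RName r) \<longleftrightarrow> r \<in> arole_names S"
| "wf_arole S D RUniv \<longleftrightarrow> True"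
| "wf_arole S D (RInv R) \<longleftrightarrow> wf_arole S D R"
| "wf_arole S D (RNeg R) \<longleftrightarrow> wf_arole S D R"
| "wf_arole S D (ROr Q R) \<longleftrightarrow> wf_arole S D Q \<and> wf_arole S D R"
| "wf_arole S D (RAnd Q R) \<longleftrightarrow> wf_arole S D Q \<and> wf_arole S D R"
| "wf_arole S D (RDom R C) \<longleftrightarrow> wf_arole S D R \<and> wf_concept S D C"
| "wf_arole S D (RRan R C) \<longleftrightarrow> wf_arole S D R \<and> wf_concept S D C"
| "wf_arole S D (RDomRan R B C) \<longleftrightarrow> wf_arole S D R \<and> wf_concept S D B \<and> wf_concept S D C"
| "wf_arole S D (RId C) \<longleftrightarrow> wf_concept S D C"
| "wf_arole S D (RProd B C) \<longleftrightarrow> wf_concept S D B \<and> wf_concept S D C"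
| "wf_crole S D (PName p) \<longleftrightarrow> p \<in> crole_names S"
| "wf_crole S D (PNeg P) \<longleftrightarrow> wf_crole S D P"
| "wf_crole S D (POr P' P) \<longleftrightarrow> wf_crole S D P' \<and> wf_crole S D P"
| "wf_crole S D (PAnd P' P) \<longleftrightarrow> wf_crole S D P' \<and> wf_crole S D P"
| "wf_crole S D (PDom P C) \<longleftrightarrow> wf_crole S D P \<and> wf_concept S D C"
| "wf_crole S D (PRan P t) \<longleftrightarrow> wf_crole S D P \<and> wf_dterm D t"
| "wf_crole S D (PDomRan P C t) \<longleftrightarrow> wf_crole S D P \<and> wf_concept S D C \<and> wf_dterm D t"

primrec wf_rbox_ax :: "signature \<Rightarrow> 'u datatype_map \<Rightarrow> rbox_ax \<Rightarrow> bool" where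
  "wf_rbox_ax S D (REquiv Q R) \<longleftrightarrow> wf_arole S D Q \<and> wf_arole S D R"
| "wf_rbox_ax S D (RSub Q R) \<longleftrightarrow> wf_arole S D Q \<and> wf_arole S D R"
| "wf_rbox_ax S D (RChain Rs R) \<longleftrightarrow> Rs \<noteq> [] \<and> (\<forall>Q\<in>set Rs. wf_arole S D Q) \<and> wf_arole S D R"
| "wf_rbox_ax S D (RSym R) \<longleftrightarrow> wf_arole S D R"
| "wf_rbox_ax S D (RAsym R) \<longleftrightarrow> wf_arole S D R"
| "wf_rbox_ax S D (RRef R) \<longleftrightarrow> wf_arole S D R"
| "wf_rbox_ax S D (RIrref R) \<longleftrightarrow> wf_arole S D R"
| "wf_rbox_ax S D (RDis Q R) \<longleftrightarrow> wf_arole S D Q \<and> wf_arole S D R"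
| "wf_rbox_ax S D (RTra R) \<longleftrightarrow> wf_arole S D R"
| "wf_rbox_ax S D (RFun R) \<longleftrightarrow> wf_arole S D R"
| "wf_rbox_ax S D (REquivProd R B C) \<longleftrightarrow> wf_arole S D R \<and> wf_concept S D B \<and> wf_concept S D C"
| "wf_rbox_ax S D (PEquiv P' P) \<longleftrightarrow> wf_crole S D P' \<and> wf_crole S D P"
| "wf_rbox_ax S D (PSub P' P) \<longleftrightarrow> wf_crole S D P' \<and> wf_crole S D P"
| "wf_rbox_ax S D (PDis P' P) \<longleftrightarrow> wf_crole S D P' \<and> wf_crole S D P"
| "wf_rbox_ax S D (PFun P) \<longleftrightarrow> wf_crole S D P"

primrec wf_tbox_ax :: "signature \<Rightarrow> 'u datatype_map \<Rightarrow> tbox_ax \<Rightarrow> bool" where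
  "wf_tbox_ax S D (CEquiv B C) \<longleftrightarrow> wf_concept S D B \<and> wf_concept S D C"
| "wf_tbox_ax S D (CSub B C) \<longleftrightarrow> wf_concept S D B \<and> wf_concept S D C"
| "wf_tbox_ax S D (CSubAll B R C) \<longleftrightarrow> wf_concept S D B \<and> wf_arole S D R \<and> wf_concept S D C"
| "wf_tbox_ax S D (ExSub R B C) \<longleftrightarrow> wf_arole S D R \<and> wf_concept S D B \<and> wf_concept S D C"
| "wf_tbox_ax S D (AtLeastSub n R B C) \<longleftrightarrow> wf_arole S D R \<and> wf_concept S D B \<and> wf_concept S D C"
| "wf_tbox_ax S D (SubAtMost B n R C) \<longleftrightarrow> wf_concept S D B \<and> wf_arole S D R \<and> wf_concept S D C"
| "wf_tbox_ax S D (TEquiv s t) \<longleftrightarrow> wf_dterm D s \<and> wf_dterm D t"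
| "wf_tbox_ax S D (TSub s t) \<longleftrightarrow> wf_dterm D s \<and> wf_dterm D t"
| "wf_tbox_ax S D (CSubAllD C P t) \<longleftrightarrow> wf_concept S D C \<and> wf_crole S D P \<and> wf_dterm D t"
| "wf_tbox_ax S D (ExSubD P t C) \<longleftrightarrow> wf_crole S D P \<and> wf_dterm D t \<and> wf_concept S D C"
| "wf_tbox_ax S D (AtLeastSubD n P t C) \<longleftrightarrow> wf_crole S D P \<and> wf_dterm D t \<and> wf_concept S D C"
| "wf_tbox_ax S D (SubAtMostD C n P t) \<longleftrightarrow> wf_concept S D C \<and> wf_crole S D P \<and> wf_dterm D t"

primrec wf_abox_as :: "signature \<Rightarrow> 'u datatype_map \<Rightarrow> abox_as \<Rightarrow> bool" where
  "wf_abox_as S D (IsA a C) \<longleftrightarrow> a \<in> inds S \<and> wf_concept S D C"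
| "wf_abox_as S D (Related a b R) \<longleftrightarrow> a \<in> inds S \<and> b \<in> inds S \<and> wf_arole S D R"
| "wf_abox_as S D (Same a b) \<longleftrightarrow> a \<in> inds S \<and> b \<in> inds S"
| "wf_abox_as S D (ConstIsA c t) \<longleftrightarrow> c \<in> all_consts D \<and> wf_dterm D t"
| "wf_abox_as S D (RelatedD a c P) \<longleftrightarrow> a \<in> inds S \<and> c \<in> all_consts D \<and> wf_crole S D P"

definition wf_kb :: "signature \<Rightarrow> 'u datatype_map \<Rightarrow> kb \<Rightarrow> bool" where
  "wf_kb S D KB \<longleftrightarrow> (case KB of (\<R>, \<T>, \<A>) \<Rightarrow>
     (\<forall>x\<in>set \<R>. wf_rbox_ax S D x) \<and>
     (\<forall>x\<in>set \<T>. wf_tbox_ax S D x) \<and>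
     (\<forall>x\<in>set \<A>. wf_abox_as S D x))"


section \<open>Semantics\<close>

record 'u interp =
  adom :: "'u set"
  ddom :: "'u set"
  concept_int :: "nat \<Rightarrow> 'u set"
  ind_int :: "nat \<Rightarrow> 'u"
  arole_int :: "nat \<Rightarrow> ('u \<times> 'u) set"
  crole_int :: "nat \<Rightarrow> ('u \<times> 'u) set"

definition interpretation_of :: "signature \<Rightarrow> 'u datatype_map \<Rightarrow> 'u interp \<Rightarrow> bool" where
  "interpretation_of S D I \<longleftrightarrow>
     adom I \<noteq> {} \<and> ddom I \<noteq> {} \<and> adom I \<inter> ddom I = {} \<and>
     (\<forall>d\<in>dtypes D. dtype_int D d \<subseteq> ddom I) \<and>
     (\<forall>A\<in>concept_names S. concept_int I A \<subseteq> adom I) \<and>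
     (\<forall>a\<in>inds S. ind_int I a \<in> adom I) \<and>
     (\<forall>r\<in>arole_names S. arole_int I r \<subseteq> adom I \<times> adom I) \<and>
     (\<forall>p\<in>crole_names S. crole_int I p \<subseteq> adom I \<times> ddom I)"

primrec dterm_sem :: "'u datatype_map \<Rightarrow> 'u interp \<Rightarrow> dterm \<Rightarrow> 'u set" where
  "dterm_sem D I (TRange r) = range_sem D (ddom I) r"
| "dterm_sem D I (TNeg t) = ddom I - dterm_sem D I t"
| "dterm_sem D I (TAnd s t) = dterm_sem D I s \<inter> dterm_sem D I t"
| "dterm_sem D I (TOr s t) = dterm_sem D I s \<union> dterm_sem D I t"
| "dterm_sem D I (TConst c) = {const_val D c}"

primrec
  concept_sem :: "'u datatype_map \<Rightarrow> 'u interp \<Rightarrow> concept \<Rightarrow> 'u set" and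
  arole_sem :: "'u datatype_map \<Rightarrow> 'u interp \<Rightarrow> arole \<Rightarrow> ('u \<times> 'u) set" and
  crole_sem :: "'u datatype_map \<Rightarrow> 'u interp \<Rightarrow> crole \<Rightarrow> ('u \<times> 'u) set" where
  "concept_sem D I (CName A) = concept_int I A"
| "concept_sem D I CTop = adom I"
| "concept_sem D I CBot = {}"
| "concept_sem D I (CNeg C) = adom I - concept_sem D I C"
| "concept_sem D I (COr B C) = concept_sem D I B \<union> concept_sem D I C"
| "concept_sem D I (CAnd B C) = concept_sem D I B \<inter> concept_sem D I C"
| "concept_sem D I (CNom a) = {ind_int I a}"
| "concept_sem D I (CSelf R) = {x. (x, x) \<in> arole_sem D I R}"
| "concept_sem D I (CHasInd R a) = {x. (x, ind_int I a) \<in> arole_sem D I R}"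
| "concept_sem D I (CHasConst P c) = {x. (x, const_val D c) \<in> crole_sem D I P}"
| "arole_sem D I (RName r) = arole_int I r"
| "arole_sem D I RUniv = adom I \<times> adom I"
| "arole_sem D I (RInv R) = (arole_sem D I R)\<inverse>"
| "arole_sem D I (RNeg R) = adom I \<times> adom I - arole_sem D I R"
| "arole_sem D I (ROr Q R) = arole_sem D I Q \<union> arole_sem D I R"
| "arole_sem D I (RAnd Q R) = arole_sem D I Q \<inter> arole_sem D I R"
| "arole_sem D I (RDom R C) = {(x, y) \<in> arole_sem D I R. x \<in> concept_sem D I C}"
| "arole_sem D I (RRan R C) = {(x, y) \<in> arole_sem D I R. y \<in> concept_sem D I C}"
| "arole_sem D I (RDomRan R B C) =
     {(x, y) \<in> arole_sem D I R. x \<in> concept_sem D I B \<and> y \<in> concept_sem D I C}"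
| "arole_sem D I (RId C) = Id_on (concept_sem D I C)"
| "arole_sem D I (RProd B C) = concept_sem D I B \<times> concept_sem D I C"
| "crole_sem D I (PName p) = crole_int I p"
| "crole_sem D I (PNeg P) = adom I \<times> ddom I - crole_sem D I P"
| "crole_sem D I (POr P' P) = crole_sem D I P' \<union> crole_sem D I P"
| "crole_sem D I (PAnd P' P) = crole_sem D I P' \<inter> crole_sem D I P"
| "crole_sem D I (PDom P C) = {(x, y) \<in> crole_sem D I P. x \<in> concept_sem D I C}"
| "crole_sem D I (PRan P t) = {(x, y) \<in> crole_sem D I P. y \<in> dterm_sem D I t}"
| "crole_sem D I (PDomRan P C t) =
     {(x, y) \<in> crole_sem D I P. x \<in> concept_sem D I C \<and> y \<in> dterm_sem D I t}"

definition all_restr :: "'u interp \<Rightarrow> ('u \<times> 'u) set \<Rightarrow> 'u set \<Rightarrow> 'u set" where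
  "all_restr I r X = {x \<in> adom I. \<forall>y. (x, y) \<in> r \<longrightarrow> y \<in> X}"

definition ex_restr :: "'u interp \<Rightarrow> ('u \<times> 'u) set \<Rightarrow> 'u set \<Rightarrow> 'u set" where
  "ex_restr I r X = {x \<in> adom I. \<exists>y. (x, y) \<in> r \<and> y \<in> X}"

definition at_least :: "'u interp \<Rightarrow> nat \<Rightarrow> ('u \<times> 'u) set \<Rightarrow> 'u set \<Rightarrow> 'u set" where
  "at_least I n r X =
     {x \<in> adom I. infinite {y \<in> X. (x, y) \<in> r} \<or> n \<le> card {y \<in> X. (x, y) \<in> r}}"

definition at_most :: "'u interp \<Rightarrow> nat \<Rightarrow> ('u \<times> 'u) set \<Rightarrow> 'u set \<Rightarrow> 'u set" where
  "at_most I n r X =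
     {x \<in> adom I. finite {y \<in> X. (x, y) \<in> r} \<and> card {y \<in> X. (x, y) \<in> r} \<le> n}"

primrec sat_rbox_ax :: "'u datatype_map \<Rightarrow> 'u interp \<Rightarrow> rbox_ax \<Rightarrow> bool" where
  "sat_rbox_ax D I (REquiv Q R) \<longleftrightarrow> arole_sem D I Q = arole_sem D I R"
| "sat_rbox_ax D I (RSub Q R) \<longleftrightarrow> arole_sem D I Q \<subseteq> arole_sem D I R"
| "sat_rbox_ax D I (RChain Rs R) \<longleftrightarrow> foldr (O) (map (arole_sem D I) Rs) Id \<subseteq> arole_sem D I R"
| "sat_rbox_ax D I (RSym R) \<longleftrightarrow> sym (arole_sem D I R)"
| "sat_rbox_ax D I (RAsym R) \<longleftrightarrow> asym (arole_sem D I R)"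
| "sat_rbox_ax D I (RRef R) \<longleftrightarrow> refl_on (adom I) (arole_sem D I R)"
| "sat_rbox_ax D I (RIrref R) \<longleftrightarrow> irrefl (arole_sem D I R)"
| "sat_rbox_ax D I (RDis Q R) \<longleftrightarrow> arole_sem D I Q \<inter> arole_sem D I R = {}"
| "sat_rbox_ax D I (RTra R) \<longleftrightarrow> trans (arole_sem D I R)"
| "sat_rbox_ax D I (RFun R) \<longleftrightarrow> single_valued (arole_sem D I R)"
| "sat_rbox_ax D I (REquivProd R B C) \<longleftrightarrow> arole_sem D I R = concept_sem D I B \<times> concept_sem D I C"
| "sat_rbox_ax D I (PEquiv P' P) \<longleftrightarrow> crole_sem D I P' = crole_sem D I P"
| "sat_rbox_ax D I (PSub P' P) \<longleftrightarrow> crole_sem D I P' \<subseteq> crole_sem D I P"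
| "sat_rbox_ax D I (PDis P' P) \<longleftrightarrow> crole_sem D I P' \<inter> crole_sem D I P = {}"
| "sat_rbox_ax D I (PFun P) \<longleftrightarrow> single_valued (crole_sem D I P)"

primrec sat_tbox_ax :: "'u datatype_map \<Rightarrow> 'u interp \<Rightarrow> tbox_ax \<Rightarrow> bool" where
  "sat_tbox_ax D I (CEquiv B C) \<longleftrightarrow> concept_sem D I B = concept_sem D I C"
| "sat_tbox_ax D I (CSub B C) \<longleftrightarrow> concept_sem D I B \<subseteq> concept_sem D I C"
| "sat_tbox_ax D I (CSubAll B R C) \<longleftrightarrow>
     concept_sem D I B \<subseteq> all_restr I (arole_sem D I R) (concept_sem D I C)"
| "sat_tbox_ax D I (ExSub R B C) \<longleftrightarrow>
     ex_restr I (arole_sem D I R) (concept_sem D I B) \<subseteq> concept_sem D I C"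
| "sat_tbox_ax D I (AtLeastSub n R B C) \<longleftrightarrow>
     at_least I n (arole_sem D I R) (concept_sem D I B) \<subseteq> concept_sem D I C"
| "sat_tbox_ax D I (SubAtMost B n R C) \<longleftrightarrow>
     concept_sem D I B \<subseteq> at_most I n (arole_sem D I R) (concept_sem D I C)"
| "sat_tbox_ax D I (TEquiv s t) \<longleftrightarrow> dterm_sem D I s = dterm_sem D I t"
| "sat_tbox_ax D I (TSub s t) \<longleftrightarrow> dterm_sem D I s \<subseteq> dterm_sem D I t"
| "sat_tbox_ax D I (CSubAllD C P t) \<longleftrightarrow>
     concept_sem D I C \<subseteq> all_restr I (crole_sem D I P) (dterm_sem D I t)"
| "sat_tbox_ax D I (ExSubD P t C) \<longleftrightarrow>
     ex_restr I (crole_sem D I P) (dterm_sem D I t) \<subseteq> concept_sem D I C"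
| "sat_tbox_ax D I (AtLeastSubD n P t C) \<longleftrightarrow>
     at_least I n (crole_sem D I P) (dterm_sem D I t) \<subseteq> concept_sem D I C"
| "sat_tbox_ax D I (SubAtMostD C n P t) \<longleftrightarrow>
     concept_sem D I C \<subseteq> at_most I n (crole_sem D I P) (dterm_sem D I t)"

primrec sat_abox_as :: "'u datatype_map \<Rightarrow> 'u interp \<Rightarrow> abox_as \<Rightarrow> bool" where
  "sat_abox_as D I (IsA a C) \<longleftrightarrow> ind_int I a \<in> concept_sem D I C"
| "sat_abox_as D I (Related a b R) \<longleftrightarrow> (ind_int I a, ind_int I b) \<in> arole_sem D I R"
| "sat_abox_as D I (Same a b) \<longleftrightarrow> ind_int I a = ind_int I b"
| "sat_abox_as D I (ConstIsA c t) \<longleftrightarrow> const_val D c \<in> dterm_sem D I t"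
| "sat_abox_as D I (RelatedD a c P) \<longleftrightarrow> (ind_int I a, const_val D c) \<in> crole_sem D I P"

definition sat_kb :: "'u datatype_map \<Rightarrow> 'u interp \<Rightarrow> kb \<Rightarrow> bool" where
  "sat_kb D I KB \<longleftrightarrow> (case KB of (\<R>, \<T>, \<A>) \<Rightarrow>
     (\<forall>x\<in>set \<R>. sat_rbox_ax D I x) \<and>
     (\<forall>x\<in>set \<T>. sat_tbox_ax D I x) \<and>
     (\<forall>x\<in>set \<A>. sat_abox_as D I x))"


section \<open>Conjunctive queries and their answer sets\<close>

datatype obj = Ind nat | Const dconst

datatype qterm = Var nat | Obj obj

datatype atom =
    ARole arole qterm qterm
  | CRole crole qterm qterm
  | Conc concept qterm
  | Eq qterm qterm

datatype literal = Pos atom | Neg atom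

type_synonym query = "literal list"

type_synonym subst = "nat \<rightharpoonup> obj"

definition objs :: "signature \<Rightarrow> 'u datatype_map \<Rightarrow> obj set" where
  "objs S D = Ind ` inds S \<union> Const ` all_consts D"

definition abs_term :: "signature \<Rightarrow> qterm \<Rightarrow> bool" where
  "abs_term S w \<longleftrightarrow> w \<in> range Var \<union> (Obj \<circ> Ind) ` inds S"

definition data_term :: "'u datatype_map \<Rightarrow> qterm \<Rightarrow> bool" where
  "data_term D u \<longleftrightarrow> u \<in> range Var \<union> (Obj \<circ> Const) ` all_consts D"

primrec wf_atom :: "signature \<Rightarrow> 'u datatype_map \<Rightarrow> atom \<Rightarrow> bool" where
  "wf_atom S D (ARole R v w) \<longleftrightarrow> wf_arole S D R \<and> abs_term S v \<and> abs_term S w"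
| "wf_atom S D (CRole P w u) \<longleftrightarrow> wf_crole S D P \<and> abs_term S w \<and> data_term D u"
| "wf_atom S D (Conc C w) \<longleftrightarrow> wf_concept S D C \<and> abs_term S w"
| "wf_atom S D (Eq s t) \<longleftrightarrow> (abs_term S s \<and> abs_term S t) \<or> (data_term D s \<and> data_term D t)"

primrec lit_atom :: "literal \<Rightarrow> atom" where
  "lit_atom (Pos a) = a"
| "lit_atom (Neg a) = a"

definition wf_query :: "signature \<Rightarrow> 'u datatype_map \<Rightarrow> query \<Rightarrow> bool" where
  "wf_query S D Q \<longleftrightarrow> (\<forall>l\<in>set Q. wf_atom S D (lit_atom l))"

primrec qterm_vars :: "qterm \<Rightarrow> nat set" where
  "qterm_vars (Var v) = {v}"
| "qterm_vars (Obj x) = {}"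

primrec atom_vars :: "atom \<Rightarrow> nat set" where
  "atom_vars (ARole R v w) = qterm_vars v \<union> qterm_vars w"
| "atom_vars (CRole P w u) = qterm_vars w \<union> qterm_vars u"
| "atom_vars (Conc C w) = qterm_vars w"
| "atom_vars (Eq s t) = qterm_vars s \<union> qterm_vars t"

definition query_vars :: "query \<Rightarrow> nat set" where
  "query_vars Q = (\<Union>l\<in>set Q. atom_vars (lit_atom l))"

definition substitution :: "signature \<Rightarrow> 'u datatype_map \<Rightarrow> subst \<Rightarrow> bool" where
  "substitution S D \<sigma> \<longleftrightarrow> finite (dom \<sigma>) \<and> ran \<sigma> \<subseteq> objs S D"

primrec subst_qterm :: "subst \<Rightarrow> qterm \<Rightarrow> qterm" where
  "subst_qterm \<sigma> (Var v) = (case \<sigma> v of None \<Rightarrow> Var v | Some x \<Rightarrow> Obj x)"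
| "subst_qterm \<sigma> (Obj x) = Obj x"

primrec subst_atom :: "subst \<Rightarrow> atom \<Rightarrow> atom" where
  "subst_atom \<sigma> (ARole R v w) = ARole R (subst_qterm \<sigma> v) (subst_qterm \<sigma> w)"
| "subst_atom \<sigma> (CRole P w u) = CRole P (subst_qterm \<sigma> w) (subst_qterm \<sigma> u)"
| "subst_atom \<sigma> (Conc C w) = Conc C (subst_qterm \<sigma> w)"
| "subst_atom \<sigma> (Eq s t) = Eq (subst_qterm \<sigma> s) (subst_qterm \<sigma> t)"

primrec subst_lit :: "subst \<Rightarrow> literal \<Rightarrow> literal" where
  "subst_lit \<sigma> (Pos a) = Pos (subst_atom \<sigma> a)"
| "subst_lit \<sigma> (Neg a) = Neg (subst_atom \<sigma> a)"

definition subst_query :: "subst \<Rightarrow> query \<Rightarrow> query" where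
  "subst_query \<sigma> Q = map (subst_lit \<sigma>) Q"

text \<open>Satisfaction is only used for ground queries; the value of a variable is irrelevant.\<close>

fun qterm_val :: "'u datatype_map \<Rightarrow> 'u interp \<Rightarrow> qterm \<Rightarrow> 'u" where
  "qterm_val D I (Obj (Ind a)) = ind_int I a"
| "qterm_val D I (Obj (Const c)) = const_val D c"
| "qterm_val D I (Var v) = undefined"

primrec sat_atom :: "'u datatype_map \<Rightarrow> 'u interp \<Rightarrow> atom \<Rightarrow> bool" where
  "sat_atom D I (ARole R v w) \<longleftrightarrow> (qterm_val D I v, qterm_val D I w) \<in> arole_sem D I R"
| "sat_atom D I (CRole P w u) \<longleftrightarrow> (qterm_val D I w, qterm_val D I u) \<in> crole_sem D I P"
| "sat_atom D I (Conc C w) \<longleftrightarrow> qterm_val D I w \<in> concept_sem D I C"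
| "sat_atom D I (Eq s t) \<longleftrightarrow> qterm_val D I s = qterm_val D I t"

primrec sat_lit :: "'u datatype_map \<Rightarrow> 'u interp \<Rightarrow> literal \<Rightarrow> bool" where
  "sat_lit D I (Pos a) \<longleftrightarrow> sat_atom D I a"
| "sat_lit D I (Neg a) \<longleftrightarrow> \<not> sat_atom D I a"

definition sat_query :: "'u datatype_map \<Rightarrow> 'u interp \<Rightarrow> query \<Rightarrow> bool" where
  "sat_query D I Q \<longleftrightarrow> (\<forall>l\<in>set Q. sat_lit D I l)"

text \<open>
  The instantiated query is required to be a query again. This excludes substitutions that
  put a constant in the place of an individual or vice versa, for which satisfaction of a
  (negated) atom is meaningless.
\<close>

definition solution ::
  "signature \<Rightarrow> 'u datatype_map \<Rightarrow> kb \<Rightarrow> query \<Rightarrow> subst \<Rightarrow> bool" where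
  "solution S D KB Q \<sigma> \<longleftrightarrow>
     substitution S D \<sigma> \<and> dom \<sigma> = query_vars Q \<and> wf_query S D (subst_query \<sigma> Q) \<and>
     (\<exists>I. interpretation_of S D I \<and> sat_kb D I KB \<and> sat_query D I (subst_query \<sigma> Q))"

definition answer_set :: "signature \<Rightarrow> 'u datatype_map \<Rightarrow> kb \<Rightarrow> query \<Rightarrow> subst set" where
  "answer_set S D KB Q = {\<sigma>. solution S D KB Q \<sigma>}"


section \<open>Encoding of the inputs and outputs of algorithms\<close>

primrec enc_dterm :: "dterm \<Rightarrow> nat" where
  "enc_dterm (TRange r) = node 0 [enc_range r]"
| "enc_dterm (TNeg t) = node 1 [enc_dterm t]"
| "enc_dterm (TAnd s t) = node 2 [enc_dterm s, enc_dterm t]"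
| "enc_dterm (TOr s t) = node 3 [enc_dterm s, enc_dterm t]"
| "enc_dterm (TConst c) = node 4 [prod_encode c]"

primrec
  enc_concept :: "concept \<Rightarrow> nat" and
  enc_arole :: "arole \<Rightarrow> nat" and
  enc_crole :: "crole \<Rightarrow> nat" where
  "enc_concept (CName A) = node 0 [A]"
| "enc_concept CTop = node 1 []"
| "enc_concept CBot = node 2 []"
| "enc_concept (CNeg C) = node 3 [enc_concept C]"
| "enc_concept (COr B C) = node 4 [enc_concept B, enc_concept C]"
| "enc_concept (CAnd B C) = node 5 [enc_concept B, enc_concept C]"
| "enc_concept (CNom a) = node 6 [a]"
| "enc_concept (CSelf R) = node 7 [enc_arole R]"
| "enc_concept (CHasInd R a) = node 8 [enc_arole R, a]"
| "enc_concept (CHasConst P c) = node 9 [enc_crole P, prod_encode c]"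
| "enc_arole (RName r) = node 0 [r]"
| "enc_arole RUniv = node 1 []"
| "enc_arole (RInv R) = node 2 [enc_arole R]"
| "enc_arole (RNeg R) = node 3 [enc_arole R]"
| "enc_arole (ROr Q R) = node 4 [enc_arole Q, enc_arole R]"
| "enc_arole (RAnd Q R) = node 5 [enc_arole Q, enc_arole R]"
| "enc_arole (RDom R C) = node 6 [enc_arole R, enc_concept C]"
| "enc_arole (RRan R C) = node 7 [enc_arole R, enc_concept C]"
| "enc_arole (RDomRan R B C) = node 8 [enc_arole R, enc_concept B, enc_concept C]"
| "enc_arole (RId C) = node 9 [enc_concept C]"
| "enc_arole (RProd B C) = node 10 [enc_concept B, enc_concept C]"
| "enc_crole (PName p) = node 0 [p]"
| "enc_crole (PNeg P) = node 1 [enc_crole P]"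
| "enc_crole (POr P' P) = node 2 [enc_crole P', enc_crole P]"
| "enc_crole (PAnd P' P) = node 3 [enc_crole P', enc_crole P]"
| "enc_crole (PDom P C) = node 4 [enc_crole P, enc_concept C]"
| "enc_crole (PRan P t) = node 5 [enc_crole P, enc_dterm t]"
| "enc_crole (PDomRan P C t) = node 6 [enc_crole P, enc_concept C, enc_dterm t]"

primrec enc_rbox_ax :: "rbox_ax \<Rightarrow> nat" where
  "enc_rbox_ax (REquiv Q R) = node 0 [enc_arole Q, enc_arole R]"
| "enc_rbox_ax (RSub Q R) = node 1 [enc_arole Q, enc_arole R]"
| "enc_rbox_ax (RChain Rs R) = node 2 [list_encode (map enc_arole Rs), enc_arole R]"
| "enc_rbox_ax (RSym R) = node 3 [enc_arole R]"
| "enc_rbox_ax (RAsym R) = node 4 [enc_arole R]"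
| "enc_rbox_ax (RRef R) = node 5 [enc_arole R]"
| "enc_rbox_ax (RIrref R) = node 6 [enc_arole R]"
| "enc_rbox_ax (RDis Q R) = node 7 [enc_arole Q, enc_arole R]"
| "enc_rbox_ax (RTra R) = node 8 [enc_arole R]"
| "enc_rbox_ax (RFun R) = node 9 [enc_arole R]"
| "enc_rbox_ax (REquivProd R B C) = node 10 [enc_arole R, enc_concept B, enc_concept C]"
| "enc_rbox_ax (PEquiv P' P) = node 11 [enc_crole P', enc_crole P]"
| "enc_rbox_ax (PSub P' P) = node 12 [enc_crole P', enc_crole P]"
| "enc_rbox_ax (PDis P' P) = node 13 [enc_crole P', enc_crole P]"
| "enc_rbox_ax (PFun P) = node 14 [enc_crole P]"

primrec enc_tbox_ax :: "tbox_ax \<Rightarrow> nat" where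
  "enc_tbox_ax (CEquiv B C) = node 0 [enc_concept B, enc_concept C]"
| "enc_tbox_ax (CSub B C) = node 1 [enc_concept B, enc_concept C]"
| "enc_tbox_ax (CSubAll B R C) = node 2 [enc_concept B, enc_arole R, enc_concept C]"
| "enc_tbox_ax (ExSub R B C) = node 3 [enc_arole R, enc_concept B, enc_concept C]"
| "enc_tbox_ax (AtLeastSub n R B C) = node 4 [n, enc_arole R, enc_concept B, enc_concept C]"
| "enc_tbox_ax (SubAtMost B n R C) = node 5 [enc_concept B, n, enc_arole R, enc_concept C]"
| "enc_tbox_ax (TEquiv s t) = node 6 [enc_dterm s, enc_dterm t]"
| "enc_tbox_ax (TSub s t) = node 7 [enc_dterm s, enc_dterm t]"
| "enc_tbox_ax (CSubAllD C P t) = node 8 [enc_concept C, enc_crole P, enc_dterm t]"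
| "enc_tbox_ax (ExSubD P t C) = node 9 [enc_crole P, enc_dterm t, enc_concept C]"
| "enc_tbox_ax (AtLeastSubD n P t C) = node 10 [n, enc_crole P, enc_dterm t, enc_concept C]"
| "enc_tbox_ax (SubAtMostD C n P t) = node 11 [enc_concept C, n, enc_crole P, enc_dterm t]"

primrec enc_abox_as :: "abox_as \<Rightarrow> nat" where
  "enc_abox_as (IsA a C) = node 0 [a, enc_concept C]"
| "enc_abox_as (Related a b R) = node 1 [a, b, enc_arole R]"
| "enc_abox_as (Same a b) = node 2 [a, b]"
| "enc_abox_as (ConstIsA c t) = node 3 [prod_encode c, enc_dterm t]"
| "enc_abox_as (RelatedD a c P) = node 4 [a, prod_encode c, enc_crole P]"

definition enc_kb :: "kb \<Rightarrow> nat" where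
  "enc_kb KB = (case KB of (\<R>, \<T>, \<A>) \<Rightarrow>
     list_encode [list_encode (map enc_rbox_ax \<R>), list_encode (map enc_tbox_ax \<T>),
       list_encode (map enc_abox_as \<A>)])"

primrec enc_obj :: "obj \<Rightarrow> nat" where
  "enc_obj (Ind a) = node 0 [a]"
| "enc_obj (Const c) = node 1 [prod_encode c]"

primrec enc_qterm :: "qterm \<Rightarrow> nat" where
  "enc_qterm (Var v) = node 0 [v]"
| "enc_qterm (Obj x) = node 1 [enc_obj x]"

primrec enc_atom :: "atom \<Rightarrow> nat" where
  "enc_atom (ARole R v w) = node 0 [enc_arole R, enc_qterm v, enc_qterm w]"
| "enc_atom (CRole P w u) = node 1 [enc_crole P, enc_qterm w, enc_qterm u]"
| "enc_atom (Conc C w) = node 2 [enc_concept C, enc_qterm w]"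
| "enc_atom (Eq s t) = node 3 [enc_qterm s, enc_qterm t]"

primrec enc_lit :: "literal \<Rightarrow> nat" where
  "enc_lit (Pos a) = node 0 [enc_atom a]"
| "enc_lit (Neg a) = node 1 [enc_atom a]"

definition enc_query :: "query \<Rightarrow> nat" where
  "enc_query Q = list_encode (map enc_lit Q)"

text \<open>A substitution is coded by the list of its bindings, in increasing order of variables.\<close>

definition enc_subst :: "subst \<Rightarrow> nat" where
  "enc_subst \<sigma> =
     list_encode (map (\<lambda>v. prod_encode (v, enc_obj (the (\<sigma> v)))) (sorted_list_of_set (dom \<sigma>)))"

lemma enc_obj_eq_iff [simp]: "enc_obj x = enc_obj y \<longleftrightarrow> x = y"
  by (cases x; cases y) auto

lemma enc_subst_inj:
  assumes "finite (dom \<sigma>)" "finite (dom \<tau>)" "enc_subst \<sigma> = enc_subst \<tau>"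
  shows "\<sigma> = \<tau>"
proof -
  let ?b = "\<lambda>\<sigma> v. (v, enc_obj (the (\<sigma> v)))"
  have "map (prod_encode \<circ> ?b \<sigma>) (sorted_list_of_set (dom \<sigma>)) =
        map (prod_encode \<circ> ?b \<tau>) (sorted_list_of_set (dom \<tau>))"
    using assms(3) by (simp add: enc_subst_def comp_def list_encode_eq)
  hence "set (map (prod_encode \<circ> ?b \<sigma>) (sorted_list_of_set (dom \<sigma>))) =
         set (map (prod_encode \<circ> ?b \<tau>) (sorted_list_of_set (dom \<tau>)))" by simp
  hence "prod_encode ` ?b \<sigma> ` dom \<sigma> = prod_encode ` ?b \<tau> ` dom \<tau>"
    using assms(1,2) by (simp add: image_comp)
  hence eq: "?b \<sigma> ` dom \<sigma> = ?b \<tau> ` dom \<tau>"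
    by (simp add: inj_image_eq_iff inj_prod_encode)
  have d: "dom \<sigma> = dom \<tau>"
    using arg_cong[OF eq, of "image fst"] by (simp add: image_comp comp_def)
  have "the (\<sigma> v) = the (\<tau> v)" if "v \<in> dom \<sigma>" for v
  proof -
    have "?b \<sigma> v \<in> ?b \<tau> ` dom \<tau>" using that eq by blast
    thus ?thesis by auto
  qed
  thus ?thesis using d by (metis domIff ext option.expand)
qed

end

theory Submission
  imports Defs "HOL-Library.FuncSet"
begin

text \<open>
  Every statement of a knowledge base is universal, so satisfiability is preserved when the abstract
  domain of an interpretation is shrunk to the named individuals and the data domain to the data
  values. What then matters about a data value is its type, i.e. the set of data ranges of the
  input that contain it. The number of values of a type, up to a bound, is obtained from the
  decision procedure for data conjunctions, and by the pigeonhole principle boundedly many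
  values of each type are enough to decide number restrictions. It remains to search the finitely
  many finite structures over the named individuals and these representatives.
\<close>

section \<open>Total recursive functions and decidable predicates\<close>

text \<open>Two circumstances shape the procedure. The decision procedure for data conjunctions is a
  partial function, specified only on codes of well-formed conjunctions. Hence all calls to it come
  before the search: they run over a list of queries built from ranges that really occur in the
  input, the satisfiable queries form a list \<open>w\<close>, and the search is a total decidable
  predicate of the input code \<open>N\<close> and \<open>w\<close>. Secondly, membership in the
  signature is not assumed decidable. So every number up to \<open>N\<close> is treated as an
  individual name, and a constant is recognised only as the element whose type contains its
  singleton range. The number \<open>N\<close> also bounds all names, subexpressions and bounds of
  number restrictions. The two directions are asymmetric. From an interpretation one gets an
  embedded finite structure, in which counts can only drop. Conversely the interpretation is built
  over all data values, where a representative may stand for many of them, and counts up to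
  \<open>N\<close> must survive. The elements outside the data values leave room for an abstract
  domain disjoint from the data domain.\<close>

definition pr :: "nat \<Rightarrow> nat \<Rightarrow> nat" where "pr a b = prod_encode (a, b)"
definition pr1 :: "nat \<Rightarrow> nat" where "pr1 n = fst (prod_decode n)"
definition pr2 :: "nat \<Rightarrow> nat" where "pr2 n = snd (prod_decode n)"

lemma pr1_pr [simp]: "pr1 (pr a b) = a"
  and pr2_pr [simp]: "pr2 (pr a b) = b"
  and pr_collapse [simp]: "pr (pr1 n) (pr2 n) = n"
  by (simp_all add: pr_def pr1_def pr2_def)

lemma pr_eq_iff [simp]: "pr a b = pr c d \<longleftrightarrow> a = c \<and> b = d"
  by (simp add: pr_def)

lemma pr_ge1: "a \<le> pr a b" and pr_ge2: "b \<le> pr a b"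
  by (simp_all add: pr_def le_prod_encode_1 le_prod_encode_2)

lemma pr_mono: "a \<le> c \<Longrightarrow> b \<le> d \<Longrightarrow> pr a b \<le> pr c d"
proof -
  assume a: "a \<le> c" "b \<le> d"
  hence "triangle (a + b) \<le> triangle (c + d)"
    unfolding triangle_def by (intro div_le_mono mult_le_mono) auto
  thus ?thesis using a by (simp add: pr_def prod_encode_def)
qed

definition recursive :: "(nat \<Rightarrow> nat) \<Rightarrow> bool" where
  "recursive f \<longleftrightarrow> partrec (\<lambda>n. Some (f n))"

definition decidable :: "(nat \<Rightarrow> bool) \<Rightarrow> bool" where
  "decidable P \<longleftrightarrow> recursive (\<lambda>n. of_bool (P n))"

named_theorems rec_intros

lemma recursive_comp: "recursive f \<Longrightarrow> recursive g \<Longrightarrow> recursive (\<lambda>x. f (g x))"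
  unfolding recursive_def using partrec.comp[of "\<lambda>n. Some (f n)" "\<lambda>n. Some (g n)"] by simp

lemma decidable_comp: "decidable P \<Longrightarrow> recursive g \<Longrightarrow> decidable (\<lambda>x. P (g x))"
  unfolding decidable_def by (rule recursive_comp)

lemma recursive_pr [rec_intros]:
  "recursive f \<Longrightarrow> recursive g \<Longrightarrow> recursive (\<lambda>x. pr (f x) (g x))"
  unfolding recursive_def pr_def using partrec.pair[of "\<lambda>n. Some (f n)" "\<lambda>n. Some (g n)"] by simp

lemma recursive_pr1 [rec_intros]: "recursive f \<Longrightarrow> recursive (\<lambda>x. pr1 (f x))"
  by (rule recursive_comp[of pr1]) (simp_all add: recursive_def pr1_def[abs_def] partrec.left)

lemma recursive_pr2 [rec_intros]: "recursive f \<Longrightarrow> recursive (\<lambda>x. pr2 (f x))"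
  by (rule recursive_comp[of pr2]) (simp_all add: recursive_def pr2_def[abs_def] partrec.right)

lemma recursive_Suc [rec_intros]: "recursive f \<Longrightarrow> recursive (\<lambda>x. Suc (f x))"
  by (rule recursive_comp[of Suc]) (simp_all add: recursive_def partrec.succ)

text \<open>The identity is not among the generators; it is the pairing of the two
  projections.\<close>

lemma recursive_id [rec_intros]: "recursive (\<lambda>x. x)"
  using recursive_pr[of pr1 pr2] recursive_comp[of pr1 "\<lambda>x. x"]
  by (simp add: recursive_def pr1_def[abs_def] pr2_def[abs_def] partrec.left partrec.right pr_def)

lemma recursive_const [rec_intros]: "recursive (\<lambda>x. c)"
  by (induction c) (simp_all add: recursive_Suc, simp add: recursive_def partrec.zero)

lemma rec_nat_bind_Some:
  "rec_nat (Some a) (\<lambda>k r. Option.bind r (\<lambda>i. Some (g k i))) n = Some (rec_nat a g n)"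
  by (induction n) auto

text \<open>The step function is tested on one coded triple of parameter, counter and previous
  value, so that \<open>intro rec_intros\<close> can proceed below the binders. The rules for the
  other binding operators follow the same scheme.\<close>

lemma recursive_rec_nat [rec_intros]:
  assumes "recursive a" "recursive (\<lambda>z. g (pr1 z) (pr1 (pr2 z)) (pr2 (pr2 z)))" "recursive n"
  shows "recursive (\<lambda>x. rec_nat (a x) (g x) (n x))"
proof -
  let ?g = "\<lambda>z. g (pr1 z) (pr1 (pr2 z)) (pr2 (pr2 z))"
  have "recursive (\<lambda>z. rec_nat (a (pr1 z)) (\<lambda>k i. ?g (pr (pr1 z) (pr k i))) (pr2 z))"
    using partrec.prec[OF assms(1,2)[unfolded recursive_def]]
    by (simp add: recursive_def rec_nat_bind_Some pr_def pr1_def pr2_def)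
  from recursive_comp[OF this recursive_pr[OF recursive_id assms(3)]]
  show ?thesis by simp
qed

section \<open>Arithmetic, connectives and bounded quantifiers\<close>

lemma recursive_add [rec_intros]:
  assumes "recursive f" "recursive g" shows "recursive (\<lambda>x. f x + g x)"
proof -
  have "rec_nat a (\<lambda>k. Suc) b = a + b" for a b by (induction b) auto
  moreover have "recursive (\<lambda>x. rec_nat (f x) (\<lambda>k. Suc) (g x))"
    by (intro rec_intros assms)
  ultimately show ?thesis by simp
qed

lemma recursive_mult [rec_intros]:
  assumes "recursive f" "recursive g" shows "recursive (\<lambda>x. f x * g x)"
proof -
  have "rec_nat 0 (\<lambda>k r. r + a) b = a * b" for a b :: nat by (induction b) auto
  moreover have "recursive (\<lambda>x. rec_nat 0 (\<lambda>k r. r + f x) (g x))"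
    by (intro rec_intros assms recursive_comp[OF assms(1)])
  ultimately show ?thesis by simp
qed

lemma recursive_power [rec_intros]:
  assumes "recursive f" "recursive g" shows "recursive (\<lambda>x. f x ^ g x)"
proof -
  have "rec_nat 1 (\<lambda>k r. r * a) b = a ^ b" for a b :: nat by (induction b) auto
  moreover have "recursive (\<lambda>x. rec_nat 1 (\<lambda>k r. r * f x) (g x))"
    by (intro rec_intros assms recursive_comp[OF assms(1)])
  ultimately show ?thesis by simp
qed

lemma recursive_diff [rec_intros]:
  assumes "recursive f" "recursive g" shows "recursive (\<lambda>x. f x - g x)"
proof -
  \<comment> \<open>Predecessor: a recursion that returns its own counter.\<close>
  have 1: "rec_nat 0 (\<lambda>k r. k) b = b - 1" for b :: nat by (cases b) auto
  have 2: "rec_nat a (\<lambda>k r. r - 1) b = a - b" for a b :: nat by (induction b) auto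
  have "recursive (\<lambda>x. rec_nat 0 (\<lambda>k r. k) (h x))" if "recursive h" for h
    by (intro rec_intros that)
  hence [rec_intros]: "recursive (\<lambda>x. h x - 1)" if "recursive h" for h
    unfolding 1 using that by blast
  have "recursive (\<lambda>x. rec_nat (f x) (\<lambda>k r. r - 1) (g x))"
    by (intro rec_intros assms)
  thus ?thesis by (simp only: 2)
qed

lemma recursive_of_bool [rec_intros]: "decidable P \<Longrightarrow> recursive (\<lambda>x. of_bool (P x))"
  by (simp add: decidable_def)

lemma decidable_eq_0: 
  assumes "recursive f" shows "decidable (\<lambda>x. f x = 0)"
proof -
  have "recursive (\<lambda>x. 1 - f x)" by (intro rec_intros assms)
  moreover have "1 - n = of_bool (n = 0)" for n :: nat by auto
  ultimately show ?thesis unfolding decidable_def by simp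
qed

lemma decidable_not [rec_intros]: "decidable P \<Longrightarrow> decidable (\<lambda>x. \<not> P x)"
  using decidable_eq_0[of "\<lambda>x. of_bool (P x)"] by (simp add: decidable_def)

lemma decidable_conj [rec_intros]:
  "decidable P \<Longrightarrow> decidable Q \<Longrightarrow> decidable (\<lambda>x. P x \<and> Q x)"
  unfolding decidable_def of_bool_conj by (rule recursive_mult)

lemma decidable_disj [rec_intros]:
  assumes "decidable P" "decidable Q" shows "decidable (\<lambda>x. P x \<or> Q x)"
  using decidable_not[OF decidable_conj[OF assms[THEN decidable_not]]] by simp

lemma decidable_imp [rec_intros]:
  assumes "decidable P" "decidable Q" shows "decidable (\<lambda>x. P x \<longrightarrow> Q x)"
  using decidable_disj[OF decidable_not[OF assms(1)] assms(2)] by (simp only: imp_conv_disj)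

lemma decidable_le [rec_intros]:
  assumes "recursive f" "recursive g" shows "decidable (\<lambda>x. f x \<le> g x)"
  using decidable_eq_0[OF recursive_diff[OF assms]] by simp

lemma decidable_less [rec_intros]:
  assumes "recursive f" "recursive g" shows "decidable (\<lambda>x. f x < g x)"
  using decidable_le[OF recursive_Suc[OF assms(1)] assms(2)] by (simp add: Suc_le_eq)

lemma decidable_eq [rec_intros]:
  assumes "recursive f" "recursive g" shows "decidable (\<lambda>x. f x = g x)"
  using decidable_conj[OF decidable_le[OF assms] decidable_le[OF assms(2,1)]] by (simp add: eq_iff)

lemma decidable_iff [rec_intros]:
  assumes "decidable P" "decidable Q" shows "decidable (\<lambda>x. P x = Q x)"
  using decidable_conj[OF decidable_imp[OF assms] decidable_imp[OF assms(2,1)]]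
  by (simp only: iff_conv_conj_imp)

lemma recursive_If [rec_intros]:
  assumes "decidable P" "recursive f" "recursive g"
  shows "recursive (\<lambda>x. if P x then f x else g x)"
proof -
  have "recursive (\<lambda>x. of_bool (P x) * f x + of_bool (\<not> P x) * g x)"
    by (intro rec_intros assms)
  moreover have "of_bool p * a + of_bool (\<not> p) * b = (if p then a else b)" for p and a b :: nat
    by auto
  ultimately show ?thesis by simp
qed

text \<open>Counting is a primitive recursion. Bounded quantifiers reduce to it, a witness existing
  iff the count is nonzero, and the evaluation of number restrictions uses it directly.\<close>

lemma recursive_card [rec_intros]:
  assumes "decidable (\<lambda>z. P (pr1 z) (pr2 z))" "recursive b"
  shows "recursive (\<lambda>x. card {y. y < b x \<and> P x y})"
proof -
  have "rec_nat 0 (\<lambda>k r. r + of_bool (Q k)) n = card {y. y < n \<and> Q y}" for Q n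
  proof (induction n)
    case (Suc n)
    have "{y. y < Suc n \<and> Q y} = {y. y < n \<and> Q y} \<union> (if Q n then {n} else {})"
      by (auto simp: less_Suc_eq)
    moreover have "finite {y. y < n \<and> Q y}" by simp
    ultimately show ?case using Suc by (auto simp: card_Un_disjoint)
  qed auto
  moreover have "recursive (\<lambda>x. rec_nat 0 (\<lambda>k r. r + of_bool (P x k)) (b x))"
  proof -
    have "recursive (\<lambda>z. pr (pr1 z) (pr1 (pr2 z)))" by (intro rec_intros)
    from decidable_comp[OF assms(1) this]
    have "decidable (\<lambda>z. P (pr1 z) (pr1 (pr2 z)))" by simp
    thus ?thesis by (intro rec_intros assms)
  qed
  ultimately show ?thesis by simp
qed

lemma decidable_ex_less [rec_intros]:
  assumes "decidable (\<lambda>z. P (pr1 z) (pr2 z))" "recursive b"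
  shows "decidable (\<lambda>x. \<exists>y<b x. P x y)"
proof -
  have "decidable (\<lambda>x. \<not> card {y. y < b x \<and> P x y} = 0)"
    by (intro rec_intros assms)
  thus ?thesis by simp
qed

lemma decidable_all_less [rec_intros]:
  assumes "decidable (\<lambda>z. P (pr1 z) (pr2 z))" "recursive b"
  shows "decidable (\<lambda>x. \<forall>y<b x. P x y)"
  using decidable_not[OF decidable_ex_less[OF decidable_not[OF assms(1)] assms(2)]] by simp

lemma decidable_ex_le [rec_intros]:
  assumes "decidable (\<lambda>z. P (pr1 z) (pr2 z))" "recursive b"
  shows "decidable (\<lambda>x. \<exists>y\<le>b x. P x y)"
  using decidable_ex_less[OF assms(1) recursive_Suc[OF assms(2)]] by (simp add: less_Suc_eq_le)

lemma decidable_all_le [rec_intros]: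
  assumes "decidable (\<lambda>z. P (pr1 z) (pr2 z))" "recursive b"
  shows "decidable (\<lambda>x. \<forall>y\<le>b x. P x y)"
  using decidable_all_less[OF assms(1) recursive_Suc[OF assms(2)]] by (simp add: less_Suc_eq_le)

lemma recursive_Least:
  assumes "decidable (\<lambda>z. P (pr1 z) (pr2 z))" "\<And>x. \<exists>y. P x y"
  shows "recursive (\<lambda>x. LEAST y. P x y)"
proof -
  \<comment> \<open>Minimisation searches for a zero, hence the negated truth value.\<close>
  have "recursive (\<lambda>z. of_bool (\<not> P (pr1 z) (pr2 z)))"
    by (intro rec_intros assms)
  from partrec.rfind[OF this[unfolded recursive_def]] assms(2)
  show ?thesis by (simp add: recursive_def pr1_def pr2_def)
qed

text \<open>Division becomes a total minimisation; the disjunct \<open>d = 0\<close> ends the search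
  at once with the conventional value 0.\<close>

lemma div_eq_Least: "(a::nat) div d = (LEAST q. d = 0 \<or> a < Suc q * d)"
proof (cases "d = 0")
  case False
  have "a < Suc (a div d) * d" using False
    by (metis dividend_less_div_times mult_Suc bot_nat_0.not_eq_extremum)
  moreover have "a div d \<le> q" if "a < Suc q * d" for q
    using that less_mult_imp_div_less less_Suc_eq_le by blast
  ultimately show ?thesis using False by (intro Least_equality[symmetric]) auto
qed auto

lemma recursive_div [rec_intros]:
  assumes "recursive f" "recursive g" shows "recursive (\<lambda>x. f x div g x)"
proof -
  have "\<exists>q. d = 0 \<or> a < Suc q * d" for a d :: nat
    by (rule exI[of _ a], cases d) auto
  thus ?thesis unfolding div_eq_Least
    by (intro recursive_Least rec_intros recursive_comp[OF assms(1)] recursive_comp[OF assms(2)])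
qed

text \<open>Finite sets are coded by their binary digits. A digit is the parity of a shifted number,
  and parity is expressed by division.\<close>

lemma decidable_mem_set_decode [rec_intros]:
  assumes "recursive f" "recursive g"
  shows "decidable (\<lambda>x. f x \<in> set_decode (g x))"
proof -
  have "decidable (\<lambda>x. g x div 2 ^ f x \<noteq> 2 * (g x div 2 ^ f x div 2))"
    by (intro rec_intros assms)
  moreover have "(n \<noteq> 2 * (n div 2)) \<longleftrightarrow> odd n" for n :: nat by presburger
  ultimately show ?thesis by (simp add: set_decode_def)
qed

lemma recursive_sum [rec_intros]:
  assumes "recursive (\<lambda>z. f (pr1 z) (pr2 z))" "recursive b"
  shows "recursive (\<lambda>x. \<Sum>y<b x. f x y)"
proof -
  have "rec_nat 0 (\<lambda>k r. r + h k) n = (\<Sum>y<n. h y)" for h :: "nat \<Rightarrow> nat" and n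
    by (induction n) auto
  moreover have "recursive (\<lambda>x. rec_nat 0 (\<lambda>k r. r + f x k) (b x))"
  proof -
    have "recursive (\<lambda>z. pr (pr1 z) (pr1 (pr2 z)))" by (intro rec_intros)
    from recursive_comp[OF assms(1) this]
    have "recursive (\<lambda>z. f (pr1 z) (pr1 (pr2 z)))" by simp
    thus ?thesis by (intro rec_intros assms)
  qed
  ultimately show ?thesis by simp
qed

text \<open>A fixed finite set is hard-wired as the constant that codes it, so it need not be
  presented effectively.\<close>

lemma decidable_finite_set [rec_intros]:
  assumes "recursive f" "finite A" shows "decidable (\<lambda>x. f x \<in> A)"
proof -
  have "decidable (\<lambda>x. f x \<in> set_decode (set_encode A))" by (intro rec_intros assms)
  thus ?thesis using assms by simp
qed


section \<open>Coded lists\<close>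

definition lhd :: "nat \<Rightarrow> nat" where "lhd l = pr1 (l - 1)"
definition ltl :: "nat \<Rightarrow> nat" where "ltl l = pr2 (l - 1)"

lemma lhd_list_encode [simp]: "lhd (list_encode (x # xs)) = x"
  and ltl_list_encode [simp]: "ltl (list_encode (x # xs)) = list_encode xs"
  by (simp_all add: lhd_def ltl_def pr1_def pr2_def)

lemma list_encode_Cons: "list_encode (x # xs) = Suc (pr x (list_encode xs))"
  by (simp add: pr_def)

declare list_encode.simps(2) [simp del]

lemma list_encode_eq_0_iff [simp]: "list_encode xs = 0 \<longleftrightarrow> xs = []"
  by (cases xs) (simp_all add: list_encode_Cons)

lemma recursive_lhd [rec_intros]: "recursive f \<Longrightarrow> recursive (\<lambda>x. lhd (f x))"
  unfolding lhd_def by (intro rec_intros)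

lemma recursive_ltl [rec_intros]: "recursive f \<Longrightarrow> recursive (\<lambda>x. ltl (f x))"
  unfolding ltl_def by (intro rec_intros)

lemma recursive_Cons [rec_intros]:
  "recursive f \<Longrightarrow> recursive (\<lambda>x. list_encode (g x)) \<Longrightarrow> recursive (\<lambda>x. list_encode (f x # g x))"
  unfolding list_encode_Cons by (intro rec_intros)

lemma member_le_list_encode: "m \<in> set xs \<Longrightarrow> m < list_encode xs"
proof (induction xs)
  case (Cons x xs)
  thus ?case using pr_ge1[of x "list_encode xs"] pr_ge2[of "list_encode xs" x]
    by (auto simp: list_encode_Cons)
qed simp

lemma member_set_decode_list: "m \<in> set (list_decode l) \<Longrightarrow> m < l"
  using member_le_list_encode[of m "list_decode l"] by simp

lemma list_encode_ge_length: "length xs \<le> list_encode xs"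
proof (induction xs)
  case (Cons x xs)
  thus ?case using pr_ge2[of "list_encode xs" x] by (simp add: list_encode_Cons)
qed simp

lemma rec_nat_ltl: "rec_nat (list_encode xs) (\<lambda>k. ltl) k = list_encode (drop k xs)"
proof (induction k)
  case (Suc k)
  \<comment> \<open>\<open>ltl\<close> fixes the code of the empty list, so the iteration is correct
    beyond the end of the list as well.\<close>
  have [simp]: "ltl 0 = 0"
    using le_prod_encode_2[of "pr2 0" "pr1 0"] by (simp add: ltl_def pr1_def pr2_def)
  show ?case
  proof (cases "length xs \<le> k")
    case False
    hence "drop k xs = xs ! k # drop (Suc k) xs" by (simp add: Cons_nth_drop_Suc)
    with Suc show ?thesis by simp
  qed (simp add: Suc)
qed simp

lemma lhd_drop: "k < length xs \<Longrightarrow> lhd (list_encode (drop k xs)) = xs ! k"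
  by (metis Cons_nth_drop_Suc lhd_list_encode)

text \<open>Membership is a bounded search for a position: the code of a list bounds its length, and
  an exhausted tail shows as the code 0.\<close>

lemma decidable_mem_list [rec_intros]:
  assumes "recursive f" "recursive g"
  shows "decidable (\<lambda>x. f x \<in> set (list_decode (g x)))"
proof -
  have "m \<in> set xs \<longleftrightarrow> (\<exists>k<list_encode xs. rec_nat (list_encode xs) (\<lambda>k. ltl) k \<noteq> 0 \<and>
      lhd (rec_nat (list_encode xs) (\<lambda>k. ltl) k) = m)" for m xs
  proof
    assume "m \<in> set xs"
    then obtain k where k: "k < length xs" "xs ! k = m" by (auto simp: in_set_conv_nth)
    moreover have "k < list_encode xs" using k list_encode_ge_length[of xs] by simp
    ultimately show "\<exists>k<list_encode xs. rec_nat (list_encode xs) (\<lambda>k. ltl) k \<noteq> 0 \<and>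
      lhd (rec_nat (list_encode xs) (\<lambda>k. ltl) k) = m"
      unfolding rec_nat_ltl by (auto simp: lhd_drop intro!: exI[of _ k])
  next
    assume "\<exists>k<list_encode xs. rec_nat (list_encode xs) (\<lambda>k. ltl) k \<noteq> 0 \<and>
      lhd (rec_nat (list_encode xs) (\<lambda>k. ltl) k) = m"
    then obtain k where "k < length xs" "lhd (list_encode (drop k xs)) = m"
      unfolding rec_nat_ltl by (auto simp: not_le)
    thus "m \<in> set xs" by (auto simp: lhd_drop)
  qed
  from this[of _ "list_decode _"] have *: "m \<in> set (list_decode l) \<longleftrightarrow>
      (\<exists>k<l. rec_nat l (\<lambda>k. ltl) k \<noteq> 0 \<and> lhd (rec_nat l (\<lambda>k. ltl) k) = m)" for m l
    by simp
  show ?thesis unfolding *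
    by (intro rec_intros recursive_comp[OF assms(1)] recursive_comp[OF assms(2)])
qed

lemma recursive_length [rec_intros]:
  assumes "recursive f" shows "recursive (\<lambda>x. length (list_decode (f x)))"
proof -
  have "length xs = card {k. k < list_encode xs \<and> rec_nat (list_encode xs) (\<lambda>k. ltl) k \<noteq> 0}" for xs
  proof -
    have "{k. k < list_encode xs \<and> rec_nat (list_encode xs) (\<lambda>k. ltl) k \<noteq> 0} = {..<length xs}"
      unfolding rec_nat_ltl using list_encode_ge_length[of xs] by auto
    thus ?thesis by simp
  qed
  from this[of "list_decode _"]
  have *: "length (list_decode l) = card {k. k < l \<and> rec_nat l (\<lambda>k. ltl) k \<noteq> 0}" for l by simp
  show ?thesis unfolding *
    by (intro rec_intros recursive_comp[OF assms(1)] assms)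
qed

lemma decidable_ball_list [rec_intros]:
  assumes "decidable (\<lambda>z. P (pr1 z) (pr2 z))" "recursive l"
  shows "decidable (\<lambda>x. \<forall>m\<in>set (list_decode (l x)). P x m)"
proof -
  have "decidable (\<lambda>x. \<forall>m<l x. m \<in> set (list_decode (l x)) \<longrightarrow> P x m)"
    by (intro rec_intros assms recursive_comp[OF assms(2)])
  moreover have "(\<forall>m<l x. m \<in> set (list_decode (l x)) \<longrightarrow> P x m) \<longleftrightarrow>
      (\<forall>m\<in>set (list_decode (l x)). P x m)" for x
    using member_set_decode_list by auto
  ultimately show ?thesis by simp
qed

lemma decidable_bex_list [rec_intros]:
  assumes "decidable (\<lambda>z. P (pr1 z) (pr2 z))" "recursive l"
  shows "decidable (\<lambda>x. \<exists>m\<in>set (list_decode (l x)). P x m)"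
  using decidable_not[OF decidable_ball_list[OF decidable_not[OF assms(1)] assms(2)]] by simp

lemma recursive_filter_upt [rec_intros]:
  assumes "recursive (\<lambda>z. g (pr1 z) (pr2 z))" "decidable (\<lambda>z. P (pr1 z) (pr2 z))" "recursive n"
  shows "recursive (\<lambda>x. list_encode (map (g x) (filter (P x) [0..<n x])))"
proof -
  \<comment> \<open>Runs down from the upper end, so that consing produces increasing order.\<close>
  define step where "step = (\<lambda>h Q n k r. if Q (n - Suc k) then Suc (pr (h (n - Suc k) :: nat) r) else r)"
  have *: "k \<le> n \<Longrightarrow> rec_nat 0 (step h Q n) k = list_encode (map h (filter Q [n - k..<n]))" for h Q n k
  proof (induction k)
    case (Suc k)
    hence "[n - Suc k..<n] = (n - Suc k) # [n - k..<n]"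
      by (simp add: upt_conv_Cons Suc_diff_Suc)
    with Suc show ?case by (simp add: step_def list_encode_Cons)
  qed simp
  have 1: "recursive (\<lambda>z. g (a z) (b z))" if "recursive a" "recursive b" for a b
    using recursive_comp[OF assms(1) recursive_pr[OF that]] by simp
  have 2: "decidable (\<lambda>z. P (a z) (b z))" if "recursive a" "recursive b" for a b
    using decidable_comp[OF assms(2) recursive_pr[OF that]] by simp
  have "recursive (\<lambda>x. rec_nat 0 (step (g x) (P x) (n x)) (n x))" unfolding step_def
    by (intro rec_intros 1 2 assms recursive_comp[OF assms(3)])
  moreover have "rec_nat 0 (step (g x) (P x) (n x)) (n x) =
      list_encode (map (g x) (filter (P x) [0..<n x]))" for x
    using *[of "n x" "n x" "g x" "P x"] by simp
  ultimately show ?thesis by simp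
qed

section \<open>Calls to partial functions\<close>

lemma partrec_comp_recursive: "partrec f \<Longrightarrow> recursive g \<Longrightarrow> partrec (\<lambda>n. f (g n))"
  using partrec.comp[of f "\<lambda>n. Some (g n)"] by (simp add: recursive_def)

lemma recursive_comp_partrec:
  "recursive f \<Longrightarrow> partrec g \<Longrightarrow> partrec (\<lambda>n. Option.bind (g n) (\<lambda>m. Some (f m)))"
  using partrec.comp[of "\<lambda>n. Some (f n)" g] by (simp add: recursive_def)

text \<open>This isolates partiality: one pass over a precomputed list calls \<open>f\<close> on
  each member, and the result can be handed to a total function. Consing during a forward pass
  reverses the list, which is harmless because only the set of survivors matters later.\<close>

lemma partrec_filter:
  assumes "partrec f"
  obtains h where "partrec h"
    "\<And>c l. (\<forall>m\<in>set l. f (pr c m) \<in> {Some 0, Some 1}) \<Longrightarrow>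
      h (pr c (list_encode l)) = Some (list_encode (rev (filter (\<lambda>m. f (pr c m) = Some 1) l)))"
proof -
  define el where "el = (\<lambda>x k. lhd (rec_nat (pr2 x) (\<lambda>k. ltl) k))"
  define step where "step = (\<lambda>z. Option.bind (f (pr (pr1 (pr1 z)) (el (pr1 z) (pr1 (pr2 z)))))
    (\<lambda>b. Some (if b = 1 then Suc (pr (el (pr1 z) (pr1 (pr2 z))) (pr2 (pr2 z))) else pr2 (pr2 z))))"
  have el: "recursive (\<lambda>x. el (a x) (b x))" if "recursive a" "recursive b" for a b
    unfolding el_def by (intro rec_intros that)
  have "partrec (\<lambda>z. f (pr (pr1 (pr1 z)) (el (pr1 z) (pr1 (pr2 z)))))"
    by (rule partrec_comp_recursive[OF assms]) (intro rec_intros el)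
  from partrec.pair[OF recursive_id[unfolded recursive_def] this]
  have 1: "partrec (\<lambda>z. Option.bind (f (pr (pr1 (pr1 z)) (el (pr1 z) (pr1 (pr2 z))))) (\<lambda>b. Some (pr z b)))"
    by (simp add: pr_def)
  have 2: "recursive (\<lambda>w. if pr2 w = 1 then
      Suc (pr (el (pr1 (pr1 w)) (pr1 (pr2 (pr1 w)))) (pr2 (pr2 (pr1 w)))) else pr2 (pr2 (pr1 w)))"
    by (intro rec_intros el)
  have step: "partrec step"
    using recursive_comp_partrec[OF 2 1] by (simp add: step_def cong: if_cong)
  define h where "h = (\<lambda>x. rec_nat (Some 0) (\<lambda>k r. Option.bind r (\<lambda>i. step (pr x (pr k i))))
    (length (list_decode (pr2 x))))"
  have "recursive (\<lambda>x. pr x (length (list_decode (pr2 x))))" by (intro rec_intros)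
  from partrec_comp_recursive[OF partrec.prec[OF recursive_const[of 0, unfolded recursive_def] step] this]
  have "partrec h" by (simp add: h_def pr_def pr1_def pr2_def)
  moreover have "h (pr c (list_encode l)) =
      Some (list_encode (rev (filter (\<lambda>m. f (pr c m) = Some 1) l)))"
    if l: "\<forall>m\<in>set l. f (pr c m) \<in> {Some 0, Some 1}" for c l
  proof -
    have "k \<le> length l \<Longrightarrow> rec_nat (Some 0)
        (\<lambda>k r. Option.bind r (\<lambda>i. step (pr (pr c (list_encode l)) (pr k i)))) k =
        Some (list_encode (rev (filter (\<lambda>m. f (pr c m) = Some 1) (take k l))))" for k
    proof (induction k)
      case (Suc k)
      hence "f (pr c (l ! k)) \<in> {Some 0, Some 1}" using l by simp
      thus ?case using Suc
        by (auto simp: step_def el_def rec_nat_ltl lhd_drop take_Suc_conv_app_nth list_encode_Cons)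
    qed simp
    from this[of "length l"] show ?thesis by (simp add: h_def)
  qed
  ultimately show ?thesis using that by blast
qed


section \<open>Course-of-values recursion\<close>

text \<open>
  \<open>crec K \<Phi> n\<close> is a set of points, defined from the sets at the arguments below \<open>n\<close>; only
  the points below \<open>K\<close> of the latter can be used, so that they can be tabulated.
\<close>

declare conj_cong [fundef_cong]

function crec :: "nat \<Rightarrow> (nat \<Rightarrow> nat \<Rightarrow> (nat \<Rightarrow> nat \<Rightarrow> bool) \<Rightarrow> bool) \<Rightarrow> nat \<Rightarrow> nat \<Rightarrow> bool" where
  "crec K \<Phi> n p = \<Phi> n p (\<lambda>m q. m < n \<and> q < K \<and> crec K \<Phi> m q)"
  by auto
termination by (relation "measure (\<lambda>(K, \<Phi>, n, p). n)") auto

declare crec.simps [simp del]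

text \<open>The truth values at all smaller arguments form one finite set of points
  \<open>pr m q\<close>, hence one number, and the step is evaluated with lookups in this table.
  That is why the hypothesis speaks only of oracles of the form
  \<open>pr m q \<in> set_decode T\<close>.\<close>

lemma decidable_crec:
  assumes \<Phi>: "decidable (\<lambda>z. \<Phi> (pr1 z) (pr1 (pr2 z)) (pr1 (pr2 (pr2 z)))
      (\<lambda>m q. pr m q \<in> set_decode (pr2 (pr2 (pr2 z)))))"
    and "recursive K" "recursive n" "recursive p"
  shows "decidable (\<lambda>x. crec (K x) (\<Phi> x) (n x) (p x))"
proof -
  \<comment> \<open>A new row contributes the powers of two of its true points. It is disjoint from
    the earlier rows, so adding codes amounts to taking unions.\<close>
  define step where "step = (\<lambda>x n T. T + (\<Sum>q<K x. of_bool (\<Phi> x n q (\<lambda>m q. pr m q \<in> set_decode T)) * 2 ^ pr n q))"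
  define T where "T = (\<lambda>x n. rec_nat 0 (step x) n)"
  \<comment> \<open>The second conjunct carries finiteness along, since \<open>set_encode\<close>
    can be inverted on finite sets only.\<close>
  have *: "T x n = set_encode {pr m q |m q. m < n \<and> q < K x \<and> crec (K x) (\<Phi> x) m q} \<and>
    set_decode (T x n) = {pr m q |m q. m < n \<and> q < K x \<and> crec (K x) (\<Phi> x) m q}" for x n
  proof (induction n)
    case 0
    show ?case by (simp add: T_def)
  next
    case (Suc n)
    let ?A = "{pr m q |m q. m < n \<and> q < K x \<and> crec (K x) (\<Phi> x) m q}"
    let ?B = "pr n ` {q. q < K x \<and> crec (K x) (\<Phi> x) n q}"
    have un: "{pr m q |m q. m < Suc n \<and> q < K x \<and> crec (K x) (\<Phi> x) m q} = ?A \<union> ?B"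
      by (auto simp: less_Suc_eq)
    have fin: "finite ?A" using Suc finite_set_decode by metis
    have "\<Phi> x n q (\<lambda>m q. pr m q \<in> set_decode (T x n)) = crec (K x) (\<Phi> x) n q" for q
      unfolding conjunct2[OF Suc] by (subst crec.simps) simp
    hence "T x (Suc n) = T x n + (\<Sum>q<K x. of_bool (crec (K x) (\<Phi> x) n q) * 2 ^ pr n q)"
      by (simp add: T_def step_def)
    also have "(\<Sum>q<K x. of_bool (crec (K x) (\<Phi> x) n q) * 2 ^ pr n q) =
        (\<Sum>q\<in>{q. q < K x \<and> crec (K x) (\<Phi> x) n q}. 2 ^ pr n q :: nat)"
      by (intro sum.mono_neutral_cong_right) auto
    also have "\<dots> = set_encode ?B"
      unfolding set_encode_def by (subst sum.reindex) (auto simp: inj_on_def)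
    also have "T x n = set_encode ?A" using Suc by simp
    also have "set_encode ?A + set_encode ?B = set_encode (?A \<union> ?B)"
      unfolding set_encode_def using fin by (subst sum.union_disjoint) auto
    finally show ?case using fin by (simp add: un)
  qed
  have T: "recursive (\<lambda>x. T x (n x))"
  proof -
    have D: "decidable (\<lambda>z. \<Phi> (a z) (b z) (c z) (\<lambda>m q. pr m q \<in> set_decode (d z)))"
      if "recursive a" "recursive b" "recursive c" "recursive d" for a b c d
      using decidable_comp[OF \<Phi> recursive_pr[OF that(1) recursive_pr[OF that(2) recursive_pr[OF that(3,4)]]]]
      by simp
    show ?thesis unfolding T_def step_def
      by (intro rec_intros D assms(2-) recursive_comp[OF assms(2)])
  qed
  have "crec (K x) (\<Phi> x) (n x) (p x) = \<Phi> x (n x) (p x) (\<lambda>m q. pr m q \<in> set_decode (T x (n x)))" for x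
    unfolding conjunct2[OF *] by (subst crec.simps) simp
  moreover have "decidable (\<lambda>x. \<Phi> x (n x) (p x) (\<lambda>m q. pr m q \<in> set_decode (T x (n x))))"
    using decidable_comp[OF \<Phi> recursive_pr[OF recursive_id recursive_pr[OF assms(3) recursive_pr[OF assms(4) T]]]]
    by simp
  ultimately show ?thesis by simp
qed


text \<open>Below a binder a parameter \<open>f x\<close> turns into \<open>f (pr1 z)\<close>, which
  the assumption \<open>recursive f\<close> does not match. A notion is therefore treated once for
  coded parameters, and arbitrary ones are substituted afterwards.\<close>

lemma recursive_lift2: "recursive (\<lambda>z. f (pr1 z) (pr2 z)) \<Longrightarrow> recursive a \<Longrightarrow> recursive b \<Longrightarrow>
    recursive (\<lambda>x. f (a x) (b x))"
  by (drule recursive_comp[OF _ recursive_pr, of _ a b]) simp_all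

lemma decidable_lift2: "decidable (\<lambda>z. P (pr1 z) (pr2 z)) \<Longrightarrow> recursive a \<Longrightarrow> recursive b \<Longrightarrow>
    decidable (\<lambda>x. P (a x) (b x))"
  by (drule decidable_comp[OF _ recursive_pr, of _ a b]) simp_all

lemma decidable_lift3: "decidable (\<lambda>z. P (pr1 z) (pr1 (pr2 z)) (pr2 (pr2 z))) \<Longrightarrow>
    recursive a \<Longrightarrow> recursive b \<Longrightarrow> recursive c \<Longrightarrow> decidable (\<lambda>x. P (a x) (b x) (c x))"
  using decidable_lift2[of "\<lambda>x y. P x (pr1 y) (pr2 y)" a "\<lambda>x. pr (b x) (c x)"]
  by (simp add: recursive_pr)

lemma decidable_lift4: "decidable (\<lambda>z. P (pr1 z) (pr1 (pr2 z)) (pr1 (pr2 (pr2 z))) (pr2 (pr2 (pr2 z)))) \<Longrightarrow>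
    recursive a \<Longrightarrow> recursive b \<Longrightarrow> recursive c \<Longrightarrow> recursive d \<Longrightarrow>
    decidable (\<lambda>x. P (a x) (b x) (c x) (d x))"
  using decidable_lift3[of "\<lambda>x y z. P x y (pr1 z) (pr2 z)" a b "\<lambda>x. pr (c x) (d x)"]
  by (simp add: recursive_pr)

section \<open>Codes of syntax trees\<close>

definition arg0 :: "nat \<Rightarrow> nat" where "arg0 n = lhd (pr2 n)"
definition arg1 :: "nat \<Rightarrow> nat" where "arg1 n = lhd (ltl (pr2 n))"
definition arg2 :: "nat \<Rightarrow> nat" where "arg2 n = lhd (ltl (ltl (pr2 n)))"
definition arg3 :: "nat \<Rightarrow> nat" where "arg3 n = lhd (ltl (ltl (ltl (pr2 n))))"

lemma node_eq_pr: "node k xs = pr k (list_encode xs)"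
  by (simp add: node_def pr_def)

lemma pr1_node [simp]: "pr1 (node k xs) = k"
  and arg0_node [simp]: "arg0 (node k (a # xs)) = a"
  and arg1_node [simp]: "arg1 (node k (a # b # xs)) = b"
  and arg2_node [simp]: "arg2 (node k (a # b # c # xs)) = c"
  and arg3_node [simp]: "arg3 (node k (a # b # c # d # xs)) = d"
  by (simp_all add: node_eq_pr arg0_def arg1_def arg2_def arg3_def)

lemma member_less_node: "m \<in> set xs \<Longrightarrow> m < node k xs"
  using member_le_list_encode[of m xs] pr_ge2[of "list_encode xs" k] by (simp add: node_eq_pr)

lemma arg_less_node [simp]:
  "a < node k (a # xs)" "b < node k (a # b # xs)" "c < node k (a # b # c # xs)"
  "d < node k (a # b # c # d # xs)"
  by (rule member_less_node, simp)+

lemma recursive_node [rec_intros]: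
  "recursive k \<Longrightarrow> recursive (\<lambda>x. list_encode (xs x)) \<Longrightarrow> recursive (\<lambda>x. node (k x) (xs x))"
  unfolding node_eq_pr by (intro rec_intros)

lemma recursive_args [rec_intros]:
  assumes "recursive f"
  shows "recursive (\<lambda>x. arg0 (f x))" "recursive (\<lambda>x. arg1 (f x))"
    "recursive (\<lambda>x. arg2 (f x))" "recursive (\<lambda>x. arg3 (f x))"
  unfolding arg0_def arg1_def arg2_def arg3_def by (intro rec_intros assms)+

declare finite.emptyI [rec_intros] finite.insertI [rec_intros] finite_atLeastAtMost [rec_intros]


section \<open>The data ranges that occur in the input\<close>

text \<open>
  Codes do not determine the kind of object that they stand for. The kinds are: 0 concept,
  1 abstract role, 2 concrete role, 3 datatype term, 4 list of abstract roles, 5 data range,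
  6 constant, 8 RBox axiom, 9 TBox axiom, 10 ABox assertion, 11 atom, 12 literal,
  13 query term, 14 object. A constant counts as the data range \<open>DEnum [c]\<close>.
\<close>

definition occ_step :: "nat \<Rightarrow> nat \<Rightarrow> nat \<Rightarrow> (nat \<Rightarrow> nat \<Rightarrow> bool) \<Rightarrow> bool" where
  "occ_step n k r h \<longleftrightarrow>
    k = 0 \<and> (pr1 n \<in> {3,4,5} \<and> h (arg0 n) 0 \<or> pr1 n \<in> {4,5} \<and> h (arg1 n) 0 \<or>
      pr1 n \<in> {7,8} \<and> h (arg0 n) 1 \<or> pr1 n = 9 \<and> (h (arg0 n) 2 \<or> h (arg1 n) 6)) \<or>
    k = 1 \<and> (pr1 n \<in> {2..8} \<and> h (arg0 n) 1 \<or> pr1 n \<in> {4,5} \<and> h (arg1 n) 1 \<or>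
      pr1 n \<in> {6,7,8} \<and> h (arg1 n) 0 \<or> pr1 n = 8 \<and> h (arg2 n) 0 \<or>
      pr1 n \<in> {9,10} \<and> h (arg0 n) 0 \<or> pr1 n = 10 \<and> h (arg1 n) 0) \<or>
    k = 2 \<and> (pr1 n \<in> {1..6} \<and> h (arg0 n) 2 \<or> pr1 n \<in> {2,3} \<and> h (arg1 n) 2 \<or>
      pr1 n \<in> {4,6} \<and> h (arg1 n) 0 \<or> pr1 n = 5 \<and> h (arg1 n) 3 \<or> pr1 n = 6 \<and> h (arg2 n) 3) \<or>
    k = 3 \<and> (pr1 n = 0 \<and> h (arg0 n) 5 \<or> pr1 n \<in> {1,2,3} \<and> h (arg0 n) 3 \<or>
      pr1 n \<in> {2,3} \<and> h (arg1 n) 3 \<or> pr1 n = 4 \<and> h (arg0 n) 6) \<or>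
    k = 4 \<and> n \<noteq> 0 \<and> (h (lhd n) 1 \<or> h (ltl n) 4) \<or>
    k = 5 \<and> r = n \<or>
    k = 6 \<and> r = node 1 [n] \<or>
    k = 8 \<and> (pr1 n \<in> {0,1,3,4,5,6,7,8,9,10} \<and> h (arg0 n) 1 \<or> pr1 n \<in> {0,1,2,7} \<and> h (arg1 n) 1 \<or>
      pr1 n = 2 \<and> h (arg0 n) 4 \<or> pr1 n = 10 \<and> (h (arg1 n) 0 \<or> h (arg2 n) 0) \<or>
      pr1 n \<in> {11..14} \<and> h (arg0 n) 2 \<or> pr1 n \<in> {11,12,13} \<and> h (arg1 n) 2) \<or>
    k = 9 \<and> (pr1 n \<in> {0,1,2,5,8,11} \<and> h (arg0 n) 0 \<or> pr1 n = 3 \<and> h (arg0 n) 1 \<or>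
      pr1 n = 9 \<and> h (arg0 n) 2 \<or> pr1 n \<in> {6,7} \<and> h (arg0 n) 3 \<or>
      pr1 n \<in> {0,1,3} \<and> h (arg1 n) 0 \<or> pr1 n \<in> {2,4} \<and> h (arg1 n) 1 \<or>
      pr1 n \<in> {8,10} \<and> h (arg1 n) 2 \<or> pr1 n \<in> {6,7,9} \<and> h (arg1 n) 3 \<or>
      pr1 n \<in> {2,3,4,9} \<and> h (arg2 n) 0 \<or> pr1 n = 5 \<and> h (arg2 n) 1 \<or>
      pr1 n = 11 \<and> h (arg2 n) 2 \<or> pr1 n \<in> {8,10} \<and> h (arg2 n) 3 \<or>
      pr1 n \<in> {4,5,10} \<and> h (arg3 n) 0 \<or> pr1 n = 11 \<and> h (arg3 n) 3) \<or>
    k = 10 \<and> (pr1 n = 0 \<and> h (arg1 n) 0 \<or> pr1 n = 1 \<and> h (arg2 n) 1 \<or>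
      pr1 n = 3 \<and> (h (arg0 n) 6 \<or> h (arg1 n) 3) \<or> pr1 n = 4 \<and> (h (arg1 n) 6 \<or> h (arg2 n) 2)) \<or>
    k = 11 \<and> (pr1 n = 0 \<and> h (arg0 n) 1 \<or> pr1 n = 1 \<and> h (arg0 n) 2 \<or> pr1 n = 2 \<and> h (arg0 n) 0 \<or>
      pr1 n = 3 \<and> h (arg0 n) 13 \<or> h (arg1 n) 13 \<or> pr1 n \<in> {0,1} \<and> h (arg2 n) 13) \<or>
    k = 12 \<and> h (arg0 n) 11 \<or>
    k = 13 \<and> pr1 n = 1 \<and> h (arg0 n) 14 \<or>
    k = 14 \<and> pr1 n = 1 \<and> h (arg0 n) 6"

text \<open>The range that is looked for travels unchanged inside the point. Kinds are at most 14
  and ranges at most \<open>R\<close>, so monotonicity of \<open>pr\<close> bounds the points by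
  \<open>pr 14 R\<close>.\<close>

definition occ :: "nat \<Rightarrow> nat \<Rightarrow> nat \<Rightarrow> nat \<Rightarrow> bool" where
  "occ R n k r = crec (Suc (pr 14 R))
     (\<lambda>n p orc. occ_step n (pr1 p) (pr2 p) (\<lambda>m k'. orc m (pr k' (pr2 p)))) n (pr k r)"

lemma occ_unfold:
  assumes "r \<le> R"
  shows "occ R n k r \<longleftrightarrow> occ_step n k r (\<lambda>m k'. m < n \<and> k' \<le> 14 \<and> occ R m k' r)"
proof -
  \<comment> \<open>Every kind requested by \<open>occ_step\<close> is at most 14, which lets the
    bound on points be traded for a bound on kinds.\<close>
  have *: "occ_step n k r h = occ_step n k r (\<lambda>m k'. k' \<le> 14 \<and> h m k')" for n h
    unfolding occ_step_def by simp
  have "occ R n k r = occ_step n k r (\<lambda>m k'. m < n \<and> pr k' r < Suc (pr 14 R) \<and> occ R m k' r)"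
    unfolding occ_def by (subst crec.simps) simp
  also have "\<dots> = occ_step n k r (\<lambda>m k'. k' \<le> 14 \<and> m < n \<and> pr k' r < Suc (pr 14 R) \<and> occ R m k' r)"
    by (rule *)
  also have "(\<lambda>m k'. k' \<le> 14 \<and> m < n \<and> pr k' r < Suc (pr 14 R) \<and> occ R m k' r) =
      (\<lambda>m k'. m < n \<and> k' \<le> 14 \<and> occ R m k' r)"
    using pr_mono[of _ 14 r R] assms by (auto simp: less_Suc_eq_le fun_eq_iff)
  finally show ?thesis .
qed

lemma decidable_occ [rec_intros]:
  assumes "recursive R" "recursive n" "recursive k" "recursive r"
  shows "decidable (\<lambda>x. occ (R x) (n x) (k x) (r x))"
  unfolding occ_def
  by (rule decidable_crec, unfold occ_step_def) (intro rec_intros assms)+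


section \<open>Finite structures and the evaluation of codes\<close>

text \<open>
  The input \<open>N\<close> codes the list of the knowledge base, the query and the substitution. A finite
  structure is given by a number \<open>s\<close>, read as a set of atomic facts: facts of sort 0 identify
  individual names, those of sort 1, 2, 3 interpret concept, abstract role and concrete role
  names. The abstract domain consists of individual names, the least one being chosen from every
  class of identified names. A data element is a pair \<open>(t, i)\<close> standing for the \<open>i\<close>-th value of
  type \<open>t\<close>, the type of a value being the set of occurring data ranges that it belongs to; the
  list \<open>w\<close> of satisfiable data conjunctions tells which pairs exist.
\<close>

definition fact_in :: "nat \<Rightarrow> nat \<Rightarrow> nat \<Rightarrow> nat \<Rightarrow> nat \<Rightarrow> bool" where
  "fact_in s j n a b \<longleftrightarrow> pr j (pr n (pr a b)) \<in> set_decode s"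

definition indv :: "nat \<Rightarrow> nat \<Rightarrow> nat" where
  "indv s a = (LEAST b. b = a \<or> fact_in s 0 0 b a)"

text \<open>All numbers up to \<open>N\<close> act as individual names, whether or not they belong
  to the signature. In particular the domain is never empty.\<close>

definition in_A :: "nat \<Rightarrow> nat \<Rightarrow> nat \<Rightarrow> bool" where
  "in_A N s a \<longleftrightarrow> (\<exists>c\<le>N. a = indv s c)"

definition rbox_code :: "nat \<Rightarrow> nat" where "rbox_code N = lhd (lhd N)"
definition tbox_code :: "nat \<Rightarrow> nat" where "tbox_code N = lhd (ltl (lhd N))"
definition abox_code :: "nat \<Rightarrow> nat" where "abox_code N = lhd (ltl (ltl (lhd N)))"
definition query_code :: "nat \<Rightarrow> nat" where "query_code N = lhd (ltl N)"
definition subst_code :: "nat \<Rightarrow> nat" where "subst_code N = lhd (ltl (ltl N))"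

text \<open>A range of the input has a code up to \<open>N\<close>, but a constant \<open>c\<close>
  counts as the range coded by \<open>node 1 [c]\<close>, which may be larger than
  \<open>N\<close>.\<close>

definition range_bd :: "nat \<Rightarrow> nat" where "range_bd N = node 1 [N]"

definition in_R :: "nat \<Rightarrow> nat \<Rightarrow> bool" where
  "in_R N r \<longleftrightarrow> r \<le> range_bd N \<and>
    ((\<exists>x\<in>set (list_decode (rbox_code N)). occ (range_bd N) x 8 r) \<or>
     (\<exists>x\<in>set (list_decode (tbox_code N)). occ (range_bd N) x 9 r) \<or>
     (\<exists>x\<in>set (list_decode (abox_code N)). occ (range_bd N) x 10 r) \<or>
     (\<exists>x\<in>set (list_decode (query_code N)). occ (range_bd N) x 12 r) \<or>
     (\<exists>x\<in>set (list_decode (subst_code N)). occ (range_bd N) (pr2 x) 14 r))"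

text \<open>A value meets at most \<open>Suc N * Suc N\<close> pairs of a concrete role name and an
  individual, so the power counts the possible patterns. Among this many values some pattern occurs
  more than \<open>N\<close> times.\<close>

definition mult_bd :: "nat \<Rightarrow> nat" where "mult_bd N = Suc (N * 2 ^ (Suc N * Suc N))"

definition elem_bd :: "nat \<Rightarrow> nat" where "elem_bd N = pr (2 ^ Suc (range_bd N)) (mult_bd N)"

text \<open>The conjunction asks for \<open>Suc (pr2 y)\<close> values of type \<open>pr1 y\<close>:
  each variable up to \<open>pr2 y\<close> lies in every known range or in its complement
  (\<open>node 3\<close> codes \<open>DNeg\<close>), as the type prescribes, and the variables are
  pairwise distinct. The literals are read off numbers \<open>z\<close> below a bound that covers
  all their parameters.\<close>

definition data_query :: "nat \<Rightarrow> nat \<Rightarrow> nat" where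
  "data_query N y = list_encode (map
     (\<lambda>z. if pr1 z = 0
        then node 0 [pr1 (pr2 z), if pr2 (pr2 z) \<in> set_decode (pr1 y) then pr2 (pr2 z) else node 3 [pr2 (pr2 z)]]
        else node 1 [pr1 (pr2 z), pr2 (pr2 z)])
     (filter (\<lambda>z. pr1 z = 0 \<and> pr1 (pr2 z) \<le> pr2 y \<and> in_R N (pr2 (pr2 z)) \<or>
         pr1 z = 1 \<and> pr1 (pr2 z) < pr2 (pr2 z) \<and> pr2 (pr2 z) \<le> pr2 y)
       [0..<Suc (pr 1 (pr (pr2 y) (range_bd N + pr2 y)))]))"

definition candidate :: "nat \<Rightarrow> nat \<Rightarrow> bool" where
  "candidate N y \<longleftrightarrow> pr1 y < 2 ^ Suc (range_bd N) \<and> pr2 y < mult_bd N \<and>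
     (\<forall>r\<le>range_bd N. r \<in> set_decode (pr1 y) \<longrightarrow> in_R N r)"

definition data_queries :: "nat \<Rightarrow> nat" where
  "data_queries N = list_encode (map (data_query N) (filter (candidate N) [0..<Suc (elem_bd N)]))"

definition in_V :: "nat \<Rightarrow> nat \<Rightarrow> nat \<Rightarrow> bool" where
  "in_V N w y \<longleftrightarrow> candidate N y \<and> data_query N y \<in> set (list_decode w)"

text \<open>The kinds \<open>k\<close> are those of \<open>occ_step\<close>, kind 4 being role
  chains; unary kinds are evaluated with second coordinate 0. In the clause for
  \<open>CHasConst\<close> the constant is found as an element whose type contains its singleton
  range.\<close>

definition hold_step ::
  "nat \<Rightarrow> nat \<Rightarrow> nat \<Rightarrow> nat \<Rightarrow> nat \<Rightarrow> nat \<Rightarrow> nat \<Rightarrow> (nat \<Rightarrow> nat \<Rightarrow> nat \<Rightarrow> nat \<Rightarrow> bool) \<Rightarrow> bool" where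
  "hold_step N w s n k a b h \<longleftrightarrow>
    k = 0 \<and>
     (pr1 n = 0 \<and> fact_in s 1 (arg0 n) a 0 \<or>
      pr1 n = 1 \<or>
      pr1 n = 3 \<and> \<not> h (arg0 n) 0 a 0 \<or>
      pr1 n = 4 \<and> (h (arg0 n) 0 a 0 \<or> h (arg1 n) 0 a 0) \<or>
      pr1 n = 5 \<and> h (arg0 n) 0 a 0 \<and> h (arg1 n) 0 a 0 \<or>
      pr1 n = 6 \<and> a = indv s (arg0 n) \<or>
      pr1 n = 7 \<and> h (arg0 n) 1 a a \<or>
      pr1 n = 8 \<and> h (arg0 n) 1 a (indv s (arg1 n)) \<or>
      pr1 n = 9 \<and> (\<exists>y\<le>elem_bd N. in_V N w y \<and> node 1 [arg1 n] \<in> set_decode (pr1 y) \<and> h (arg0 n) 2 a y)) \<or>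
    k = 1 \<and>
     (pr1 n = 0 \<and> fact_in s 2 (arg0 n) a b \<or>
      pr1 n = 1 \<or>
      pr1 n = 2 \<and> h (arg0 n) 1 b a \<or>
      pr1 n = 3 \<and> \<not> h (arg0 n) 1 a b \<or>
      pr1 n = 4 \<and> (h (arg0 n) 1 a b \<or> h (arg1 n) 1 a b) \<or>
      pr1 n = 5 \<and> h (arg0 n) 1 a b \<and> h (arg1 n) 1 a b \<or>
      pr1 n = 6 \<and> h (arg0 n) 1 a b \<and> h (arg1 n) 0 a 0 \<or>
      pr1 n = 7 \<and> h (arg0 n) 1 a b \<and> h (arg1 n) 0 b 0 \<or>
      pr1 n = 8 \<and> h (arg0 n) 1 a b \<and> h (arg1 n) 0 a 0 \<and> h (arg2 n) 0 b 0 \<or>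
      pr1 n = 9 \<and> a = b \<and> h (arg0 n) 0 a 0 \<or>
      pr1 n = 10 \<and> h (arg0 n) 0 a 0 \<and> h (arg1 n) 0 b 0) \<or>
    k = 2 \<and>
     (pr1 n = 0 \<and> fact_in s 3 (arg0 n) a b \<or>
      pr1 n = 1 \<and> \<not> h (arg0 n) 2 a b \<or>
      pr1 n = 2 \<and> (h (arg0 n) 2 a b \<or> h (arg1 n) 2 a b) \<or>
      pr1 n = 3 \<and> h (arg0 n) 2 a b \<and> h (arg1 n) 2 a b \<or>
      pr1 n = 4 \<and> h (arg0 n) 2 a b \<and> h (arg1 n) 0 a 0 \<or>
      pr1 n = 5 \<and> h (arg0 n) 2 a b \<and> h (arg1 n) 3 b 0 \<or>
      pr1 n = 6 \<and> h (arg0 n) 2 a b \<and> h (arg1 n) 0 a 0 \<and> h (arg2 n) 3 b 0) \<or>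
    k = 3 \<and>
     (pr1 n = 0 \<and> arg0 n \<in> set_decode (pr1 a) \<or>
      pr1 n = 1 \<and> \<not> h (arg0 n) 3 a 0 \<or>
      pr1 n = 2 \<and> h (arg0 n) 3 a 0 \<and> h (arg1 n) 3 a 0 \<or>
      pr1 n = 3 \<and> (h (arg0 n) 3 a 0 \<or> h (arg1 n) 3 a 0) \<or>
      pr1 n = 4 \<and> node 1 [arg0 n] \<in> set_decode (pr1 a)) \<or>
    k = 4 \<and>
     (n = 0 \<and> a = b \<or>
      n \<noteq> 0 \<and> (\<exists>c\<le>N. in_A N s c \<and> h (lhd n) 1 a c \<and> h (ltl n) 4 c b))"

definition hold :: "nat \<Rightarrow> nat \<Rightarrow> nat \<Rightarrow> nat \<Rightarrow> nat \<Rightarrow> nat \<Rightarrow> nat \<Rightarrow> bool" where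
  "hold N w s k n a b = crec (Suc (pr 4 (pr (elem_bd N) (elem_bd N))))
     (\<lambda>n p orc. hold_step N w s n (pr1 p) (pr1 (pr2 p)) (pr2 (pr2 p))
        (\<lambda>m k' a' b'. orc m (pr k' (pr a' b')))) n (pr k (pr a b))"

definition all_A :: "nat \<Rightarrow> nat \<Rightarrow> (nat \<Rightarrow> bool) \<Rightarrow> bool" where
  "all_A N s P \<longleftrightarrow> (\<forall>a\<le>N. in_A N s a \<longrightarrow> P a)"

definition all_V :: "nat \<Rightarrow> nat \<Rightarrow> (nat \<Rightarrow> bool) \<Rightarrow> bool" where
  "all_V N w P \<longleftrightarrow> (\<forall>y\<le>elem_bd N. in_V N w y \<longrightarrow> P y)"

definition card_A :: "nat \<Rightarrow> nat \<Rightarrow> (nat \<Rightarrow> bool) \<Rightarrow> nat" where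
  "card_A N s P = card {a. a < Suc N \<and> in_A N s a \<and> P a}"

definition card_V :: "nat \<Rightarrow> nat \<Rightarrow> (nat \<Rightarrow> bool) \<Rightarrow> nat" where
  "card_V N w P = card {y. y < Suc (elem_bd N) \<and> in_V N w y \<and> P y}"

definition rbox_ok :: "nat \<Rightarrow> nat \<Rightarrow> nat \<Rightarrow> nat \<Rightarrow> bool" where
  "rbox_ok N w s n \<longleftrightarrow> (let T = hold N w s in
     pr1 n = 0 \<and> all_A N s (\<lambda>a. all_A N s (\<lambda>b. T 1 (arg0 n) a b = T 1 (arg1 n) a b)) \<or>
     pr1 n = 1 \<and> all_A N s (\<lambda>a. all_A N s (\<lambda>b. T 1 (arg0 n) a b \<longrightarrow> T 1 (arg1 n) a b)) \<or>
     pr1 n = 2 \<and> all_A N s (\<lambda>a. all_A N s (\<lambda>b. T 4 (arg0 n) a b \<longrightarrow> T 1 (arg1 n) a b)) \<or>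
     pr1 n = 3 \<and> all_A N s (\<lambda>a. all_A N s (\<lambda>b. T 1 (arg0 n) a b \<longrightarrow> T 1 (arg0 n) b a)) \<or>
     pr1 n = 4 \<and> all_A N s (\<lambda>a. all_A N s (\<lambda>b. T 1 (arg0 n) a b \<longrightarrow> \<not> T 1 (arg0 n) b a)) \<or>
     pr1 n = 5 \<and> all_A N s (\<lambda>a. T 1 (arg0 n) a a) \<or>
     pr1 n = 6 \<and> all_A N s (\<lambda>a. \<not> T 1 (arg0 n) a a) \<or>
     pr1 n = 7 \<and> all_A N s (\<lambda>a. all_A N s (\<lambda>b. \<not> (T 1 (arg0 n) a b \<and> T 1 (arg1 n) a b))) \<or>
     pr1 n = 8 \<and> all_A N s (\<lambda>a. all_A N s (\<lambda>b. all_A N s (\<lambda>c.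
        T 1 (arg0 n) a b \<and> T 1 (arg0 n) b c \<longrightarrow> T 1 (arg0 n) a c))) \<or>
     pr1 n = 9 \<and> all_A N s (\<lambda>a. all_A N s (\<lambda>b. all_A N s (\<lambda>c.
        T 1 (arg0 n) a b \<and> T 1 (arg0 n) a c \<longrightarrow> b = c))) \<or>
     pr1 n = 10 \<and> all_A N s (\<lambda>a. all_A N s (\<lambda>b.
        T 1 (arg0 n) a b = (T 0 (arg1 n) a 0 \<and> T 0 (arg2 n) b 0))) \<or>
     pr1 n = 11 \<and> all_A N s (\<lambda>a. all_V N w (\<lambda>y. T 2 (arg0 n) a y = T 2 (arg1 n) a y)) \<or>
     pr1 n = 12 \<and> all_A N s (\<lambda>a. all_V N w (\<lambda>y. T 2 (arg0 n) a y \<longrightarrow> T 2 (arg1 n) a y)) \<or>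
     pr1 n = 13 \<and> all_A N s (\<lambda>a. all_V N w (\<lambda>y. \<not> (T 2 (arg0 n) a y \<and> T 2 (arg1 n) a y))) \<or>
     pr1 n = 14 \<and> all_A N s (\<lambda>a. card_V N w (T 2 (arg0 n) a) \<le> 1))"

definition tbox_ok :: "nat \<Rightarrow> nat \<Rightarrow> nat \<Rightarrow> nat \<Rightarrow> bool" where
  "tbox_ok N w s n \<longleftrightarrow> (let T = hold N w s in
     pr1 n = 0 \<and> all_A N s (\<lambda>a. T 0 (arg0 n) a 0 = T 0 (arg1 n) a 0) \<or>
     pr1 n = 1 \<and> all_A N s (\<lambda>a. T 0 (arg0 n) a 0 \<longrightarrow> T 0 (arg1 n) a 0) \<or>
     pr1 n = 2 \<and> all_A N s (\<lambda>a. all_A N s (\<lambda>b.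
        T 0 (arg0 n) a 0 \<and> T 1 (arg1 n) a b \<longrightarrow> T 0 (arg2 n) b 0)) \<or>
     pr1 n = 3 \<and> all_A N s (\<lambda>a. all_A N s (\<lambda>b.
        T 1 (arg0 n) a b \<and> T 0 (arg1 n) b 0 \<longrightarrow> T 0 (arg2 n) a 0)) \<or>
     pr1 n = 4 \<and> all_A N s (\<lambda>a.
        arg0 n \<le> card_A N s (\<lambda>b. T 0 (arg2 n) b 0 \<and> T 1 (arg1 n) a b) \<longrightarrow> T 0 (arg3 n) a 0) \<or>
     pr1 n = 5 \<and> all_A N s (\<lambda>a. T 0 (arg0 n) a 0 \<longrightarrow>
        card_A N s (\<lambda>b. T 0 (arg3 n) b 0 \<and> T 1 (arg2 n) a b) \<le> arg1 n) \<or>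
     pr1 n = 6 \<and> all_V N w (\<lambda>y. T 3 (arg0 n) y 0 = T 3 (arg1 n) y 0) \<or>
     pr1 n = 7 \<and> all_V N w (\<lambda>y. T 3 (arg0 n) y 0 \<longrightarrow> T 3 (arg1 n) y 0) \<or>
     pr1 n = 8 \<and> all_A N s (\<lambda>a. all_V N w (\<lambda>y.
        T 0 (arg0 n) a 0 \<and> T 2 (arg1 n) a y \<longrightarrow> T 3 (arg2 n) y 0)) \<or>
     pr1 n = 9 \<and> all_A N s (\<lambda>a. all_V N w (\<lambda>y.
        T 2 (arg0 n) a y \<and> T 3 (arg1 n) y 0 \<longrightarrow> T 0 (arg2 n) a 0)) \<or>
     pr1 n = 10 \<and> all_A N s (\<lambda>a.
        arg0 n \<le> card_V N w (\<lambda>y. T 3 (arg2 n) y 0 \<and> T 2 (arg1 n) a y) \<longrightarrow> T 0 (arg3 n) a 0) \<or>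
     pr1 n = 11 \<and> all_A N s (\<lambda>a. T 0 (arg0 n) a 0 \<longrightarrow>
        card_V N w (\<lambda>y. T 3 (arg3 n) y 0 \<and> T 2 (arg2 n) a y) \<le> arg1 n))"

definition const_elem :: "nat \<Rightarrow> nat \<Rightarrow> nat \<Rightarrow> nat \<Rightarrow> bool" where
  "const_elem N w c y \<longleftrightarrow> in_V N w y \<and> node 1 [c] \<in> set_decode (pr1 y)"

definition abox_ok :: "nat \<Rightarrow> nat \<Rightarrow> nat \<Rightarrow> nat \<Rightarrow> bool" where
  "abox_ok N w s n \<longleftrightarrow>
     pr1 n = 0 \<and> hold N w s 0 (arg1 n) (indv s (arg0 n)) 0 \<or>
     pr1 n = 1 \<and> hold N w s 1 (arg2 n) (indv s (arg0 n)) (indv s (arg1 n)) \<or>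
     pr1 n = 2 \<and> indv s (arg0 n) = indv s (arg1 n) \<or>
     pr1 n = 3 \<and> (\<exists>y\<le>elem_bd N. const_elem N w (arg0 n) y \<and> hold N w s 3 (arg1 n) y 0) \<or>
     pr1 n = 4 \<and> (\<exists>y\<le>elem_bd N. const_elem N w (arg1 n) y \<and>
        hold N w s 2 (arg2 n) (indv s (arg0 n)) y)"

text \<open>The disjunct \<open>x = z\<close> only serves to make the least \<open>x\<close> exist.\<close>

definition obj_of :: "nat \<Rightarrow> nat \<Rightarrow> nat" where
  "obj_of z u = (if pr1 u = 1 then arg0 u
     else (LEAST x. pr (arg0 u) x \<in> set (list_decode z) \<or> x = z))"

definition atom_ok :: "nat \<Rightarrow> nat \<Rightarrow> nat \<Rightarrow> nat \<Rightarrow> bool" where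
  "atom_ok N w s n \<longleftrightarrow> (let ob = obj_of (subst_code N); iv = (\<lambda>u. indv s (arg0 (ob u))) in
     pr1 n = 0 \<and> hold N w s 1 (arg0 n) (iv (arg1 n)) (iv (arg2 n)) \<or>
     pr1 n = 1 \<and> (\<exists>y\<le>elem_bd N. const_elem N w (arg0 (ob (arg2 n))) y \<and>
        hold N w s 2 (arg0 n) (iv (arg1 n)) y) \<or>
     pr1 n = 2 \<and> hold N w s 0 (arg0 n) (iv (arg1 n)) 0 \<or>
     pr1 n = 3 \<and> (pr1 (ob (arg0 n)) = 0 \<and> iv (arg0 n) = iv (arg1 n) \<or>
        pr1 (ob (arg0 n)) = 1 \<and> (\<exists>y\<le>elem_bd N.
          const_elem N w (arg0 (ob (arg0 n))) y \<and> const_elem N w (arg0 (ob (arg1 n))) y)))"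

text \<open>The tags 0 and 1 of objects separate individuals from constants. For a well-formed query
  and substitution this comparison of tags is all that remains of the requirement that the
  instantiated query be a query.\<close>

definition sorts_ok :: "nat \<Rightarrow> nat \<Rightarrow> bool" where
  "sorts_ok z n \<longleftrightarrow> (let so = (\<lambda>u. pr1 (obj_of z u)) in
     pr1 n = 0 \<and> so (arg1 n) = 0 \<and> so (arg2 n) = 0 \<or>
     pr1 n = 1 \<and> so (arg1 n) = 0 \<and> so (arg2 n) = 1 \<or>
     pr1 n = 2 \<and> so (arg1 n) = 0 \<or>
     pr1 n = 3 \<and> so (arg0 n) = so (arg1 n))"

text \<open>In all four kinds of atom the second argument is a query term; role atoms have a further
  one in third place, equations in first place.\<close>

definition var_in_atom :: "nat \<Rightarrow> nat \<Rightarrow> bool" where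
  "var_in_atom v n \<longleftrightarrow> arg1 n = node 0 [v] \<or> pr1 n \<in> {0,1} \<and> arg2 n = node 0 [v] \<or>
     pr1 n = 3 \<and> arg0 n = node 0 [v]"

definition var_in_query :: "nat \<Rightarrow> nat \<Rightarrow> bool" where
  "var_in_query N v \<longleftrightarrow> (\<exists>l\<in>set (list_decode (query_code N)). var_in_atom v (arg0 l))"

definition subst_ok :: "nat \<Rightarrow> bool" where
  "subst_ok N \<longleftrightarrow>
     (\<forall>v\<le>N. (\<exists>x\<le>N. pr v x \<in> set (list_decode (subst_code N))) = var_in_query N v) \<and>
     (\<forall>l\<in>set (list_decode (query_code N)). sorts_ok (subst_code N) (arg0 l))"

definition model_ok :: "nat \<Rightarrow> nat \<Rightarrow> nat \<Rightarrow> bool" where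
  "model_ok N w s \<longleftrightarrow>
     (\<forall>n\<in>set (list_decode (rbox_code N)). rbox_ok N w s n) \<and>
     (\<forall>n\<in>set (list_decode (tbox_code N)). tbox_ok N w s n) \<and>
     (\<forall>n\<in>set (list_decode (abox_code N)). abox_ok N w s n) \<and>
     (\<forall>l\<in>set (list_decode (query_code N)). atom_ok N w s (arg0 l) = (pr1 l = 0))"

definition fact_bd :: "nat \<Rightarrow> nat" where
  "fact_bd N = Suc (pr 3 (pr N (pr (elem_bd N) (elem_bd N))))"

definition answer_ok :: "nat \<Rightarrow> nat \<Rightarrow> bool" where
  "answer_ok N w \<longleftrightarrow> subst_ok N \<and> (\<exists>s<2 ^ fact_bd N. model_ok N w s)"

section \<open>Decidability of the finite search\<close>

lemma decidable_fact_in [rec_intros]: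
  assumes "recursive s" "recursive j" "recursive n" "recursive a" "recursive b"
  shows "decidable (\<lambda>x. fact_in (s x) (j x) (n x) (a x) (b x))"
  unfolding fact_in_def by (intro rec_intros assms)

lemma recursive_indv [rec_intros]:
  assumes "recursive s" "recursive a" shows "recursive (\<lambda>x. indv (s x) (a x))"
proof -
  have "recursive (\<lambda>x. indv (pr1 x) (pr2 x))"
    unfolding indv_def by (rule recursive_Least) (intro rec_intros, blast)
  from recursive_lift2[OF this assms] show ?thesis .
qed

lemma decidable_in_A [rec_intros]:
  "recursive N \<Longrightarrow> recursive s \<Longrightarrow> recursive a \<Longrightarrow> decidable (\<lambda>x. in_A (N x) (s x) (a x))"
  by (rule decidable_lift3, unfold in_A_def) (intro rec_intros)

lemma recursive_parts [rec_intros]: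
  assumes "recursive N"
  shows "recursive (\<lambda>x. rbox_code (N x))" "recursive (\<lambda>x. tbox_code (N x))"
    "recursive (\<lambda>x. abox_code (N x))" "recursive (\<lambda>x. query_code (N x))"
    "recursive (\<lambda>x. subst_code (N x))" "recursive (\<lambda>x. range_bd (N x))"
  unfolding rbox_code_def tbox_code_def abox_code_def query_code_def subst_code_def range_bd_def
  by (intro rec_intros assms)+

lemma decidable_in_R [rec_intros]:
  "recursive N \<Longrightarrow> recursive r \<Longrightarrow> decidable (\<lambda>x. in_R (N x) (r x))"
  by (rule decidable_lift2, unfold in_R_def) (intro rec_intros)

lemma recursive_bds [rec_intros]:
  assumes "recursive N"
  shows "recursive (\<lambda>x. mult_bd (N x))" "recursive (\<lambda>x. elem_bd (N x))"
    "recursive (\<lambda>x. fact_bd (N x))"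
  unfolding mult_bd_def elem_bd_def fact_bd_def
  by (intro rec_intros assms)+

lemma recursive_data_query [rec_intros]:
  "recursive N \<Longrightarrow> recursive y \<Longrightarrow> recursive (\<lambda>x. data_query (N x) (y x))"
  by (rule recursive_lift2, unfold data_query_def) (intro rec_intros)

lemma decidable_candidate [rec_intros]:
  "recursive N \<Longrightarrow> recursive y \<Longrightarrow> decidable (\<lambda>x. candidate (N x) (y x))"
  by (rule decidable_lift2, unfold candidate_def) (intro rec_intros)

lemma recursive_data_queries [rec_intros]: "recursive data_queries"
  unfolding data_queries_def[abs_def] by (intro rec_intros)

lemma decidable_in_V [rec_intros]:
  "recursive N \<Longrightarrow> recursive w \<Longrightarrow> recursive y \<Longrightarrow> decidable (\<lambda>x. in_V (N x) (w x) (y x))"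
  unfolding in_V_def by (intro rec_intros)

lemma decidable_const_elem [rec_intros]:
  "recursive N \<Longrightarrow> recursive w \<Longrightarrow> recursive c \<Longrightarrow> recursive y \<Longrightarrow>
    decidable (\<lambda>x. const_elem (N x) (w x) (c x) (y x))"
  unfolding const_elem_def by (intro rec_intros)

lemma decidable_hold [rec_intros]:
  assumes "recursive N" "recursive w" "recursive s" "recursive k" "recursive n" "recursive a" "recursive b"
  shows "decidable (\<lambda>x. hold (N x) (w x) (s x) (k x) (n x) (a x) (b x))"
proof -
  have "decidable (\<lambda>x. hold (pr1 x) (pr1 (pr2 x)) (pr1 (pr2 (pr2 x))) (k x) (n x) (a x) (b x))"
    if "recursive k" "recursive n" "recursive a" "recursive b" for k n a b
    unfolding hold_def
    by (rule decidable_crec, unfold hold_step_def) (intro rec_intros that)+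
  note * = this[of "\<lambda>x. pr1 (pr2 (pr2 (pr2 x)))" "\<lambda>x. pr1 (pr2 (pr2 (pr2 (pr2 x))))"
      "\<lambda>x. pr1 (pr2 (pr2 (pr2 (pr2 (pr2 x)))))" "\<lambda>x. pr2 (pr2 (pr2 (pr2 (pr2 (pr2 x)))))"]
  have "recursive (\<lambda>x. pr (N x) (pr (w x) (pr (s x) (pr (k x) (pr (n x) (pr (a x) (b x)))))))"
    by (intro rec_intros assms)
  from decidable_comp[OF * this] show ?thesis by (simp add: rec_intros)
qed

lemma decidable_all_A [rec_intros]:
  assumes "decidable (\<lambda>z. P (pr1 z) (pr2 z))" "recursive N" "recursive s"
  shows "decidable (\<lambda>x. all_A (N x) (s x) (P x))"
  unfolding all_A_def
  by (intro rec_intros assms recursive_comp[OF assms(2)] recursive_comp[OF assms(3)])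

lemma decidable_all_V [rec_intros]:
  assumes "decidable (\<lambda>z. P (pr1 z) (pr2 z))" "recursive N" "recursive w"
  shows "decidable (\<lambda>x. all_V (N x) (w x) (P x))"
  unfolding all_V_def
  by (intro rec_intros assms recursive_comp[OF assms(2)] recursive_comp[OF assms(3)])

lemma recursive_card_A [rec_intros]:
  assumes "decidable (\<lambda>z. P (pr1 z) (pr2 z))" "recursive N" "recursive s"
  shows "recursive (\<lambda>x. card_A (N x) (s x) (P x))"
  unfolding card_A_def
  by (intro rec_intros assms recursive_comp[OF assms(2)] recursive_comp[OF assms(3)])

lemma recursive_card_V [rec_intros]:
  assumes "decidable (\<lambda>z. P (pr1 z) (pr2 z))" "recursive N" "recursive w"
  shows "recursive (\<lambda>x. card_V (N x) (w x) (P x))"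
  unfolding card_V_def
  by (intro rec_intros assms recursive_comp[OF assms(2)] recursive_comp[OF assms(3)])

lemma decidable_rbox_ok [rec_intros]:
  "recursive N \<Longrightarrow> recursive w \<Longrightarrow> recursive s \<Longrightarrow> recursive n \<Longrightarrow>
    decidable (\<lambda>x. rbox_ok (N x) (w x) (s x) (n x))"
  by (rule decidable_lift4, unfold rbox_ok_def Let_def) (intro rec_intros)

lemma decidable_tbox_ok [rec_intros]:
  "recursive N \<Longrightarrow> recursive w \<Longrightarrow> recursive s \<Longrightarrow> recursive n \<Longrightarrow>
    decidable (\<lambda>x. tbox_ok (N x) (w x) (s x) (n x))"
  by (rule decidable_lift4, unfold tbox_ok_def Let_def) (intro rec_intros)

lemma decidable_abox_ok [rec_intros]:
  "recursive N \<Longrightarrow> recursive w \<Longrightarrow> recursive s \<Longrightarrow> recursive n \<Longrightarrow>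
    decidable (\<lambda>x. abox_ok (N x) (w x) (s x) (n x))"
  by (rule decidable_lift4, unfold abox_ok_def) (intro rec_intros)

lemma recursive_obj_of [rec_intros]:
  assumes "recursive z" "recursive u" shows "recursive (\<lambda>x. obj_of (z x) (u x))"
proof -
  have "recursive (\<lambda>x. LEAST y. pr (arg0 (pr2 x)) y \<in> set (list_decode (pr1 x)) \<or> y = pr1 x)"
    by (rule recursive_Least) (intro rec_intros, blast)
  hence "recursive (\<lambda>x. obj_of (pr1 x) (pr2 x))"
    unfolding obj_of_def by (intro rec_intros)
  from recursive_lift2[OF this assms] show ?thesis .
qed

lemma decidable_atom_ok [rec_intros]:
  "recursive N \<Longrightarrow> recursive w \<Longrightarrow> recursive s \<Longrightarrow> recursive n \<Longrightarrow>
    decidable (\<lambda>x. atom_ok (N x) (w x) (s x) (n x))"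
  by (rule decidable_lift4, unfold atom_ok_def Let_def) (intro rec_intros)

lemma decidable_sorts_ok [rec_intros]:
  "recursive z \<Longrightarrow> recursive n \<Longrightarrow> decidable (\<lambda>x. sorts_ok (z x) (n x))"
  unfolding sorts_ok_def Let_def by (intro rec_intros)

lemma decidable_var_in_query [rec_intros]:
  "recursive N \<Longrightarrow> recursive v \<Longrightarrow> decidable (\<lambda>x. var_in_query (N x) (v x))"
  by (rule decidable_lift2, unfold var_in_query_def var_in_atom_def) (intro rec_intros)

lemma decidable_answer_ok: "decidable (\<lambda>x. answer_ok (pr1 x) (pr2 x))"
  unfolding answer_ok_def subst_ok_def model_ok_def by (intro rec_intros)


section \<open>The data domain\<close>

text \<open>
  Without datatypes there are no data values, but the data domain of an interpretation is still
  nonempty. Universal statements are preserved under shrinking it to the sets \<open>W\<close> below.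
\<close>

definition data_core :: "'u datatype_map \<Rightarrow> 'u set \<Rightarrow> bool" where
  "data_core D W \<longleftrightarrow> W \<noteq> {} \<and> data_values D \<subseteq> W \<and>
     (if data_values D = {} then \<exists>v. W = {v} else W = data_values D)"

primrec lit_holds_in :: "'u datatype_map \<Rightarrow> 'u set \<Rightarrow> (nat \<Rightarrow> 'u) \<Rightarrow> data_lit \<Rightarrow> bool" where
  "lit_holds_in D W v (InRange x r) \<longleftrightarrow> v x \<in> range_sem D W r"
| "lit_holds_in D W v (Distinct x y) \<longleftrightarrow> v x \<noteq> v y"

definition conj_sat_in :: "'u datatype_map \<Rightarrow> 'u set \<Rightarrow> data_lit list \<Rightarrow> bool" where
  "conj_sat_in D W ls \<longleftrightarrow> (\<exists>v. (\<forall>x. v x \<in> W) \<and> (\<forall>l\<in>set ls. lit_holds_in D W v l))"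

lemma dtype_subset_data_values: "d \<in> dtypes D \<Longrightarrow> dtype_int D d \<subseteq> data_values D"
  by (auto simp: data_values_def)

lemma facet_sem_subset:
  assumes "datatype_map D" "d \<in> dtypes D" "facet_names x \<subseteq> facets_of D d"
  shows "facet_sem D d x \<subseteq> dtype_int D d"
  using assms(3) assms(1,2) by (induction x) (auto simp: datatype_map_def)

lemma const_val_in_data_values:
  "datatype_map D \<Longrightarrow> c \<in> all_consts D \<Longrightarrow> const_val D c \<in> data_values D"
  unfolding datatype_map_def all_consts_def const_val_def data_values_def
  by (cases c) (simp, blast)

lemma range_sem_subset:
  assumes "datatype_map D" "data_values D \<subseteq> V" "wf_range D r"
  shows "range_sem D V r \<subseteq> V"
  using assms(3)
proof (induction r)
  case (Dtype d)
  thus ?case using dtype_subset_data_values[of d D] assms(2) by simp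
next
  case (DEnum cs)
  thus ?case using const_val_in_data_values[OF assms(1)] assms(2) by auto
next
  case (DFacet d x)
  thus ?case using facet_sem_subset[OF assms(1), of d x] dtype_subset_data_values[of d D] assms(2)
    by simp
qed auto

text \<open>Complements in \<open>V\<close> and in \<open>W\<close> agree on \<open>W\<close>, and
  the other ranges do not depend on the domain. Shrinking the data domain rests on this.\<close>

lemma range_sem_restrict:
  assumes "datatype_map D" "data_values D \<subseteq> W" "W \<subseteq> V" "wf_range D r" "v \<in> W"
  shows "v \<in> range_sem D V r \<longleftrightarrow> v \<in> range_sem D W r"
  using assms(4) by (induction r) (use assms in auto)

text \<open>Without datatypes the only well-formed ranges are the empty enumeration under some
  number of complements. The single data value lies in such a range iff this number is odd.\<close>

definition neg_parity :: "nat \<Rightarrow> bool" where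
  "neg_parity n = crec 1 (\<lambda>n p orc. pr1 n = 3 \<and> \<not> orc (arg0 n) 0) n 0"

lemma neg_parity_node:
  "neg_parity (node k ns) \<longleftrightarrow> k = 3 \<and> \<not> (arg0 (node k ns) < node k ns \<and> neg_parity (arg0 (node k ns)))"
  unfolding neg_parity_def by (subst crec.simps) simp

lemma decidable_neg_parity [rec_intros]: "recursive n \<Longrightarrow> decidable (\<lambda>x. neg_parity (n x))"
  unfolding neg_parity_def by (rule decidable_crec) (intro rec_intros | assumption)+

text \<open>If there are no data values, the given procedure answers for an empty set of values,
  whereas interpretations have a nonempty data domain. In that case literals are evaluated directly
  at a single value, where distinctness always fails.\<close>

lemma effective_data_core:
  assumes "datatype_map D" "effective_datatype_map D"
  obtains f where "partrec f"
    "\<And>W ls. data_core D W \<Longrightarrow> (\<forall>l\<in>set ls. wf_data_lit D l) \<Longrightarrow>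
      f (list_encode (map enc_data_lit ls)) = Some (of_bool (conj_sat_in D W ls))"
proof (cases "data_values D = {}")
  case False
  obtain f where f: "partrec f" "\<And>ls. (\<forall>l\<in>set ls. wf_data_lit D l) \<Longrightarrow>
      f (list_encode (map enc_data_lit ls)) = Some (of_bool (data_conj_sat D ls))"
    using assms(2) unfolding effective_datatype_map_def by blast
  have "lit_holds_in D (data_values D) v l = data_lit_holds D v l" for v l
    by (cases l) auto
  hence "conj_sat_in D W ls = data_conj_sat D ls" if "data_core D W" for W ls
    using that False by (simp add: data_core_def conj_sat_in_def data_conj_sat_def)
  thus ?thesis using that[OF f(1)] f(2) by simp
next
  case True
  hence no: "dtypes D = {}" using assms(1) by (auto simp: data_values_def datatype_map_def)
  have par: "v \<in> range_sem D {v} r \<longleftrightarrow> neg_parity (enc_range r)" if "wf_range D r" for v r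
    using that no
    by (induction r) (auto simp: neg_parity_node all_consts_def)
  define f where "f = (\<lambda>n. Some (of_bool (\<forall>l\<in>set (list_decode n). pr1 l = 0 \<and> neg_parity (arg1 l)) :: nat))"
  have "recursive (\<lambda>n. of_bool (\<forall>l\<in>set (list_decode n). pr1 l = 0 \<and> neg_parity (arg1 l)))"
    by (intro rec_intros)
  hence "partrec f" unfolding f_def recursive_def .
  moreover have "f (list_encode (map enc_data_lit ls)) = Some (of_bool (conj_sat_in D W ls))"
    if W: "data_core D W" and wf: "\<forall>l\<in>set ls. wf_data_lit D l" for W ls
  proof -
    obtain v where v: "W = {v}" using W True by (auto simp: data_core_def)
    have "lit_holds_in D W (\<lambda>_. v) l \<longleftrightarrow> pr1 (enc_data_lit l) = 0 \<and> neg_parity (arg1 (enc_data_lit l))"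
      if "l \<in> set ls" for l
      using wf that by (cases l) (auto simp: v par)
    moreover have "conj_sat_in D W ls \<longleftrightarrow> (\<forall>l\<in>set ls. lit_holds_in D W (\<lambda>_. v) l)"
    proof -
      have "(\<forall>x. u x \<in> W) \<longleftrightarrow> u = (\<lambda>_. v)" for u :: "nat \<Rightarrow> _" using v by auto
      thus ?thesis unfolding conj_sat_in_def by simp
    qed
    ultimately show ?thesis by (simp add: f_def)
  qed
  ultimately show ?thesis using that by blast
qed


section \<open>Unfolding the evaluation of codes\<close>

text \<open>Stated as an inclusion, occurrence unfolds along codes by plain rewriting. The set
  \<open>X\<close> is instantiated in two ways: by the ranges found in the input, and by the codes
  of well-formed ranges.\<close>

definition occs :: "nat \<Rightarrow> nat set \<Rightarrow> nat \<Rightarrow> nat \<Rightarrow> bool" where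
  "occs R X k n \<longleftrightarrow> (\<forall>r\<le>R. occ R n k r \<longrightarrow> r \<in> X)"

lemma occs_unfold:
  "occs R X k n \<longleftrightarrow> (\<forall>r\<le>R. occ_step n k r (\<lambda>m k'. m < n \<and> k' \<le> 14 \<and> occ R m k' r) \<longrightarrow> r \<in> X)"
  unfolding occs_def using occ_unfold by blast

lemma occs_concept [simp]:
  "occs R X 0 (node 0 [x])" "occs R X 0 (node 1 [])" "occs R X 0 (node 2 [])"
  "occs R X 0 (node 3 [m]) = occs R X 0 m"
  "occs R X 0 (node 4 [m, n]) \<longleftrightarrow> occs R X 0 m \<and> occs R X 0 n"
  "occs R X 0 (node 5 [m, n]) \<longleftrightarrow> occs R X 0 m \<and> occs R X 0 n"
  "occs R X 0 (node 6 [x])"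
  "occs R X 0 (node 7 [m]) = occs R X 1 m"
  "occs R X 0 (node 8 [m, x]) = occs R X 1 m"
  "occs R X 0 (node 9 [m, n]) \<longleftrightarrow> occs R X 2 m \<and> occs R X 6 n"
  by (subst occs_unfold, (auto simp: occs_def occ_step_def)[1])+

lemma occs_arole [simp]:
  "occs R X 1 (node 0 [x])" "occs R X 1 (node 1 [])"
  "occs R X 1 (node 2 [m]) = occs R X 1 m" "occs R X 1 (node 3 [m]) = occs R X 1 m"
  "occs R X 1 (node 4 [m, n]) \<longleftrightarrow> occs R X 1 m \<and> occs R X 1 n"
  "occs R X 1 (node 5 [m, n]) \<longleftrightarrow> occs R X 1 m \<and> occs R X 1 n"
  "occs R X 1 (node 6 [m, n]) \<longleftrightarrow> occs R X 1 m \<and> occs R X 0 n"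
  "occs R X 1 (node 7 [m, n]) \<longleftrightarrow> occs R X 1 m \<and> occs R X 0 n"
  "occs R X 1 (node 8 [m, n, l]) \<longleftrightarrow> occs R X 1 m \<and> occs R X 0 n \<and> occs R X 0 l"
  "occs R X 1 (node 9 [m]) = occs R X 0 m"
  "occs R X 1 (node 10 [m, n]) \<longleftrightarrow> occs R X 0 m \<and> occs R X 0 n"
  by (subst occs_unfold, (auto simp: occs_def occ_step_def)[1])+

lemma occs_crole [simp]:
  "occs R X 2 (node 0 [x])" "occs R X 2 (node 1 [m]) = occs R X 2 m"
  "occs R X 2 (node 2 [m, n]) \<longleftrightarrow> occs R X 2 m \<and> occs R X 2 n"
  "occs R X 2 (node 3 [m, n]) \<longleftrightarrow> occs R X 2 m \<and> occs R X 2 n"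
  "occs R X 2 (node 4 [m, n]) \<longleftrightarrow> occs R X 2 m \<and> occs R X 0 n"
  "occs R X 2 (node 5 [m, n]) \<longleftrightarrow> occs R X 2 m \<and> occs R X 3 n"
  "occs R X 2 (node 6 [m, n, l]) \<longleftrightarrow> occs R X 2 m \<and> occs R X 0 n \<and> occs R X 3 l"
  by (subst occs_unfold, (auto simp: occs_def occ_step_def)[1])+

lemma occs_dterm [simp]:
  "occs R X 3 (node 0 [m]) = occs R X 5 m" "occs R X 3 (node 1 [m]) = occs R X 3 m"
  "occs R X 3 (node 2 [m, n]) \<longleftrightarrow> occs R X 3 m \<and> occs R X 3 n"
  "occs R X 3 (node 3 [m, n]) \<longleftrightarrow> occs R X 3 m \<and> occs R X 3 n"
  "occs R X 3 (node 4 [m]) = occs R X 6 m"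
  "occs R X 5 m \<longleftrightarrow> m \<le> R \<longrightarrow> m \<in> X" "occs R X 6 m \<longleftrightarrow> node 1 [m] \<le> R \<longrightarrow> node 1 [m] \<in> X"
  by (subst occs_unfold, (auto simp: occs_def occ_step_def)[1])+

lemma occs_chain [simp]:
  "occs R X 4 (list_encode (map enc_arole Rs)) \<longleftrightarrow> (\<forall>r\<in>set Rs. occs R X 1 (enc_arole r))"
proof (induction Rs)
  case Nil
  show ?case by (subst occs_unfold) (simp add: occ_step_def)
next
  case (Cons a Rs)
  let ?n = "list_encode (map enc_arole (a # Rs))"
  have "enc_arole a < ?n" by (rule member_le_list_encode) simp
  moreover have "list_encode (map enc_arole Rs) < ?n"
    using pr_ge2 by (simp add: list_encode_Cons less_Suc_eq_le)
  ultimately have "occs R X 4 ?n \<longleftrightarrow> occs R X 1 (enc_arole a) \<and> occs R X 4 (list_encode (map enc_arole Rs))"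
    by (subst occs_unfold, unfold occs_def occ_step_def) auto
  thus ?case using Cons by auto
qed

lemma occs_rbox [simp]:
  "occs R X 8 (node 0 [m, n]) \<longleftrightarrow> occs R X 1 m \<and> occs R X 1 n"
  "occs R X 8 (node 1 [m, n]) \<longleftrightarrow> occs R X 1 m \<and> occs R X 1 n"
  "occs R X 8 (node 2 [m, n]) \<longleftrightarrow> occs R X 4 m \<and> occs R X 1 n"
  "occs R X 8 (node 3 [m]) = occs R X 1 m" "occs R X 8 (node 4 [m]) = occs R X 1 m"
  "occs R X 8 (node 5 [m]) = occs R X 1 m" "occs R X 8 (node 6 [m]) = occs R X 1 m"
  "occs R X 8 (node 7 [m, n]) \<longleftrightarrow> occs R X 1 m \<and> occs R X 1 n"
  "occs R X 8 (node 8 [m]) = occs R X 1 m" "occs R X 8 (node 9 [m]) = occs R X 1 m"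
  "occs R X 8 (node 10 [m, n, l]) \<longleftrightarrow> occs R X 1 m \<and> occs R X 0 n \<and> occs R X 0 l"
  "occs R X 8 (node 11 [m, n]) \<longleftrightarrow> occs R X 2 m \<and> occs R X 2 n"
  "occs R X 8 (node 12 [m, n]) \<longleftrightarrow> occs R X 2 m \<and> occs R X 2 n"
  "occs R X 8 (node 13 [m, n]) \<longleftrightarrow> occs R X 2 m \<and> occs R X 2 n"
  "occs R X 8 (node 14 [m]) = occs R X 2 m"
  by (subst occs_unfold, (auto simp: occs_def occ_step_def)[1])+

lemma occs_tbox [simp]:
  "occs R X 9 (node 0 [m, n]) \<longleftrightarrow> occs R X 0 m \<and> occs R X 0 n"
  "occs R X 9 (node 1 [m, n]) \<longleftrightarrow> occs R X 0 m \<and> occs R X 0 n"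
  "occs R X 9 (node 2 [m, n, l]) \<longleftrightarrow> occs R X 0 m \<and> occs R X 1 n \<and> occs R X 0 l"
  "occs R X 9 (node 3 [m, n, l]) \<longleftrightarrow> occs R X 1 m \<and> occs R X 0 n \<and> occs R X 0 l"
  "occs R X 9 (node 4 [x, m, n, l]) \<longleftrightarrow> occs R X 1 m \<and> occs R X 0 n \<and> occs R X 0 l"
  "occs R X 9 (node 5 [m, x, n, l]) \<longleftrightarrow> occs R X 0 m \<and> occs R X 1 n \<and> occs R X 0 l"
  "occs R X 9 (node 6 [m, n]) \<longleftrightarrow> occs R X 3 m \<and> occs R X 3 n"
  "occs R X 9 (node 7 [m, n]) \<longleftrightarrow> occs R X 3 m \<and> occs R X 3 n"
  "occs R X 9 (node 8 [m, n, l]) \<longleftrightarrow> occs R X 0 m \<and> occs R X 2 n \<and> occs R X 3 l"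
  "occs R X 9 (node 9 [m, n, l]) \<longleftrightarrow> occs R X 2 m \<and> occs R X 3 n \<and> occs R X 0 l"
  "occs R X 9 (node 10 [x, m, n, l]) \<longleftrightarrow> occs R X 2 m \<and> occs R X 3 n \<and> occs R X 0 l"
  "occs R X 9 (node 11 [m, x, n, l]) \<longleftrightarrow> occs R X 0 m \<and> occs R X 2 n \<and> occs R X 3 l"
  by (subst occs_unfold, (auto simp: occs_def occ_step_def)[1])+

lemma occs_abox [simp]:
  "occs R X 10 (node 0 [x, m]) = occs R X 0 m" "occs R X 10 (node 1 [x, y, m]) = occs R X 1 m"
  "occs R X 10 (node 2 [x, y])"
  "occs R X 10 (node 3 [m, n]) \<longleftrightarrow> occs R X 6 m \<and> occs R X 3 n"
  "occs R X 10 (node 4 [x, m, n]) \<longleftrightarrow> occs R X 6 m \<and> occs R X 2 n"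
  by (subst occs_unfold, (auto simp: occs_def occ_step_def)[1])+

lemma occs_query [simp]:
  "occs R X 11 (node 0 [m, n, l]) \<longleftrightarrow> occs R X 1 m \<and> occs R X 13 n \<and> occs R X 13 l"
  "occs R X 11 (node 1 [m, n, l]) \<longleftrightarrow> occs R X 2 m \<and> occs R X 13 n \<and> occs R X 13 l"
  "occs R X 11 (node 2 [m, n]) \<longleftrightarrow> occs R X 0 m \<and> occs R X 13 n"
  "occs R X 11 (node 3 [m, n]) \<longleftrightarrow> occs R X 13 m \<and> occs R X 13 n"
  "occs R X 12 (node k [m]) = occs R X 11 m"
  "occs R X 13 (node 0 [x])" "occs R X 13 (node 1 [m]) = occs R X 14 m"
  "occs R X 14 (node 0 [x])" "occs R X 14 (node 1 [m]) = occs R X 6 m"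
  by (subst occs_unfold, (auto simp: occs_def occ_step_def)[1])+


declare One_nat_def [simp del] \<comment> \<open>the rewrite rules for codes mention the tag 1\<close>

section \<open>Bounds on elements, and evaluation node by node\<close>

lemma N_le_elem_bd: "N \<le> elem_bd N"
proof -
  have "N \<le> range_bd N" unfolding range_bd_def by (rule less_imp_le) simp
  also have "\<dots> \<le> 2 ^ Suc (range_bd N)"
    using less_exp[of "Suc (range_bd N)"] by simp
  also have "\<dots> \<le> elem_bd N" unfolding elem_bd_def by (rule pr_ge1)
  finally show ?thesis .
qed

lemma indv_le: "indv s a \<le> a"
  unfolding indv_def by (rule Least_le) simp

lemma in_A_le: "in_A N s a \<Longrightarrow> a \<le> N"
  unfolding in_A_def using indv_le le_trans by blast

lemma in_V_le: "in_V N w y \<Longrightarrow> y \<le> elem_bd N"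
  using pr_mono[of "pr1 y" "2 ^ Suc (range_bd N)" "pr2 y" "mult_bd N"]
  by (simp add: in_V_def candidate_def elem_bd_def)

lemma hold_unfold:
  "hold N w s k n a b = hold_step N w s n k a b (\<lambda>m k' a' b'. m < n \<and>
     pr k' (pr a' b') < Suc (pr 4 (pr (elem_bd N) (elem_bd N))) \<and> hold N w s k' m a' b')"
  unfolding hold_def by (subst crec.simps) simp

text \<open>Within these bounds the truncation of points in \<open>crec\<close> has no effect, so
  evaluation obeys its intended clauses.\<close>

lemma point_bound:
  "k \<le> 4 \<Longrightarrow> a \<le> elem_bd N \<Longrightarrow> b \<le> elem_bd N \<Longrightarrow>
    pr k (pr a b) < Suc (pr 4 (pr (elem_bd N) (elem_bd N)))"
  by (simp add: pr_mono less_Suc_eq_le)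

context
  fixes N a :: nat assumes bd: "a \<le> elem_bd N"
begin

lemma hold_concept_code:
  "hold N w s 0 (node 0 [x]) a 0 = fact_in s 1 x a 0"
  "hold N w s 0 (node 1 []) a 0"
  "\<not> hold N w s 0 (node 2 []) a 0"
  "hold N w s 0 (node 3 [m]) a 0 \<longleftrightarrow> \<not> hold N w s 0 m a 0"
  "hold N w s 0 (node 4 [m, n]) a 0 \<longleftrightarrow> hold N w s 0 m a 0 \<or> hold N w s 0 n a 0"
  "hold N w s 0 (node 5 [m, n]) a 0 \<longleftrightarrow> hold N w s 0 m a 0 \<and> hold N w s 0 n a 0"
  "hold N w s 0 (node 6 [x]) a 0 \<longleftrightarrow> a = indv s x"
  "hold N w s 0 (node 7 [m]) a 0 \<longleftrightarrow> hold N w s 1 m a a"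
  "x \<le> N \<Longrightarrow> hold N w s 0 (node 8 [m, x]) a 0 \<longleftrightarrow> hold N w s 1 m a (indv s x)"
  "hold N w s 0 (node 9 [m, x]) a 0 \<longleftrightarrow> (\<exists>y\<le>elem_bd N. const_elem N w x y \<and> hold N w s 2 m a y)"
  using order_trans[OF indv_le order_trans[OF _ N_le_elem_bd]]
  by (subst hold_unfold, (simp add: hold_step_def point_bound bd const_elem_def conj_ac cong: conj_cong)[1])+

lemma hold_dterm_code:
  "hold N w s 3 (node 0 [x]) a 0 \<longleftrightarrow> x \<in> set_decode (pr1 a)"
  "hold N w s 3 (node 1 [m]) a 0 \<longleftrightarrow> \<not> hold N w s 3 m a 0"
  "hold N w s 3 (node 2 [m, n]) a 0 \<longleftrightarrow> hold N w s 3 m a 0 \<and> hold N w s 3 n a 0"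
  "hold N w s 3 (node 3 [m, n]) a 0 \<longleftrightarrow> hold N w s 3 m a 0 \<or> hold N w s 3 n a 0"
  "hold N w s 3 (node 4 [x]) a 0 \<longleftrightarrow> node 1 [x] \<in> set_decode (pr1 a)"
  by (subst hold_unfold, (simp add: hold_step_def point_bound bd)[1])+

end

context
  fixes N a b :: nat assumes bd: "a \<le> elem_bd N" "b \<le> elem_bd N"
begin

lemma hold_arole_code:
  "hold N w s 1 (node 0 [x]) a b = fact_in s 2 x a b"
  "hold N w s 1 (node 1 []) a b"
  "hold N w s 1 (node 2 [m]) a b \<longleftrightarrow> hold N w s 1 m b a"
  "hold N w s 1 (node 3 [m]) a b \<longleftrightarrow> \<not> hold N w s 1 m a b"
  "hold N w s 1 (node 4 [m, n]) a b \<longleftrightarrow> hold N w s 1 m a b \<or> hold N w s 1 n a b"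
  "hold N w s 1 (node 5 [m, n]) a b \<longleftrightarrow> hold N w s 1 m a b \<and> hold N w s 1 n a b"
  "hold N w s 1 (node 6 [m, n]) a b \<longleftrightarrow> hold N w s 1 m a b \<and> hold N w s 0 n a 0"
  "hold N w s 1 (node 7 [m, n]) a b \<longleftrightarrow> hold N w s 1 m a b \<and> hold N w s 0 n b 0"
  "hold N w s 1 (node 8 [m, n, l]) a b \<longleftrightarrow>
     hold N w s 1 m a b \<and> hold N w s 0 n a 0 \<and> hold N w s 0 l b 0"
  "hold N w s 1 (node 9 [n]) a b \<longleftrightarrow> a = b \<and> hold N w s 0 n a 0"
  "hold N w s 1 (node 10 [m, n]) a b \<longleftrightarrow> hold N w s 0 m a 0 \<and> hold N w s 0 n b 0"
  by (subst hold_unfold, (simp add: hold_step_def point_bound bd)[1])+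

lemma hold_crole_code:
  "hold N w s 2 (node 0 [x]) a b = fact_in s 3 x a b"
  "hold N w s 2 (node 1 [m]) a b \<longleftrightarrow> \<not> hold N w s 2 m a b"
  "hold N w s 2 (node 2 [m, n]) a b \<longleftrightarrow> hold N w s 2 m a b \<or> hold N w s 2 n a b"
  "hold N w s 2 (node 3 [m, n]) a b \<longleftrightarrow> hold N w s 2 m a b \<and> hold N w s 2 n a b"
  "hold N w s 2 (node 4 [m, n]) a b \<longleftrightarrow> hold N w s 2 m a b \<and> hold N w s 0 n a 0"
  "hold N w s 2 (node 5 [m, n]) a b \<longleftrightarrow> hold N w s 2 m a b \<and> hold N w s 3 n b 0"
  "hold N w s 2 (node 6 [m, n, l]) a b \<longleftrightarrow>
     hold N w s 2 m a b \<and> hold N w s 0 n a 0 \<and> hold N w s 3 l b 0"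
  by (subst hold_unfold, (simp add: hold_step_def point_bound bd)[1])+

lemma hold_chain_Cons:
  "hold N w s 4 (list_encode (m # ns)) a b \<longleftrightarrow>
     (\<exists>c. in_A N s c \<and> hold N w s 1 m a c \<and> hold N w s 4 (list_encode ns) c b)"
proof -
  let ?n = "list_encode (m # ns)"
  have "m < ?n" by (rule member_le_list_encode) simp
  moreover have "list_encode ns < ?n"
    using pr_ge2 by (simp add: list_encode_Cons less_Suc_eq_le)
  moreover have "c \<le> elem_bd N" if "c \<le> N" for c using that N_le_elem_bd le_trans by blast
  ultimately have "hold N w s 4 (list_encode (m # ns)) a b \<longleftrightarrow>
      (\<exists>c\<le>N. in_A N s c \<and> hold N w s 1 m a c \<and> hold N w s 4 (list_encode ns) c b)"
    by (subst hold_unfold) (simp add: hold_step_def point_bound bd cong: conj_cong)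
  thus ?thesis using in_A_le by blast
qed

end

lemma hold_chain_Nil: "hold N w s 4 (list_encode []) a b \<longleftrightarrow> a = b"
  by (subst hold_unfold) (simp add: hold_step_def)

lemmas hold_code = hold_concept_code hold_arole_code hold_crole_code hold_dterm_code


section \<open>Correspondence between finite structures and interpretations\<close>

text \<open>Extensions contain nothing outside the domains, so an axiom need only be checked at
  elements that a structure can represent.\<close>

lemma sem_subset:
  assumes I: "interpretation_of S D I" and D: "datatype_map D"
  shows dterm_sem_subset: "wf_dterm D t \<Longrightarrow> dterm_sem D I t \<subseteq> ddom I"
    and concept_sem_subset: "wf_concept S D C \<Longrightarrow> concept_sem D I C \<subseteq> adom I"
    and arole_sem_subset: "wf_arole S D R \<Longrightarrow> arole_sem D I R \<subseteq> adom I \<times> adom I"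
    and crole_sem_subset: "wf_crole S D P \<Longrightarrow> crole_sem D I P \<subseteq> adom I \<times> ddom I"
proof -
  have dv: "data_values D \<subseteq> ddom I"
    using I by (auto simp: interpretation_of_def data_values_def)
  show "wf_dterm D t \<Longrightarrow> dterm_sem D I t \<subseteq> ddom I"
  proof (induction t)
    case (TRange r)
    thus ?case using range_sem_subset[OF D dv] by simp
  next
    case (TConst c)
    thus ?case using const_val_in_data_values[OF D, of c] dv by auto
  qed auto
  have J: "\<forall>A\<in>concept_names S. concept_int I A \<subseteq> adom I" "\<forall>a\<in>inds S. ind_int I a \<in> adom I"
    "\<forall>r\<in>arole_names S. arole_int I r \<subseteq> adom I \<times> adom I"
    "\<forall>p\<in>crole_names S. crole_int I p \<subseteq> adom I \<times> ddom I"
    using I unfolding interpretation_of_def by blast+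
  show "wf_concept S D C \<Longrightarrow> concept_sem D I C \<subseteq> adom I"
    and "wf_arole S D R \<Longrightarrow> arole_sem D I R \<subseteq> adom I \<times> adom I"
    and "wf_crole S D P \<Longrightarrow> crole_sem D I P \<subseteq> adom I \<times> ddom I"
    by (induction C and R and P) (use J in \<open>(auto; fail) | (simp; blast)\<close>)+
qed

text \<open>The common part of both directions: \<open>relA\<close> and \<open>relD\<close> match
  elements of the structure with elements of the interpretation such that atomic facts agree.
  \<open>relA\<close> is one-to-one, whereas \<open>relD\<close> may relate one element to many
  values and one value to many elements. Constants are the exception: each has exactly one element,
  so that a constant can be evaluated through its type.\<close>

locale corr =
  fixes S :: signature and D :: "'u datatype_map" and I :: "'u interp"
    and N w s :: nat and relA relD :: "nat \<Rightarrow> 'u \<Rightarrow> bool"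
  assumes I: "interpretation_of S D I" and D: "datatype_map D"
    and A_bd: "relA a x \<Longrightarrow> in_A N s a \<and> x \<in> adom I"
    and A_inj: "relA a x \<Longrightarrow> relA b x' \<Longrightarrow> a = b \<longleftrightarrow> x = x'"
    and A_ind: "i \<le> N \<Longrightarrow> i \<in> inds S \<Longrightarrow> relA (indv s i) (ind_int I i)"
    and con: "n \<le> N \<Longrightarrow> n \<in> concept_names S \<Longrightarrow> relA a x \<Longrightarrow>
      fact_in s 1 n a 0 \<longleftrightarrow> x \<in> concept_int I n"
    and rol: "n \<le> N \<Longrightarrow> n \<in> arole_names S \<Longrightarrow> relA a x \<Longrightarrow> relA b x' \<Longrightarrow>
      fact_in s 2 n a b \<longleftrightarrow> (x, x') \<in> arole_int I n"
    and crl: "n \<le> N \<Longrightarrow> n \<in> crole_names S \<Longrightarrow> relA a x \<Longrightarrow> relD y v \<Longrightarrow>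
      fact_in s 3 n a y \<longleftrightarrow> (x, v) \<in> crole_int I n"
    and D_bd: "relD y v \<Longrightarrow> in_V N w y \<and> v \<in> ddom I"
    and rng: "relD y v \<Longrightarrow> in_R N (enc_range r) \<Longrightarrow> wf_range D r \<Longrightarrow>
      enc_range r \<in> set_decode (pr1 y) \<longleftrightarrow> v \<in> range_sem D (ddom I) r"
    and cst: "c \<in> all_consts D \<Longrightarrow> in_R N (node 1 [prod_encode c]) \<Longrightarrow>
      \<exists>y. relD y (const_val D c) \<and> (\<forall>y'. const_elem N w (prod_encode c) y' \<longrightarrow> y' = y)"
begin

abbreviation known :: "nat \<Rightarrow> nat \<Rightarrow> bool" where
  "known k n \<equiv> occs (range_bd N) {r. in_R N r} k n"

lemma relA_le: "relA a x \<Longrightarrow> a \<le> elem_bd N"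
  using A_bd in_A_le N_le_elem_bd le_trans by blast

lemma relD_le: "relD y v \<Longrightarrow> y \<le> elem_bd N"
  using D_bd in_V_le by blast

lemma le_range_bd: "n \<le> N \<Longrightarrow> n \<le> range_bd N"
  unfolding range_bd_def using arg_less_node(1)[of N 1 "[]"] by linarith

lemma const_le_range_bd: "n \<le> N \<Longrightarrow> node 1 [n] \<le> range_bd N"
  unfolding range_bd_def by (simp add: node_eq_pr list_encode_Cons pr_mono)

text \<open>As the element of a constant is unique, the existential quantifier in the evaluation of
  constants collapses to a statement about that element.\<close>

lemma const_elem_ex:
  assumes "c \<in> all_consts D" "known 6 (prod_encode c)" "prod_encode c \<le> N"
  obtains y where "relD y (const_val D c)" "const_elem N w (prod_encode c) y"
    "\<And>y'. const_elem N w (prod_encode c) y' \<Longrightarrow> y' = y"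
    "\<And>Q. (\<exists>y'\<le>elem_bd N. const_elem N w (prod_encode c) y' \<and> Q y') \<longleftrightarrow> Q y"
proof -
  have r: "in_R N (node 1 [prod_encode c])" using assms const_le_range_bd by simp
  obtain y where y: "relD y (const_val D c)" "\<forall>y'. const_elem N w (prod_encode c) y' \<longrightarrow> y' = y"
    using cst[OF assms(1) r] by blast
  have "node 1 [prod_encode c] \<in> set_decode (pr1 y)"
    using rng[OF y(1), of "DEnum [c]"] r assms(1) by simp
  hence "const_elem N w (prod_encode c) y" using D_bd[OF y(1)] by (simp add: const_elem_def)
  thus ?thesis using that[of y] y relD_le[OF y(1)] by blast
qed

lemma arg_le: "node k ns \<le> N \<Longrightarrow> m \<in> set ns \<Longrightarrow> m \<le> N"
  using member_less_node[of m ns k] by simp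

lemma hold_dterm:
  "wf_dterm D t \<Longrightarrow> enc_dterm t \<le> N \<Longrightarrow> known 3 (enc_dterm t) \<Longrightarrow> relD y v \<Longrightarrow>
    hold N w s 3 (enc_dterm t) y 0 \<longleftrightarrow> v \<in> dterm_sem D I t"
proof (induction t)
  case (TRange r)
  have "enc_range r \<le> N" using TRange.prems(2) arg_le by simp
  thus ?case using TRange.prems rng le_range_bd by (simp add: hold_code relD_le)
next
  case (TConst c)
  have "prod_encode c \<le> N" using TConst.prems(2) arg_le by simp
  thus ?case
    using TConst.prems rng[of y v "DEnum [c]"] const_le_range_bd by (simp add: hold_code relD_le)
qed (use arg_le D_bd in \<open>auto simp: hold_code relD_le\<close>)

text \<open>No concept or role constructor quantifies over the abstract domain: its value depends on
  its components at the given points, at named individuals and at constants. Agreement therefore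
  propagates although neither relation has to be total.\<close>

lemma hold_sem:
  shows hold_concept: "wf_concept S D C \<Longrightarrow> enc_concept C \<le> N \<Longrightarrow> known 0 (enc_concept C) \<Longrightarrow>
      relA a x \<Longrightarrow> hold N w s 0 (enc_concept C) a 0 \<longleftrightarrow> x \<in> concept_sem D I C"
    and hold_arole: "wf_arole S D R \<Longrightarrow> enc_arole R \<le> N \<Longrightarrow> known 1 (enc_arole R) \<Longrightarrow>
      relA a x \<Longrightarrow> relA b y \<Longrightarrow> hold N w s 1 (enc_arole R) a b \<longleftrightarrow> (x, y) \<in> arole_sem D I R"
    and hold_crole: "wf_crole S D P \<Longrightarrow> enc_crole P \<le> N \<Longrightarrow> known 2 (enc_crole P) \<Longrightarrow>
      relA a x \<Longrightarrow> relD u v \<Longrightarrow> hold N w s 2 (enc_crole P) a u \<longleftrightarrow> (x, v) \<in> crole_sem D I P"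
proof (induction C and R and P arbitrary: a x and a x b y and a x u v)
  case (CName n)
  thus ?case using arg_le con by (simp add: hold_code relA_le)
next
  case (CNom i)
  have "i \<le> N" using CNom.prems(2) arg_le by simp
  thus ?case using CNom.prems A_ind A_inj by (simp add: hold_code relA_le)
next
  case (CHasInd R i)
  have "i \<le> N" "enc_arole R \<le> N" using CHasInd.prems(2) arg_le by simp_all
  thus ?case using CHasInd A_ind by (simp add: hold_code relA_le)
next
  case (CHasConst P c)
  have le: "prod_encode c \<le> N" "enc_crole P \<le> N" using CHasConst.prems(2) arg_le by simp_all
  have c: "c \<in> all_consts D" "known 6 (prod_encode c)" using CHasConst.prems by simp_all
  obtain y where "relD y (const_val D c)"
    "\<And>Q. (\<exists>y'\<le>elem_bd N. const_elem N w (prod_encode c) y' \<and> Q y') \<longleftrightarrow> Q y"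
    using const_elem_ex[OF c le(1)] by metis
  thus ?case using CHasConst le by (simp add: hold_code relA_le)
next
  case (RName n)
  thus ?case using arg_le rol by (simp add: hold_code relA_le)
next
  case (RId C)
  thus ?case using arg_le A_inj by (auto simp: hold_code relA_le)
next
  case (PName n)
  thus ?case using arg_le crl by (simp add: hold_code relA_le relD_le)
qed (use arg_le A_bd D_bd hold_dterm in \<open>auto simp: hold_code relA_le relD_le\<close>)

end


context corr
begin

text \<open>Composition quantifies over intermediate elements, so each direction needs its own
  totality of \<open>relA\<close>: on the structure here, on the abstract domain in
  \<open>chain_imp_hold\<close>.\<close>

lemma hold_chain_imp:
  "\<lbrakk>\<forall>R\<in>set Rs. wf_arole S D R \<and> enc_arole R \<le> N \<and> known 1 (enc_arole R);
    \<And>a. in_A N s a \<Longrightarrow> \<exists>x. relA a x; relA a x; relA b y;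
    hold N w s 4 (list_encode (map enc_arole Rs)) a b\<rbrakk> \<Longrightarrow>
    (x, y) \<in> foldr (O) (map (arole_sem D I) Rs) Id"
proof (induction Rs arbitrary: a x)
  case Nil
  thus ?case using A_inj hold_chain_Nil by auto
next
  case (Cons R Rs)
  obtain c where c: "in_A N s c" "hold N w s 1 (enc_arole R) a c"
      "hold N w s 4 (list_encode (map enc_arole Rs)) c b"
    using Cons.prems hold_chain_Cons[OF relA_le relA_le, of a x b y] by auto
  obtain z where z: "relA c z" using Cons.prems(2)[OF c(1)] by blast
  have "(x, z) \<in> arole_sem D I R" using hold_arole[OF _ _ _ Cons.prems(3) z] c(2) Cons.prems(1) by auto
  moreover have "(z, y) \<in> foldr (O) (map (arole_sem D I) Rs) Id"
    using Cons.IH[OF _ Cons.prems(2) z Cons.prems(4) c(3)] Cons.prems(1) by auto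
  ultimately show ?case by auto
qed

lemma chain_imp_hold:
  "\<lbrakk>\<forall>R\<in>set Rs. wf_arole S D R \<and> enc_arole R \<le> N \<and> known 1 (enc_arole R);
    \<And>x. x \<in> adom I \<Longrightarrow> \<exists>a. relA a x; relA a x; relA b y;
    (x, y) \<in> foldr (O) (map (arole_sem D I) Rs) Id\<rbrakk> \<Longrightarrow>
    hold N w s 4 (list_encode (map enc_arole Rs)) a b"
proof (induction Rs arbitrary: a x)
  case Nil
  thus ?case using A_inj hold_chain_Nil by auto
next
  case (Cons R Rs)
  obtain z where z: "(x, z) \<in> arole_sem D I R" "(z, y) \<in> foldr (O) (map (arole_sem D I) Rs) Id"
    using Cons.prems by auto
  have "wf_arole S D R" using Cons.prems(1) by simp
  hence "z \<in> adom I" using arole_sem_subset[OF I D, of R] z by blast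
  then obtain c where c: "relA c z" using Cons.prems(2) by blast
  have "hold N w s 1 (enc_arole R) a c"
    using hold_arole[OF _ _ _ Cons.prems(3) c] z Cons.prems(1) by auto
  moreover have "hold N w s 4 (list_encode (map enc_arole Rs)) c b"
    using Cons.IH[OF _ Cons.prems(2) c Cons.prems(4) z(2)] Cons.prems(1) by auto
  moreover have "in_A N s c" using A_bd[OF c] by simp
  ultimately show ?case
    using hold_chain_Cons[OF relA_le relA_le, OF Cons.prems(3,4)] by auto
qed

text \<open>Assertions speak of named elements only, which gives an equivalence without any
  totality.\<close>

lemma abox_ok_iff:
  assumes "wf_abox_as S D x" "enc_abox_as x \<le> N" "known 10 (enc_abox_as x)"
  shows "abox_ok N w s (enc_abox_as x) \<longleftrightarrow> sat_abox_as D I x"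
proof (cases x)
  case (IsA a C)
  have "a \<le> N" "enc_concept C \<le> N" using assms(2) arg_le IsA by simp_all
  thus ?thesis using assms IsA hold_concept[OF _ _ _ A_ind, of C a] by (simp add: abox_ok_def)
next
  case (Related a b R)
  have "a \<le> N" "b \<le> N" "enc_arole R \<le> N" using assms(2) arg_le Related by simp_all
  thus ?thesis using assms Related hold_arole[OF _ _ _ A_ind A_ind, of R a b] by (simp add: abox_ok_def)
next
  case (Same a b)
  have "a \<le> N" "b \<le> N" using assms(2) arg_le Same by simp_all
  thus ?thesis using assms Same A_inj[OF A_ind A_ind, of a b] by (simp add: abox_ok_def)
next
  case (ConstIsA c t)
  have le: "prod_encode c \<le> N" "enc_dterm t \<le> N" using assms(2) arg_le ConstIsA by simp_all
  have c: "c \<in> all_consts D" "known 6 (prod_encode c)" using assms ConstIsA by simp_all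
  obtain y where y: "relD y (const_val D c)"
    "\<And>Q. (\<exists>y'\<le>elem_bd N. const_elem N w (prod_encode c) y' \<and> Q y') \<longleftrightarrow> Q y"
    using const_elem_ex[OF c le(1)] by metis
  thus ?thesis using assms ConstIsA hold_dterm[OF _ le(2) _ y(1)] by (simp add: abox_ok_def)
next
  case (RelatedD a c P)
  have le: "a \<le> N" "prod_encode c \<le> N" "enc_crole P \<le> N" using assms(2) arg_le RelatedD by simp_all
  have c: "c \<in> all_consts D" "known 6 (prod_encode c)" using assms RelatedD by simp_all
  obtain y where y: "relD y (const_val D c)"
    "\<And>Q. (\<exists>y'\<le>elem_bd N. const_elem N w (prod_encode c) y' \<and> Q y') \<longleftrightarrow> Q y"
    using const_elem_ex[OF c le(2)] by metis
  thus ?thesis using assms RelatedD le hold_crole[OF _ le(3) _ A_ind y(1), of a] by (simp add: abox_ok_def)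
qed

end

text \<open>The structure is a copy of a part of the interpretation. In the axioms, at-least
  restrictions stand only on the left and at-most restrictions only on the right of an inclusion, so
  fewer successors can do no harm.\<close>

locale corr_down = corr +
  assumes A_tot: "in_A N s a \<Longrightarrow> \<exists>x. relA a x"
    and D_tot: "in_V N w y \<Longrightarrow> \<exists>v. relD y v"
    and D_inj: "relD y v \<Longrightarrow> relD y' v' \<Longrightarrow> y = y' \<longleftrightarrow> v = v'"
begin

definition eA :: "nat \<Rightarrow> 'a" where "eA a = (SOME x. relA a x)"
definition eD :: "nat \<Rightarrow> 'a" where "eD y = (SOME v. relD y v)"

lemma eA: "in_A N s a \<Longrightarrow> relA a (eA a)"
  unfolding eA_def using A_tot by (rule someI_ex)

lemma eD: "in_V N w y \<Longrightarrow> relD y (eD y)"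
  unfolding eD_def using D_tot by (rule someI_ex)

lemma all_A_eq: "all_A N s P \<longleftrightarrow> (\<forall>a. in_A N s a \<longrightarrow> P a)"
  unfolding all_A_def using in_A_le by blast

lemma all_V_eq: "all_V N w P \<longleftrightarrow> (\<forall>y. in_V N w y \<longrightarrow> P y)"
  unfolding all_V_def using in_V_le by blast

lemma count_A:
  assumes "\<And>a. in_A N s a \<Longrightarrow> P a \<Longrightarrow> eA a \<in> X" "finite X"
  shows "card_A N s P \<le> card X"
  unfolding card_A_def
proof (rule card_inj_on_le[of eA])
  show "inj_on eA {a. a < Suc N \<and> in_A N s a \<and> P a}"
    using A_inj[OF eA eA] by (auto simp: inj_on_def)
qed (use assms in auto)

lemma count_V:
  assumes "\<And>y. in_V N w y \<Longrightarrow> P y \<Longrightarrow> eD y \<in> X" "finite X"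
  shows "card_V N w P \<le> card X"
  unfolding card_V_def
proof (rule card_inj_on_le[of eD])
  show "inj_on eD {y. y < Suc (elem_bd N) \<and> in_V N w y \<and> P y}"
    using D_inj[OF eD eD] by (auto simp: inj_on_def)
qed (use assms in auto)

lemma hold_eq:
  "wf_concept S D C \<Longrightarrow> enc_concept C \<le> N \<Longrightarrow> known 0 (enc_concept C) \<Longrightarrow> in_A N s a \<Longrightarrow>
    hold N w s 0 (enc_concept C) a 0 \<longleftrightarrow> eA a \<in> concept_sem D I C"
  "wf_arole S D R \<Longrightarrow> enc_arole R \<le> N \<Longrightarrow> known 1 (enc_arole R) \<Longrightarrow> in_A N s a \<Longrightarrow> in_A N s b \<Longrightarrow>
    hold N w s 1 (enc_arole R) a b \<longleftrightarrow> (eA a, eA b) \<in> arole_sem D I R"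
  "wf_crole S D P \<Longrightarrow> enc_crole P \<le> N \<Longrightarrow> known 2 (enc_crole P) \<Longrightarrow> in_A N s a \<Longrightarrow> in_V N w y \<Longrightarrow>
    hold N w s 2 (enc_crole P) a y \<longleftrightarrow> (eA a, eD y) \<in> crole_sem D I P"
  "wf_dterm D t \<Longrightarrow> enc_dterm t \<le> N \<Longrightarrow> known 3 (enc_dterm t) \<Longrightarrow> in_V N w y \<Longrightarrow>
    hold N w s 3 (enc_dterm t) y 0 \<longleftrightarrow> eD y \<in> dterm_sem D I t"
  using hold_concept[OF _ _ _ eA] hold_arole[OF _ _ _ eA eA] hold_crole[OF _ _ _ eA eD]
    hold_dterm[OF _ _ _ eD] by auto

lemma eA_adom: "in_A N s a \<Longrightarrow> eA a \<in> adom I"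
  using eA A_bd by blast

lemma rbox_ok_down:
  assumes "wf_rbox_ax S D x" "enc_rbox_ax x \<le> N" "known 8 (enc_rbox_ax x)" "sat_rbox_ax D I x"
  shows "rbox_ok N w s (enc_rbox_ax x)"
proof (cases x)
  case (RChain Rs R)
  have "list_encode (map enc_arole Rs) \<le> N" and R: "enc_arole R \<le> N"
    using assms(2) arg_le RChain by simp_all
  hence le: "enc_arole Q \<le> N" if "Q \<in> set Rs" for Q
    using member_le_list_encode[of "enc_arole Q" "map enc_arole Rs"] that by simp
  have "hold N w s 4 (list_encode (map enc_arole Rs)) a b \<Longrightarrow>
      (eA a, eA b) \<in> foldr (O) (map (arole_sem D I) Rs) Id" if "in_A N s a" "in_A N s b" for a b
    using hold_chain_imp[OF _ A_tot eA[OF that(1)] eA[OF that(2)]] assms RChain le by simp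
  thus ?thesis using assms RChain R by (simp add: rbox_ok_def Let_def all_A_eq hold_eq) blast
next
  case (PFun P)
  have le: "enc_crole P \<le> N" using assms(2) arg_le PFun by simp
  have "card_V N w (hold N w s 2 (enc_crole P) a) \<le> 1" if a: "in_A N s a" for a
  proof -
    \<comment> \<open>If there is no successor at all, any \<open>v\<close> will do.\<close>
    have "\<exists>v. \<forall>v'. (eA a, v') \<in> crole_sem D I P \<longrightarrow> v' = v"
      using assms PFun single_valuedD[of "crole_sem D I P"] by simp metis
    then obtain v where "\<And>v'. (eA a, v') \<in> crole_sem D I P \<Longrightarrow> v' = v" by blast
    thus ?thesis using count_V[of "hold N w s 2 (enc_crole P) a" "{v}"] assms PFun a le
      by (simp add: hold_eq)
  qed
  thus ?thesis using assms PFun le by (simp add: rbox_ok_def Let_def all_A_eq)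
qed (use assms arg_le A_inj[OF eA eA] eA_adom in
    \<open>auto simp: rbox_ok_def Let_def all_A_eq all_V_eq hold_eq refl_on_def elim: symE transE dest: asymD irreflD single_valuedD\<close>)

lemma tbox_ok_down:
  assumes "wf_tbox_ax S D x" "enc_tbox_ax x \<le> N" "known 9 (enc_tbox_ax x)" "sat_tbox_ax D I x"
  shows "tbox_ok N w s (enc_tbox_ax x)"
proof (cases x)
  case (AtLeastSub n R B C)
  have le: "enc_arole R \<le> N" "enc_concept B \<le> N" "enc_concept C \<le> N"
    using assms(2) arg_le AtLeastSub by simp_all
  have "eA a \<in> concept_sem D I C"
    if a: "in_A N s a" and c: "n \<le> card_A N s (\<lambda>b. hold N w s 0 (enc_concept B) b 0 \<and> hold N w s 1 (enc_arole R) a b)" for a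
  proof -
    \<comment> \<open>With infinitely many successors \<open>at_least\<close> holds outright;
      otherwise the successors counted in the structure inject into them.\<close>
    have "eA a \<in> at_least I n (arole_sem D I R) (concept_sem D I B)"
      using count_A[of "\<lambda>b. hold N w s 0 (enc_concept B) b 0 \<and> hold N w s 1 (enc_arole R) a b"
          "{y \<in> concept_sem D I B. (eA a, y) \<in> arole_sem D I R}"] a c assms AtLeastSub le eA_adom[OF a]
      by (fastforce simp: at_least_def hold_eq)
    thus ?thesis using assms AtLeastSub by auto
  qed
  thus ?thesis using assms AtLeastSub le by (simp add: tbox_ok_def Let_def all_A_eq hold_eq)
next
  case (SubAtMost B n R C)
  have le: "enc_arole R \<le> N" "enc_concept B \<le> N" "enc_concept C \<le> N"
    using assms(2) arg_le SubAtMost by simp_all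
  have "card_A N s (\<lambda>b. hold N w s 0 (enc_concept C) b 0 \<and> hold N w s 1 (enc_arole R) a b) \<le> n"
    if a: "in_A N s a" and c: "eA a \<in> concept_sem D I B" for a
  proof -
    have "eA a \<in> at_most I n (arole_sem D I R) (concept_sem D I C)" using assms SubAtMost c by auto
    thus ?thesis
      using count_A[of "\<lambda>b. hold N w s 0 (enc_concept C) b 0 \<and> hold N w s 1 (enc_arole R) a b"
          "{y \<in> concept_sem D I C. (eA a, y) \<in> arole_sem D I R}"] a assms SubAtMost le
      by (simp add: at_most_def hold_eq)
  qed
  thus ?thesis using assms SubAtMost le by (simp add: tbox_ok_def Let_def all_A_eq hold_eq)
next
  case (AtLeastSubD n P t C)
  have le: "enc_crole P \<le> N" "enc_dterm t \<le> N" "enc_concept C \<le> N"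
    using assms(2) arg_le AtLeastSubD by simp_all
  have "eA a \<in> concept_sem D I C"
    if a: "in_A N s a" and c: "n \<le> card_V N w (\<lambda>y. hold N w s 3 (enc_dterm t) y 0 \<and> hold N w s 2 (enc_crole P) a y)" for a
  proof -
    have "eA a \<in> at_least I n (crole_sem D I P) (dterm_sem D I t)"
      using count_V[of "\<lambda>y. hold N w s 3 (enc_dterm t) y 0 \<and> hold N w s 2 (enc_crole P) a y"
          "{y \<in> dterm_sem D I t. (eA a, y) \<in> crole_sem D I P}"] a c assms AtLeastSubD le eA_adom[OF a]
      by (fastforce simp: at_least_def hold_eq)
    thus ?thesis using assms AtLeastSubD by auto
  qed
  thus ?thesis using assms AtLeastSubD le by (simp add: tbox_ok_def Let_def all_A_eq hold_eq)
next
  case (SubAtMostD B n P t)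
  have le: "enc_crole P \<le> N" "enc_concept B \<le> N" "enc_dterm t \<le> N"
    using assms(2) arg_le SubAtMostD by simp_all
  have "card_V N w (\<lambda>y. hold N w s 3 (enc_dterm t) y 0 \<and> hold N w s 2 (enc_crole P) a y) \<le> n"
    if a: "in_A N s a" and c: "eA a \<in> concept_sem D I B" for a
  proof -
    have "eA a \<in> at_most I n (crole_sem D I P) (dterm_sem D I t)" using assms SubAtMostD c by auto
    thus ?thesis
      using count_V[of "\<lambda>y. hold N w s 3 (enc_dterm t) y 0 \<and> hold N w s 2 (enc_crole P) a y"
          "{y \<in> dterm_sem D I t. (eA a, y) \<in> crole_sem D I P}"] a assms SubAtMostD le
      by (simp add: at_most_def hold_eq)
  qed
  thus ?thesis using assms SubAtMostD le by (simp add: tbox_ok_def Let_def all_A_eq hold_eq)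
qed (use assms arg_le eA_adom in
    \<open>auto simp: tbox_ok_def Let_def all_A_eq all_V_eq hold_eq all_restr_def ex_restr_def; blast\<close>)+

end

text \<open>The interpretation is covered by the structure, but several data values may share an
  element. \<open>D_count\<close> makes up for this: up to the bound \<open>N\<close>, a matched
  property has at least as many elements as values.\<close>

locale corr_up = corr +
  assumes A_cov: "x \<in> adom I \<Longrightarrow> \<exists>a. relA a x"
    and A_on: "in_A N s a \<Longrightarrow> \<exists>x. relA a x"
    and D_cov: "v \<in> ddom I \<Longrightarrow> \<exists>y. relD y v"
    and D_count: "(\<And>y v. relD y v \<Longrightarrow> P y \<longleftrightarrow> v \<in> X) \<Longrightarrow> X \<subseteq> ddom I \<Longrightarrow> n \<le> N \<Longrightarrow>
      infinite X \<or> n \<le> card X \<Longrightarrow> n \<le> card_V N w P"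
begin

definition iA :: "'a \<Rightarrow> nat" where "iA x = (SOME a. relA a x)"
definition iD :: "'a \<Rightarrow> nat" where "iD v = (SOME y. relD y v)"

lemma iA: "x \<in> adom I \<Longrightarrow> relA (iA x) x"
  unfolding iA_def using A_cov by (rule someI_ex)

lemma iD: "v \<in> ddom I \<Longrightarrow> relD (iD v) v"
  unfolding iD_def using D_cov by (rule someI_ex)

lemma all_A_eq: "all_A N s P \<longleftrightarrow> (\<forall>x\<in>adom I. P (iA x))"
proof
  show "all_A N s P \<Longrightarrow> \<forall>x\<in>adom I. P (iA x)"
    unfolding all_A_def using A_bd[OF iA] in_A_le by blast
  have "a = iA x" if "relA a x" for a x
    using A_inj[OF that iA] A_bd[OF that] by blast
  thus "\<forall>x\<in>adom I. P (iA x) \<Longrightarrow> all_A N s P"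
    unfolding all_A_def using A_on A_bd by metis
qed

text \<open>Only one direction is available, because an element of the structure may represent no
  value of the interpretation.\<close>

lemma all_V_up: "all_V N w P \<Longrightarrow> \<forall>v\<in>ddom I. P (iD v)"
  unfolding all_V_def using D_bd[OF iD] in_V_le by blast

lemma all_AV_up: "(\<forall>x\<in>adom I. all_V N w (P x)) \<Longrightarrow> \<forall>x\<in>adom I. \<forall>v\<in>ddom I. P x (iD v)"
  using all_V_up by blast

lemma A_count:
  assumes P: "\<And>a x. relA a x \<Longrightarrow> P a \<longleftrightarrow> x \<in> X" and X: "X \<subseteq> adom I"
  shows "finite X \<and> card X \<le> card_A N s P"
proof -
  have inj: "inj_on iA X" using A_inj[OF iA iA] X by (auto simp: inj_on_def)
  have sub: "iA ` X \<subseteq> {a. a < Suc N \<and> in_A N s a \<and> P a}"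
    using A_bd[OF iA] P[OF iA] X by (auto simp: less_Suc_eq_le intro: in_A_le)
  have "finite (iA ` X)" using sub by (rule finite_subset) simp
  moreover have "card (iA ` X) \<le> card_A N s P"
    unfolding card_A_def using sub by (intro card_mono) auto
  ultimately show ?thesis using inj by (simp add: card_image finite_image_iff)
qed

lemma hold_eq:
  "wf_concept S D C \<Longrightarrow> enc_concept C \<le> N \<Longrightarrow> known 0 (enc_concept C) \<Longrightarrow> x \<in> adom I \<Longrightarrow>
    hold N w s 0 (enc_concept C) (iA x) 0 \<longleftrightarrow> x \<in> concept_sem D I C"
  "wf_arole S D R \<Longrightarrow> enc_arole R \<le> N \<Longrightarrow> known 1 (enc_arole R) \<Longrightarrow> x \<in> adom I \<Longrightarrow> y \<in> adom I \<Longrightarrow>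
    hold N w s 1 (enc_arole R) (iA x) (iA y) \<longleftrightarrow> (x, y) \<in> arole_sem D I R"
  "wf_crole S D P \<Longrightarrow> enc_crole P \<le> N \<Longrightarrow> known 2 (enc_crole P) \<Longrightarrow> x \<in> adom I \<Longrightarrow> v \<in> ddom I \<Longrightarrow>
    hold N w s 2 (enc_crole P) (iA x) (iD v) \<longleftrightarrow> (x, v) \<in> crole_sem D I P"
  "wf_dterm D t \<Longrightarrow> enc_dterm t \<le> N \<Longrightarrow> known 3 (enc_dterm t) \<Longrightarrow> v \<in> ddom I \<Longrightarrow>
    hold N w s 3 (enc_dterm t) (iD v) 0 \<longleftrightarrow> v \<in> dterm_sem D I t"
  using hold_concept[OF _ _ _ iA] hold_arole[OF _ _ _ iA iA] hold_crole[OF _ _ _ iA iD]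
    hold_dterm[OF _ _ _ iD] by auto

lemma iA_eq: "x \<in> adom I \<Longrightarrow> y \<in> adom I \<Longrightarrow> iA x = iA y \<longleftrightarrow> x = y"
  using A_inj[OF iA iA] by blast

lemma rbox_ok_up:
  assumes "wf_rbox_ax S D x" "enc_rbox_ax x \<le> N" "known 8 (enc_rbox_ax x)"
    "rbox_ok N w s (enc_rbox_ax x)"
  shows "sat_rbox_ax D I x"
proof (cases x)
  case (REquiv Q R)
  have "\<forall>x\<in>adom I. \<forall>y\<in>adom I. (x, y) \<in> arole_sem D I Q \<longleftrightarrow> (x, y) \<in> arole_sem D I R"
    using assms REquiv arg_le by (simp add: rbox_ok_def Let_def all_A_eq hold_eq)
  thus ?thesis using assms REquiv arole_sem_subset[OF I D, of Q] arole_sem_subset[OF I D, of R] by auto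
next
  case (RSub Q R)
  have "\<forall>x\<in>adom I. \<forall>y\<in>adom I. (x, y) \<in> arole_sem D I Q \<longrightarrow> (x, y) \<in> arole_sem D I R"
    using assms RSub arg_le by (simp add: rbox_ok_def Let_def all_A_eq hold_eq)
  thus ?thesis using assms RSub arole_sem_subset[OF I D, of Q] by auto
next
  case (RChain Rs R)
  have "list_encode (map enc_arole Rs) \<le> N" and R: "enc_arole R \<le> N"
    using assms(2) arg_le RChain by simp_all
  hence le: "enc_arole Q \<le> N" if "Q \<in> set Rs" for Q
    using member_le_list_encode[of "enc_arole Q" "map enc_arole Rs"] that by simp
  have H: "\<forall>x\<in>adom I. \<forall>y\<in>adom I. hold N w s 4 (list_encode (map enc_arole Rs)) (iA x) (iA y) \<longrightarrow>
      (x, y) \<in> arole_sem D I R"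
    using assms RChain R by (simp add: rbox_ok_def Let_def all_A_eq hold_eq)
  \<comment> \<open>Well-formed chains are nonempty; the empty composition would be
    \<open>Id\<close> on the whole type.\<close>
  have sub: "foldr (O) (map (arole_sem D I) Qs) Id \<subseteq> adom I \<times> adom I"
    if "Qs \<noteq> []" "\<forall>Q\<in>set Qs. wf_arole S D Q" for Qs
    using that
  proof (induction Qs)
    case (Cons Q Qs)
    have Q: "arole_sem D I Q \<subseteq> adom I \<times> adom I" using arole_sem_subset[OF I D] Cons.prems by simp
    show ?case
    proof (cases "Qs = []")
      case False
      hence "foldr (O) (map (arole_sem D I) Qs) Id \<subseteq> adom I \<times> adom I" using Cons by simp
      thus ?thesis using Q by auto
    qed (use Q in simp)
  qed simp
  show ?thesis
  proof -
    have "(x, y) \<in> arole_sem D I R" if xy: "(x, y) \<in> foldr (O) (map (arole_sem D I) Rs) Id" for x y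
    proof -
      have *: "x \<in> adom I" "y \<in> adom I" using sub[of Rs] assms(1) RChain xy by auto
      hence "hold N w s 4 (list_encode (map enc_arole Rs)) (iA x) (iA y)"
        using chain_imp_hold[OF _ A_cov iA iA xy] assms RChain le by simp
      thus ?thesis using H * by blast
    qed
    thus ?thesis using RChain by auto
  qed
next
  case (RSym R)
  have "\<forall>x\<in>adom I. \<forall>y\<in>adom I. (x, y) \<in> arole_sem D I R \<longrightarrow> (y, x) \<in> arole_sem D I R"
    using assms RSym arg_le by (simp add: rbox_ok_def Let_def all_A_eq hold_eq)
  thus ?thesis using assms RSym arole_sem_subset[OF I D, of R] by (auto simp: sym_def)
next
  case (RAsym R)
  have "\<forall>x\<in>adom I. \<forall>y\<in>adom I. (x, y) \<in> arole_sem D I R \<longrightarrow> (y, x) \<notin> arole_sem D I R"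
    using assms RAsym arg_le by (simp add: rbox_ok_def Let_def all_A_eq hold_eq)
  thus ?thesis using assms RAsym arole_sem_subset[OF I D, of R] by (auto intro!: asymI)
next
  case (RRef R)
  thus ?thesis using assms arg_le by (simp add: rbox_ok_def Let_def all_A_eq hold_eq refl_on_def)
next
  case (RIrref R)
  have "\<forall>x\<in>adom I. (x, x) \<notin> arole_sem D I R"
    using assms RIrref arg_le by (simp add: rbox_ok_def Let_def all_A_eq hold_eq)
  thus ?thesis using assms RIrref arole_sem_subset[OF I D, of R] by (auto simp: irrefl_def)
next
  case (RDis Q R)
  have "\<forall>x\<in>adom I. \<forall>y\<in>adom I. \<not> ((x, y) \<in> arole_sem D I Q \<and> (x, y) \<in> arole_sem D I R)"
    using assms RDis arg_le by (simp add: rbox_ok_def Let_def all_A_eq hold_eq)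
  thus ?thesis using assms RDis arole_sem_subset[OF I D, of Q] by auto
next
  case (RTra R)
  have "rbox_ok N w s (enc_rbox_ax x) \<longleftrightarrow> (\<forall>x\<in>adom I. \<forall>y\<in>adom I. \<forall>z\<in>adom I.
      (x, y) \<in> arole_sem D I R \<and> (y, z) \<in> arole_sem D I R \<longrightarrow> (x, z) \<in> arole_sem D I R)"
    using assms(1-3) RTra arg_le by (simp add: rbox_ok_def Let_def all_A_eq hold_eq)
  hence H: "\<forall>x\<in>adom I. \<forall>y\<in>adom I. \<forall>z\<in>adom I.
      (x, y) \<in> arole_sem D I R \<and> (y, z) \<in> arole_sem D I R \<longrightarrow> (x, z) \<in> arole_sem D I R"
    using assms(4) by blast
  have "arole_sem D I R \<subseteq> adom I \<times> adom I" using assms(1) RTra arole_sem_subset[OF I D] by simp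
  hence "trans (arole_sem D I R)" by (intro transI) (use H in blast)
  thus ?thesis using RTra by simp
next
  case (RFun R)
  have "\<forall>x\<in>adom I. \<forall>y\<in>adom I. \<forall>z\<in>adom I. (x, y) \<in> arole_sem D I R \<and> (x, z) \<in> arole_sem D I R \<longrightarrow> y = z"
    using assms RFun arg_le by (simp add: rbox_ok_def Let_def all_A_eq hold_eq iA_eq)
  thus ?thesis using assms RFun arole_sem_subset[OF I D, of R] by (auto simp: single_valued_def)
next
  case (REquivProd R B C)
  have "\<forall>x\<in>adom I. \<forall>y\<in>adom I. (x, y) \<in> arole_sem D I R \<longleftrightarrow> x \<in> concept_sem D I B \<and> y \<in> concept_sem D I C"
    using assms REquivProd arg_le by (simp add: rbox_ok_def Let_def all_A_eq hold_eq)
  thus ?thesis using assms REquivProd arole_sem_subset[OF I D, of R] concept_sem_subset[OF I D, of B]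
      concept_sem_subset[OF I D, of C] by simp blast
next
  case (PEquiv Q P)
  have "\<forall>x\<in>adom I. \<forall>v\<in>ddom I. (x, v) \<in> crole_sem D I Q \<longleftrightarrow> (x, v) \<in> crole_sem D I P"
    using all_AV_up[of "\<lambda>x y. hold N w s 2 (enc_crole Q) (iA x) y = hold N w s 2 (enc_crole P) (iA x) y"]
      assms PEquiv arg_le by (simp add: rbox_ok_def Let_def all_A_eq hold_eq)
  thus ?thesis using assms PEquiv crole_sem_subset[OF I D, of Q] crole_sem_subset[OF I D, of P] by auto
next
  case (PSub Q P)
  have "\<forall>x\<in>adom I. \<forall>v\<in>ddom I. (x, v) \<in> crole_sem D I Q \<longrightarrow> (x, v) \<in> crole_sem D I P"
    using all_AV_up[of "\<lambda>x y. hold N w s 2 (enc_crole Q) (iA x) y \<longrightarrow> hold N w s 2 (enc_crole P) (iA x) y"]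
      assms PSub arg_le by (simp add: rbox_ok_def Let_def all_A_eq hold_eq)
  thus ?thesis using assms PSub crole_sem_subset[OF I D, of Q] by auto
next
  case (PDis Q P)
  have "\<forall>x\<in>adom I. \<forall>v\<in>ddom I. \<not> ((x, v) \<in> crole_sem D I Q \<and> (x, v) \<in> crole_sem D I P)"
    using all_AV_up[of "\<lambda>x y. \<not> (hold N w s 2 (enc_crole Q) (iA x) y \<and> hold N w s 2 (enc_crole P) (iA x) y)"]
      assms PDis arg_le by (simp add: rbox_ok_def Let_def all_A_eq hold_eq)
  thus ?thesis using assms PDis crole_sem_subset[OF I D, of Q] by auto
next
  case (PFun P)
  have P: "enc_crole P \<le> N" "wf_crole S D P" "known 2 (enc_crole P)" using assms PFun arg_le by simp_all
  have H: "\<forall>x\<in>adom I. card_V N w (hold N w s 2 (enc_crole P) (iA x)) \<le> 1"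
    using assms PFun by (simp add: rbox_ok_def Let_def all_A_eq)
  have "v = v'" if v: "(x, v) \<in> crole_sem D I P" "(x, v') \<in> crole_sem D I P" for x v v'
  proof (rule ccontr)
    assume ne: "v \<noteq> v'"
    let ?X = "{v \<in> ddom I. (x, v) \<in> crole_sem D I P}"
    have x: "x \<in> adom I" "v \<in> ddom I" "v' \<in> ddom I" using crole_sem_subset[OF I D P(2)] v by auto
    have "infinite ?X \<or> 2 \<le> card ?X"
    proof (cases "finite ?X")
      case True
      have "card {v, v'} \<le> card ?X" using True v x by (intro card_mono) auto
      thus ?thesis using ne by simp
    qed simp
    \<comment> \<open>Two values violate functionality, so counting has to be reliable up to 2; the
      tag 14 of the axiom already makes \<open>N\<close> that large.\<close>
    moreover have "2 \<le> N" using assms(2) PFun pr_ge1[of 14 "list_encode [enc_crole P]"]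
      by (simp add: node_eq_pr)
    ultimately have "2 \<le> card_V N w (hold N w s 2 (enc_crole P) (iA x))"
      using D_count[of "hold N w s 2 (enc_crole P) (iA x)" ?X 2] hold_crole[OF P(2,1,3) iA[OF x(1)]] D_bd
      by blast
    thus False using H x by force
  qed
  thus ?thesis using PFun by (auto simp: single_valued_def)
qed

lemma tbox_ok_up:
  assumes "wf_tbox_ax S D x" "enc_tbox_ax x \<le> N" "known 9 (enc_tbox_ax x)"
    "tbox_ok N w s (enc_tbox_ax x)"
  shows "sat_tbox_ax D I x"
proof (cases x)
  case (CEquiv B C)
  have "\<forall>x\<in>adom I. x \<in> concept_sem D I B \<longleftrightarrow> x \<in> concept_sem D I C"
    using assms CEquiv arg_le by (simp add: tbox_ok_def Let_def all_A_eq hold_eq)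
  thus ?thesis using assms CEquiv concept_sem_subset[OF I D, of B] concept_sem_subset[OF I D, of C] by auto
next
  case (CSub B C)
  have "\<forall>x\<in>adom I. x \<in> concept_sem D I B \<longrightarrow> x \<in> concept_sem D I C"
    using assms CSub arg_le by (simp add: tbox_ok_def Let_def all_A_eq hold_eq)
  thus ?thesis using assms CSub concept_sem_subset[OF I D, of B] by auto
next
  case (CSubAll B R C)
  have "\<forall>x\<in>adom I. \<forall>y\<in>adom I. x \<in> concept_sem D I B \<and> (x, y) \<in> arole_sem D I R \<longrightarrow> y \<in> concept_sem D I C"
    using assms CSubAll arg_le by (simp add: tbox_ok_def Let_def all_A_eq hold_eq)
  thus ?thesis using assms CSubAll concept_sem_subset[OF I D, of B] arole_sem_subset[OF I D, of R]
    by (auto simp: all_restr_def)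
next
  case (ExSub R B C)
  have "\<forall>x\<in>adom I. \<forall>y\<in>adom I. (x, y) \<in> arole_sem D I R \<and> y \<in> concept_sem D I B \<longrightarrow> x \<in> concept_sem D I C"
    using assms ExSub arg_le by (simp add: tbox_ok_def Let_def all_A_eq hold_eq)
  thus ?thesis using assms ExSub arole_sem_subset[OF I D, of R] by (auto simp: ex_restr_def)
next
  case (AtLeastSub n R B C)
  have le: "enc_arole R \<le> N" "enc_concept B \<le> N" "enc_concept C \<le> N"
    and wf: "wf_arole S D R" "wf_concept S D B" "wf_concept S D C"
    and kn: "known 1 (enc_arole R)" "known 0 (enc_concept B)" "known 0 (enc_concept C)"
    using assms arg_le AtLeastSub by simp_all
  let ?P = "\<lambda>x b. hold N w s 0 (enc_concept B) b 0 \<and> hold N w s 1 (enc_arole R) (iA x) b"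
  have H: "\<forall>x\<in>adom I. n \<le> card_A N s (?P x) \<longrightarrow> x \<in> concept_sem D I C"
    using assms AtLeastSub le by (simp add: tbox_ok_def Let_def all_A_eq hold_eq)
  have "x \<in> concept_sem D I C" if "x \<in> at_least I n (arole_sem D I R) (concept_sem D I B)" for x
  proof -
    let ?X = "{y \<in> concept_sem D I B. (x, y) \<in> arole_sem D I R}"
    have x: "x \<in> adom I" "infinite ?X \<or> n \<le> card ?X" using that by (auto simp: at_least_def)
    moreover have "finite ?X \<and> card ?X \<le> card_A N s (?P x)"
      by (rule A_count) (use concept_sem_subset[OF I D wf(2)] in
        \<open>auto simp: hold_concept[OF wf(2) le(2) kn(2)] hold_arole[OF wf(1) le(1) kn(1) iA[OF x(1)]]\<close>)
    ultimately show ?thesis using H by auto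
  qed
  thus ?thesis using AtLeastSub by auto
next
  case (SubAtMost B n R C)
  have le: "enc_arole R \<le> N" "enc_concept B \<le> N" "enc_concept C \<le> N"
    and wf: "wf_arole S D R" "wf_concept S D B" "wf_concept S D C"
    and kn: "known 1 (enc_arole R)" "known 0 (enc_concept B)" "known 0 (enc_concept C)"
    using assms arg_le SubAtMost by simp_all
  let ?P = "\<lambda>x b. hold N w s 0 (enc_concept C) b 0 \<and> hold N w s 1 (enc_arole R) (iA x) b"
  have H: "\<forall>x\<in>adom I. x \<in> concept_sem D I B \<longrightarrow> card_A N s (?P x) \<le> n"
    using assms SubAtMost le by (simp add: tbox_ok_def Let_def all_A_eq hold_eq)
  have "x \<in> at_most I n (arole_sem D I R) (concept_sem D I C)" if B: "x \<in> concept_sem D I B" for x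
  proof -
    let ?X = "{y \<in> concept_sem D I C. (x, y) \<in> arole_sem D I R}"
    have x: "x \<in> adom I" using B concept_sem_subset[OF I D wf(2)] by auto
    moreover have "finite ?X \<and> card ?X \<le> card_A N s (?P x)"
      by (rule A_count) (use concept_sem_subset[OF I D wf(3)] in
        \<open>auto simp: hold_concept[OF wf(3) le(3) kn(3)] hold_arole[OF wf(1) le(1) kn(1) iA[OF x(1)]]\<close>)
    ultimately show ?thesis using H B by (force simp: at_most_def)
  qed
  thus ?thesis using SubAtMost by auto
next
  case (TEquiv t u)
  have "\<forall>v\<in>ddom I. v \<in> dterm_sem D I t \<longleftrightarrow> v \<in> dterm_sem D I u"
    using all_V_up[of "\<lambda>y. hold N w s 3 (enc_dterm t) y 0 = hold N w s 3 (enc_dterm u) y 0"]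
      assms TEquiv arg_le by (simp add: tbox_ok_def Let_def hold_eq)
  thus ?thesis using assms TEquiv dterm_sem_subset[OF I D, of t] dterm_sem_subset[OF I D, of u] by auto
next
  case (TSub t u)
  have "\<forall>v\<in>ddom I. v \<in> dterm_sem D I t \<longrightarrow> v \<in> dterm_sem D I u"
    using all_V_up[of "\<lambda>y. hold N w s 3 (enc_dterm t) y 0 \<longrightarrow> hold N w s 3 (enc_dterm u) y 0"]
      assms TSub arg_le by (simp add: tbox_ok_def Let_def hold_eq)
  thus ?thesis using assms TSub dterm_sem_subset[OF I D, of t] by auto
next
  case (CSubAllD C P t)
  have "\<forall>x\<in>adom I. \<forall>v\<in>ddom I. x \<in> concept_sem D I C \<and> (x, v) \<in> crole_sem D I P \<longrightarrow> v \<in> dterm_sem D I t"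
    using all_AV_up[of "\<lambda>x y. hold N w s 0 (enc_concept C) (iA x) 0 \<and> hold N w s 2 (enc_crole P) (iA x) y
      \<longrightarrow> hold N w s 3 (enc_dterm t) y 0"]
      assms CSubAllD arg_le by (simp add: tbox_ok_def Let_def all_A_eq hold_eq)
  thus ?thesis using assms CSubAllD concept_sem_subset[OF I D, of C] crole_sem_subset[OF I D, of P]
    by (auto simp: all_restr_def)
next
  case (ExSubD P t C)
  have "\<forall>x\<in>adom I. \<forall>v\<in>ddom I. (x, v) \<in> crole_sem D I P \<and> v \<in> dterm_sem D I t \<longrightarrow> x \<in> concept_sem D I C"
    using all_AV_up[of "\<lambda>x y. hold N w s 2 (enc_crole P) (iA x) y \<and> hold N w s 3 (enc_dterm t) y 0
      \<longrightarrow> hold N w s 0 (enc_concept C) (iA x) 0"]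
      assms ExSubD arg_le by (simp add: tbox_ok_def Let_def all_A_eq hold_eq)
  thus ?thesis using assms ExSubD crole_sem_subset[OF I D, of P] by (auto simp: ex_restr_def)
next
  case (AtLeastSubD n P t C)
  have le: "enc_crole P \<le> N" "enc_dterm t \<le> N" "enc_concept C \<le> N" "n \<le> N"
    and wf: "wf_crole S D P" "wf_dterm D t" "wf_concept S D C"
    and kn: "known 2 (enc_crole P)" "known 3 (enc_dterm t)" "known 0 (enc_concept C)"
    using assms arg_le AtLeastSubD by simp_all
  let ?P = "\<lambda>x y. hold N w s 3 (enc_dterm t) y 0 \<and> hold N w s 2 (enc_crole P) (iA x) y"
  have H: "\<forall>x\<in>adom I. n \<le> card_V N w (?P x) \<longrightarrow> x \<in> concept_sem D I C"
    using assms AtLeastSubD le by (simp add: tbox_ok_def Let_def all_A_eq hold_eq)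
  have "x \<in> concept_sem D I C" if "x \<in> at_least I n (crole_sem D I P) (dterm_sem D I t)" for x
  proof -
    let ?X = "{v \<in> dterm_sem D I t. (x, v) \<in> crole_sem D I P}"
    have x: "x \<in> adom I" "infinite ?X \<or> n \<le> card ?X" using that by (auto simp: at_least_def)
    moreover have "n \<le> card_V N w (?P x)"
      by (rule D_count[OF _ _ le(4) x(2)]) (use dterm_sem_subset[OF I D wf(2)] in
        \<open>auto simp: hold_dterm[OF wf(2) le(2) kn(2)] hold_crole[OF wf(1) le(1) kn(1) iA[OF x(1)]]\<close>)
    ultimately show ?thesis using H by auto
  qed
  thus ?thesis using AtLeastSubD by auto
next
  case (SubAtMostD B n P t)
  \<comment> \<open>A violation takes \<open>Suc n\<close> successors. This is still within the
    counting bound, since \<open>n\<close> is a proper part of the code of the axiom.\<close>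
  have n: "Suc n \<le> N"
  proof -
    have "n < enc_tbox_ax x" using SubAtMostD by simp
    thus ?thesis using assms(2) by linarith
  qed
  have le: "enc_crole P \<le> N" "enc_dterm t \<le> N" "enc_concept B \<le> N"
    and wf: "wf_crole S D P" "wf_dterm D t" "wf_concept S D B"
    and kn: "known 2 (enc_crole P)" "known 3 (enc_dterm t)" "known 0 (enc_concept B)"
    using assms arg_le SubAtMostD by simp_all
  let ?P = "\<lambda>x y. hold N w s 3 (enc_dterm t) y 0 \<and> hold N w s 2 (enc_crole P) (iA x) y"
  have H: "\<forall>x\<in>adom I. x \<in> concept_sem D I B \<longrightarrow> card_V N w (?P x) \<le> n"
    using assms SubAtMostD le by (simp add: tbox_ok_def Let_def all_A_eq hold_eq)
  have "x \<in> at_most I n (crole_sem D I P) (dterm_sem D I t)" if B: "x \<in> concept_sem D I B" for x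
  proof (rule ccontr)
    assume no: "\<not> ?thesis"
    let ?X = "{v \<in> dterm_sem D I t. (x, v) \<in> crole_sem D I P}"
    have x: "x \<in> adom I" using B concept_sem_subset[OF I D wf(3)] by auto
    hence X: "infinite ?X \<or> Suc n \<le> card ?X" using no by (auto simp: at_most_def)
    have "Suc n \<le> card_V N w (?P x)"
      by (rule D_count[OF _ _ n X]) (use dterm_sem_subset[OF I D wf(2)] in
        \<open>auto simp: hold_dterm[OF wf(2) le(2) kn(2)] hold_crole[OF wf(1) le(1) kn(1) iA[OF x]]\<close>)
    thus False using H B x by force
  qed
  thus ?thesis using SubAtMostD by auto
qed

end


section \<open>Types of data values\<close>

lemma enc_facet_eq_iff [simp]: "enc_facet x = enc_facet y \<longleftrightarrow> x = y"
proof (induction x arbitrary: y)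
qed (case_tac y; simp)+

lemma enc_range_eq_iff [simp]: "enc_range x = enc_range y \<longleftrightarrow> x = y"
proof (induction x arbitrary: y)
qed (case_tac y; simp add: inj_map_eq_map inj_prod_encode)+

lemma enc_data_lit_eq_iff [simp]: "enc_data_lit x = enc_data_lit y \<longleftrightarrow> x = y"
  by (cases x; cases y) simp_all

definition vtype :: "'u datatype_map \<Rightarrow> 'u set \<Rightarrow> nat \<Rightarrow> 'u \<Rightarrow> nat set" where
  "vtype D W N v = {enc_range r |r. wf_range D r \<and> in_R N (enc_range r) \<and> v \<in> range_sem D W r}"

definition fiber :: "'u datatype_map \<Rightarrow> 'u set \<Rightarrow> nat \<Rightarrow> nat \<Rightarrow> 'u set" where
  "fiber D W N t = {v \<in> W. vtype D W N v = set_decode t}"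

lemma vtype_iff:
  "wf_range D r \<Longrightarrow> in_R N (enc_range r) \<Longrightarrow> enc_range r \<in> vtype D W N v \<longleftrightarrow> v \<in> range_sem D W r"
  by (auto simp: vtype_def)

lemma vtype_in_R: "vtype D W N v \<subseteq> {r. in_R N r}"
  by (auto simp: vtype_def)

lemma vtype_bounded: "vtype D W N v \<subseteq> {..range_bd N}"
  by (auto simp: vtype_def in_R_def)

lemma finite_vtype [simp]: "finite (vtype D W N v)"
  using vtype_bounded by (rule finite_subset) simp

lemma set_encode_less: "A \<subseteq> {..<n} \<Longrightarrow> set_encode A < 2 ^ n"
proof -
  assume A: "A \<subseteq> {..<n}"
  have "set_encode A \<le> set_encode {..<n}" unfolding set_encode_def
    using A by (intro sum_mono2) auto
  also have "\<dots> = 2 ^ n - 1" unfolding set_encode_def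
    by (simp add: lessThan_atLeast0 sum_power2)
  also have "\<dots> < 2 ^ n" by simp
  finally show ?thesis .
qed

lemma set_encode_vtype:
  "set_encode (vtype D W N v) < 2 ^ Suc (range_bd N)"
  using vtype_bounded[of D W N v] by (intro set_encode_less) (auto simp: less_Suc_eq_le)

lemma fiber_vtype: "v \<in> W \<Longrightarrow> v \<in> fiber D W N (set_encode (vtype D W N v))"
  by (simp add: fiber_def)

lemma candidate_vtype:
  "candidate N (pr (set_encode (vtype D W N v)) i) \<longleftrightarrow> i < mult_bd N"
  using set_encode_vtype[of D W N v] vtype_in_R[of D W N v] by (auto simp: candidate_def)

definition type_lits :: "'u datatype_map \<Rightarrow> nat \<Rightarrow> nat \<Rightarrow> data_lit set" where
  "type_lits D N y =
     {InRange j (if enc_range r \<in> set_decode (pr1 y) then r else DNeg r) |j r.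
        j \<le> pr2 y \<and> wf_range D r \<and> in_R N (enc_range r)} \<union>
     {Distinct j k |j k. j < k \<and> k \<le> pr2 y}"

text \<open>The hypothesis turns the query into a code of genuine well-formed literals, the only
  kind on which the datatype procedure is specified.\<close>

lemma data_query_type_lits:
  assumes R: "\<And>r. in_R N r \<Longrightarrow> \<exists>r'. wf_range D r' \<and> r = enc_range r'"
  obtains ls where "data_query N y = list_encode (map enc_data_lit ls)" "set ls = type_lits D N y"
proof -
  define g where "g = (\<lambda>z. if pr1 z = 0
        then node 0 [pr1 (pr2 z), if pr2 (pr2 z) \<in> set_decode (pr1 y) then pr2 (pr2 z) else node 3 [pr2 (pr2 z)]]
        else node 1 [pr1 (pr2 z), pr2 (pr2 z)])"
  define P where "P = (\<lambda>z. pr1 z = 0 \<and> pr1 (pr2 z) \<le> pr2 y \<and> in_R N (pr2 (pr2 z)) \<or>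
         pr1 z = 1 \<and> pr1 (pr2 z) < pr2 (pr2 z) \<and> pr2 (pr2 z) \<le> pr2 y)"
  define b where "b = Suc (pr 1 (pr (pr2 y) (range_bd N + pr2 y)))"
  define cl where "cl = map g (filter P [0..<b])"
  have less: "z < b" if "P z" for z
  proof -
    have "pr (pr1 z) (pr (pr1 (pr2 z)) (pr2 (pr2 z))) \<le> pr 1 (pr (pr2 y) (range_bd N + pr2 y))"
      using that unfolding P_def in_R_def by (intro pr_mono) auto
    thus ?thesis by (simp add: b_def)
  qed
  hence "set cl = g ` {z. P z}" by (auto simp: cl_def)
  also have "\<dots> = enc_data_lit ` type_lits D N y"
  proof (intro equalityI subsetI)
    fix c assume "c \<in> g ` {z. P z}"
    then obtain z where z: "P z" "c = g z" by blast
    show "c \<in> enc_data_lit ` type_lits D N y"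
    proof (cases "pr1 z = 0")
      case True
      then obtain r where r: "wf_range D r" "pr2 (pr2 z) = enc_range r"
        using z R by (auto simp: P_def)
      let ?l = "InRange (pr1 (pr2 z)) (if enc_range r \<in> set_decode (pr1 y) then r else DNeg r)"
      have "?l \<in> type_lits D N y" using z True r by (auto simp: P_def type_lits_def)
      moreover have "c = enc_data_lit ?l" using z True r by (simp add: g_def)
      ultimately show ?thesis by blast
    next
      case False
      let ?l = "Distinct (pr1 (pr2 z)) (pr2 (pr2 z))"
      have "?l \<in> type_lits D N y" using z False by (auto simp: P_def type_lits_def)
      moreover have "c = enc_data_lit ?l" using z False by (simp add: g_def)
      ultimately show ?thesis by blast
    qed
  next
    fix c assume "c \<in> enc_data_lit ` type_lits D N y"
    then consider (r) j r where "j \<le> pr2 y" "in_R N (enc_range r)"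
        "c = enc_data_lit (InRange j (if enc_range r \<in> set_decode (pr1 y) then r else DNeg r))"
      | (d) j k where "j < k" "k \<le> pr2 y" "c = enc_data_lit (Distinct j k)"
      by (auto simp: type_lits_def)
    thus "c \<in> g ` {z. P z}"
    proof cases
      case r
      hence "P (pr 0 (pr j (enc_range r)))" "c = g (pr 0 (pr j (enc_range r)))"
        by (simp_all add: P_def g_def)
      thus ?thesis by blast
    next
      case d
      hence "P (pr 1 (pr j k))" "c = g (pr 1 (pr j k))"
        by (simp_all add: P_def g_def)
      thus ?thesis by blast
    qed
  qed
  finally have cl: "set cl = enc_data_lit ` type_lits D N y" .
  have inj: "inj enc_data_lit" by (rule injI) simp
  define ls where "ls = map (inv enc_data_lit) cl"
  have "map enc_data_lit ls = cl"
    unfolding ls_def map_map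
    by (rule map_idI) (use cl in \<open>auto simp: f_inv_into_f\<close>)
  moreover have "set ls = type_lits D N y"
    using cl inj by (simp add: ls_def image_comp)
  moreover have "data_query N y = list_encode cl"
    by (simp add: data_query_def cl_def g_def P_def b_def)
  ultimately show ?thesis using that by metis
qed

lemma type_lits_sat:
  assumes y: "candidate N y" and W: "W \<noteq> {}"
    and R: "\<And>r. in_R N r \<Longrightarrow> \<exists>r'. wf_range D r' \<and> r = enc_range r'"
  shows "(\<exists>v. (\<forall>x. v x \<in> W) \<and> (\<forall>l\<in>type_lits D N y. lit_holds_in D W v l)) \<longleftrightarrow>
    (\<exists>A. A \<subseteq> fiber D W N (pr1 y) \<and> finite A \<and> card A = Suc (pr2 y))"
proof -
  \<comment> \<open>The size of \<open>pr1 y\<close> excludes digits beyond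
    \<open>range_bd N\<close>, and \<open>candidate\<close> takes care of the others. So the type
    claims nothing on which the literals are silent.\<close>
  have sub: "r \<in> set_decode (pr1 y) \<Longrightarrow> in_R N r" for r
  proof -
    assume r: "r \<in> set_decode (pr1 y)"
    have "r \<le> range_bd N"
    proof (rule ccontr)
      assume "\<not> ?thesis"
      hence "2 ^ Suc (range_bd N) \<le> (2::nat) ^ r" by (intro power_increasing) auto
      hence "pr1 y < 2 ^ r" using y by (simp add: candidate_def)
      hence "pr1 y div 2 ^ r = 0" by simp
      thus False using r by (simp add: set_decode_def)
    qed
    thus ?thesis using r y by (simp add: candidate_def)
  qed
  have type: "(\<forall>r. wf_range D r \<and> in_R N (enc_range r) \<longrightarrow>
      u \<in> range_sem D W (if enc_range r \<in> set_decode (pr1 y) then r else DNeg r)) \<longleftrightarrow>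
      u \<in> fiber D W N (pr1 y)" (is "?L \<longleftrightarrow> ?R") if u: "u \<in> W" for u
  proof
    assume L: ?L
    have "r \<in> vtype D W N u \<longleftrightarrow> r \<in> set_decode (pr1 y)" for r
    proof (cases "in_R N r")
      case True
      then obtain r' where "wf_range D r'" "r = enc_range r'" using R by blast
      thus ?thesis using L True vtype_iff[of D r' N W u] by (auto split: if_splits)
    next
      case False
      thus ?thesis using sub[of r] vtype_in_R[of D W N u] by blast
    qed
    thus ?R using u by (auto simp: fiber_def)
  next
    assume ?R
    thus ?L using u vtype_iff[of D _ N W u] by (auto simp: fiber_def)
  qed
  have lits: "(\<forall>l\<in>type_lits D N y. lit_holds_in D W v l) \<longleftrightarrow>
      (\<forall>j\<le>pr2 y. v j \<in> fiber D W N (pr1 y)) \<and> (\<forall>j k. j < k \<and> k \<le> pr2 y \<longrightarrow> v j \<noteq> v k)"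
    if v: "\<forall>x. v x \<in> W" for v
  proof -
    have G: "(\<forall>l\<in>{h j r |j r. Q j r}. P l) \<longleftrightarrow> (\<forall>j r. Q j r \<longrightarrow> P (h j r))"
      for h :: "'b \<Rightarrow> 'c \<Rightarrow> 'd" and Q P by blast
    have "(\<forall>l\<in>type_lits D N y. lit_holds_in D W v l) \<longleftrightarrow>
      (\<forall>j\<le>pr2 y. \<forall>r. wf_range D r \<and> in_R N (enc_range r) \<longrightarrow>
        v j \<in> range_sem D W (if enc_range r \<in> set_decode (pr1 y) then r else DNeg r)) \<and>
      (\<forall>j k. j < k \<and> k \<le> pr2 y \<longrightarrow> v j \<noteq> v k)"
      unfolding type_lits_def ball_Un G lit_holds_in.simps by blast
    thus ?thesis using type v by simp
  qed
  show ?thesis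
  proof
    assume "\<exists>v. (\<forall>x. v x \<in> W) \<and> (\<forall>l\<in>type_lits D N y. lit_holds_in D W v l)"
    then obtain v where v: "\<forall>j\<le>pr2 y. v j \<in> fiber D W N (pr1 y)"
      "\<And>j k. j < k \<Longrightarrow> k \<le> pr2 y \<Longrightarrow> v j \<noteq> v k" using lits by blast
    have "inj_on v {..pr2 y}" using v(2) unfolding inj_on_def by (metis atMost_iff linorder_neqE_nat)
    hence "card (v ` {..pr2 y}) = Suc (pr2 y)" by (simp add: card_image)
    thus "\<exists>A. A \<subseteq> fiber D W N (pr1 y) \<and> finite A \<and> card A = Suc (pr2 y)"
      using v(1) by (intro exI[of _ "v ` {..pr2 y}"]) auto
  next
    assume "\<exists>A. A \<subseteq> fiber D W N (pr1 y) \<and> finite A \<and> card A = Suc (pr2 y)"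
    then obtain A where A: "A \<subseteq> fiber D W N (pr1 y)" "finite A" "card A = Suc (pr2 y)" by blast
    obtain h where h: "bij_betw h {0..<Suc (pr2 y)} A" using ex_bij_betw_nat_finite[OF A(2)] A(3) by auto
    obtain w0 where w0: "w0 \<in> W" using W by blast
    \<comment> \<open>Assignments are total; variables beyond \<open>pr2 y\<close> get an arbitrary
      value of \<open>W\<close>.\<close>
    define v where "v = (\<lambda>j. if j \<le> pr2 y then h j else w0)"
    have f: "v j \<in> fiber D W N (pr1 y)" if "j \<le> pr2 y" for j
      using that h A(1) by (auto simp: v_def bij_betw_def)
    have "\<forall>x. v x \<in> W" using f w0 by (auto simp: v_def fiber_def split: if_splits)
    moreover have "v j \<noteq> v k" if "j < k" "k \<le> pr2 y" for j k
      using inj_onD[OF bij_betw_imp_inj_on[OF h], of j k] that by (auto simp: v_def)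
    ultimately show "\<exists>v. (\<forall>x. v x \<in> W) \<and> (\<forall>l\<in>type_lits D N y. lit_holds_in D W v l)"
      using f lits by blast
  qed
qed

text \<open>The elements of a type thus form an initial segment of indices, as long as the number of
  values of the type but cut off at \<open>mult_bd N\<close>.\<close>

definition V_spec :: "'u datatype_map \<Rightarrow> 'u set \<Rightarrow> nat \<Rightarrow> nat \<Rightarrow> bool" where
  "V_spec D W N w \<longleftrightarrow> (\<forall>y. in_V N w y \<longleftrightarrow> candidate N y \<and>
     (\<exists>A. A \<subseteq> fiber D W N (pr1 y) \<and> finite A \<and> card A = Suc (pr2 y)))"

text \<open>The second claim, that every query receives an answer, is what
  \<open>partrec_filter\<close> demands.\<close>

lemma V_specI:
  assumes f: "\<And>ls. (\<forall>l\<in>set ls. wf_data_lit D l) \<Longrightarrow>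
      f (list_encode (map enc_data_lit ls)) = Some (of_bool (conj_sat_in D W ls))"
    and W: "W \<noteq> {}"
    and R: "\<And>r. in_R N r \<Longrightarrow> \<exists>r'. wf_range D r' \<and> r = enc_range r'"
    and w: "set (list_decode w) = {q \<in> set (list_decode (data_queries N)). f q = Some 1}"
  shows "V_spec D W N w"
    and "q \<in> set (list_decode (data_queries N)) \<Longrightarrow> f q \<in> {Some 0, Some 1}"
proof -
  have q: "f (data_query N y) = Some (of_bool
      (\<exists>A. A \<subseteq> fiber D W N (pr1 y) \<and> finite A \<and> card A = Suc (pr2 y)))" if y: "candidate N y" for y
  proof -
    obtain ls where ls: "data_query N y = list_encode (map enc_data_lit ls)" "set ls = type_lits D N y"
      using data_query_type_lits[OF R] by blast
    have "\<forall>l\<in>set ls. wf_data_lit D l" unfolding ls(2) type_lits_def by auto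
    from f[OF this] show ?thesis using type_lits_sat[OF y W R] ls by (simp add: conj_sat_in_def)
  qed
  have set: "set (list_decode (data_queries N)) = data_query N ` {y. candidate N y}"
  proof -
    have "y < Suc (elem_bd N)" if "candidate N y" for y
      using pr_mono[of "pr1 y" "2 ^ Suc (range_bd N)" "pr2 y" "mult_bd N"] that
      by (simp add: candidate_def elem_bd_def)
    hence "{y. candidate N y} = {y \<in> {..<Suc (elem_bd N)}. candidate N y}" by blast
    thus ?thesis by (simp add: data_queries_def lessThan_atLeast0 del: upt_Suc)
  qed
  have "in_V N w y \<longleftrightarrow> candidate N y \<and> f (data_query N y) = Some 1" for y
    unfolding in_V_def w set by blast
  thus "V_spec D W N w" using q by (simp add: V_spec_def cong: conj_cong)
  show "q \<in> set (list_decode (data_queries N)) \<Longrightarrow> f q \<in> {Some 0, Some 1}"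
    unfolding set using q by auto
qed


section \<open>From interpretations to finite structures\<close>

text \<open>Enumerates \<open>X\<close> without repetition, treating finite and infinite sets alike:
  the relevant indices \<open>i\<close> are those for which \<open>X\<close> has a subset of
  \<open>Suc i\<close> elements.\<close>

lemma inj_on_prefix:
  fixes X :: "'a set"
  obtains e :: "nat \<Rightarrow> 'a" where "inj_on e {i. \<exists>A\<subseteq>X. finite A \<and> card A = Suc i}"
    "\<And>i A. A \<subseteq> X \<Longrightarrow> finite A \<Longrightarrow> card A = Suc i \<Longrightarrow> e i \<in> X"
proof (cases "finite X")
  case True
  obtain h where h: "bij_betw h {0..<card X} X" using ex_bij_betw_nat_finite[OF True] by blast
  have lt: "i < card X" if "A \<subseteq> X" "card A = Suc i" for i A
    using card_mono[OF True that(1)] that(2) by simp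
  show ?thesis
  proof (rule that[of h])
    show "inj_on h {i. \<exists>A\<subseteq>X. finite A \<and> card A = Suc i}"
      using bij_betw_imp_inj_on[OF h] by (rule inj_on_subset) (clarsimp, erule (1) lt)
    show "h i \<in> X" if "A \<subseteq> X" "card A = Suc i" for i A
      using bij_betw_apply[OF h] lt[OF that] by simp
  qed
next
  case False
  then obtain e :: "nat \<Rightarrow> 'a" where "inj e" "range e \<subseteq> X"
    using infinite_countable_subset[of X] by blast
  thus ?thesis by (intro that[of e]) (auto intro: inj_on_subset)
qed

text \<open>The type of a constant contains its singleton range, so the type has just one value and
  only the index 0 occurs.\<close>

lemma const_val_fiber:
  assumes D: "datatype_map D" and W: "data_core D W" and V: "V_spec D W N w"
    and c: "c \<in> all_consts D" "in_R N (node 1 [prod_encode c])"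
  shows "in_V N w (pr (set_encode (vtype D W N (const_val D c))) 0)"
    and "const_elem N w (prod_encode c) y \<Longrightarrow> y = pr (set_encode (vtype D W N (const_val D c))) 0"
proof -
  let ?t = "set_encode (vtype D W N (const_val D c))"
  have vW: "const_val D c \<in> W"
    using const_val_in_data_values[OF D c(1)] W by (auto simp: data_core_def)
  have "mult_bd N > 0" by (simp add: mult_bd_def)
  thus "in_V N w (pr ?t 0)"
    using V fiber_vtype[OF vW] candidate_vtype[of N D W "const_val D c" 0] unfolding V_spec_def
    by (auto intro!: exI[of _ "{const_val D c}"])
  assume y: "const_elem N w (prod_encode c) y"
  then obtain A where A: "A \<subseteq> fiber D W N (pr1 y)" "card A = Suc (pr2 y)" and "finite A"
    using V unfolding V_spec_def const_elem_def by blast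
  have "v = const_val D c" if "v \<in> A" for v
  proof -
    have "enc_range (DEnum [c]) \<in> vtype D W N v"
      using that A(1) y by (auto simp: fiber_def const_elem_def)
    thus ?thesis using vtype_iff[of D "DEnum [c]" N W v] c by simp
  qed
  moreover have "A \<noteq> {}" using A(2) by auto
  ultimately have "A = {const_val D c}" by blast
  thus "y = pr ?t 0" using A by (auto simp: fiber_def intro: pr_collapse[symmetric, THEN trans])
qed

text \<open>An element of type \<open>t\<close> and index \<open>i\<close> is sent to the
  \<open>i\<close>-th value of an injective enumeration of the fiber of \<open>t\<close>; the facts
  are then read off the interpretation.\<close>

lemma structure_of_interpretation:
  assumes D: "datatype_map D" and I: "interpretation_of S D I"
    and W: "data_core D W" "W \<subseteq> ddom I" and V: "V_spec D W N w"
  obtains s relA relD where "s < 2 ^ fact_bd N" "corr_down S D I N w s relA relD"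
proof -
  obtain x0 where x0: "x0 \<in> adom I" using I by (auto simp: interpretation_of_def)
  \<comment> \<open>Numbers outside the signature need a value in the abstract domain as
    well.\<close>
  define \<iota> where "\<iota> = (\<lambda>i. if i \<in> inds S then ind_int I i else x0)"
  have \<iota>: "\<iota> i \<in> adom I" for i using I x0 by (auto simp: \<iota>_def interpretation_of_def)
  have "\<forall>t. \<exists>e. inj_on e {i. \<exists>A\<subseteq>fiber D W N t. finite A \<and> card A = Suc i} \<and>
    (\<forall>i A. A \<subseteq> fiber D W N t \<longrightarrow> finite A \<longrightarrow> card A = Suc i \<longrightarrow> e i \<in> fiber D W N t)"
  proof
    fix t
    obtain e :: "nat \<Rightarrow> 'a" where "inj_on e {i. \<exists>A\<subseteq>fiber D W N t. finite A \<and> card A = Suc i}"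
      "\<And>i A. A \<subseteq> fiber D W N t \<Longrightarrow> finite A \<Longrightarrow> card A = Suc i \<Longrightarrow> e i \<in> fiber D W N t"
      using inj_on_prefix[of "fiber D W N t"] by blast
    thus "\<exists>e. inj_on e {i. \<exists>A\<subseteq>fiber D W N t. finite A \<and> card A = Suc i} \<and>
      (\<forall>i A. A \<subseteq> fiber D W N t \<longrightarrow> finite A \<longrightarrow> card A = Suc i \<longrightarrow> e i \<in> fiber D W N t)"
      by blast
  qed
  then obtain e0 where e0': "\<forall>t. inj_on (e0 t) {i. \<exists>A\<subseteq>fiber D W N t. finite A \<and> card A = Suc i} \<and>
    (\<forall>i A. A \<subseteq> fiber D W N t \<longrightarrow> finite A \<longrightarrow> card A = Suc i \<longrightarrow> e0 t i \<in> fiber D W N t)"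
    by (rule choice[THEN exE])
  have e0: "inj_on (e0 t) {i. \<exists>A\<subseteq>fiber D W N t. finite A \<and> card A = Suc i}"
    "A \<subseteq> fiber D W N t \<Longrightarrow> finite A \<Longrightarrow> card A = Suc i \<Longrightarrow> e0 t i \<in> fiber D W N t" for t i A
    using e0' by blast+
  define e where "e = (\<lambda>y. e0 (pr1 y) (pr2 y))"
  have e: "e y \<in> fiber D W N (pr1 y)" if "in_V N w y" for y
    using that V e0(2) unfolding V_spec_def e_def by blast
  have e_inj: "y = y'" if y: "in_V N w y" "in_V N w y'" "e y = e y'" for y y'
  proof -
    \<comment> \<open>A value determines its type, so enumerations of different fibers cannot
      clash.\<close>
    have "pr1 y = pr1 y'"
      using e[OF y(1)] e[OF y(2)] y(3) set_decode_inverse unfolding fiber_def by (metis (mono_tags) mem_Collect_eq)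
    moreover from this have "pr2 y = pr2 y'"
      using inj_onD[OF e0(1), of "pr1 y" "pr2 y" "pr2 y'"] y V unfolding V_spec_def e_def by auto
    ultimately show ?thesis by (metis pr_collapse)
  qed
  define truth where "truth = (\<lambda>q. let j = pr1 q; n = pr1 (pr2 q); a = pr1 (pr2 (pr2 q)); b = pr2 (pr2 (pr2 q)) in
    j = 0 \<and> \<iota> a = \<iota> b \<or> j = 1 \<and> \<iota> a \<in> concept_int I n \<or>
    j = 2 \<and> (\<iota> a, \<iota> b) \<in> arole_int I n \<or> j = 3 \<and> (\<iota> a, e b) \<in> crole_int I n)"
  \<comment> \<open>Truncation at \<open>fact_bd N\<close> loses no fact about names up to
    \<open>N\<close> and elements up to \<open>elem_bd N\<close>.\<close>
  define s where "s = set_encode {q. q < fact_bd N \<and> truth q}"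
  have s: "s < 2 ^ fact_bd N" unfolding s_def by (rule set_encode_less) auto
  have fact: "fact_in s j n a b = truth (pr j (pr n (pr a b)))"
    if "j \<le> 3" "n \<le> N" "a \<le> elem_bd N" "b \<le> elem_bd N" for j n a b
  proof -
    have "pr j (pr n (pr a b)) < fact_bd N"
      unfolding fact_bd_def less_Suc_eq_le using that by (intro pr_mono)
    thus ?thesis by (simp add: fact_in_def s_def)
  qed
  have NE: "a \<le> N \<Longrightarrow> a \<le> elem_bd N" for a using N_le_elem_bd le_trans by blast
  \<comment> \<open>The least representative is at most \<open>a\<close>, a range in which the
    truncated identifications are complete.\<close>
  have indv: "indv s a = (LEAST b. \<iota> b = \<iota> a)" if "a \<le> N" for a
  proof (rule antisym)
    have "\<iota> (LEAST b. \<iota> b = \<iota> a) = \<iota> a" by (rule LeastI[of "\<lambda>b. \<iota> b = \<iota> a" a]) simp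
    moreover have "(LEAST b. \<iota> b = \<iota> a) \<le> a" by (rule Least_le) simp
    ultimately show "indv s a \<le> (LEAST b. \<iota> b = \<iota> a)"
      unfolding indv_def using that NE by (intro Least_le) (simp add: fact truth_def)
    have "indv s a = a \<or> fact_in s 0 0 (indv s a) a"
      unfolding indv_def by (rule LeastI[of "\<lambda>b. b = a \<or> fact_in s 0 0 b a" a]) simp
    hence "\<iota> (indv s a) = \<iota> a" using indv_le[of s a] that NE by (auto simp: fact truth_def)
    thus "(LEAST b. \<iota> b = \<iota> a) \<le> indv s a" by (rule Least_le)
  qed
  have \<iota>_indv: "\<iota> (indv s a) = \<iota> a" if "a \<le> N" for a
    unfolding indv[OF that] by (rule LeastI[of "\<lambda>b. \<iota> b = \<iota> a" a]) simp
  have \<iota>_inj: "a = b" if ab: "in_A N s a" "in_A N s b" "\<iota> a = \<iota> b" for a b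
  proof -
    obtain c d where cd: "c \<le> N" "d \<le> N" "a = indv s c" "b = indv s d" using ab by (auto simp: in_A_def)
    hence "\<iota> c = \<iota> d" using ab(3) \<iota>_indv by simp
    thus ?thesis using cd indv by simp
  qed
  have AE: "a \<le> elem_bd N" if "in_A N s a" for a using in_A_le[OF that] NE by blast
  have "corr_down S D I N w s (\<lambda>a x. in_A N s a \<and> x = \<iota> a) (\<lambda>y v. in_V N w y \<and> v = e y)"
  proof
    show "interpretation_of S D I" "datatype_map D" by fact+
  next
    fix i assume "i \<le> N" "i \<in> inds S"
    thus "in_A N s (indv s i) \<and> ind_int I i = \<iota> (indv s i)"
      using \<iota>_indv by (auto simp: in_A_def \<iota>_def)
  next
    fix y v r assume *: "in_V N w y \<and> v = e y" "in_R N (enc_range r)" "wf_range D r"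
    hence v: "v \<in> fiber D W N (pr1 y)" using e by blast
    hence "enc_range r \<in> set_decode (pr1 y) \<longleftrightarrow> v \<in> range_sem D W r"
      using vtype_iff[OF *(3,2), of W v] by (simp add: fiber_def)
    thus "enc_range r \<in> set_decode (pr1 y) \<longleftrightarrow> v \<in> range_sem D (ddom I) r"
      using range_sem_restrict[OF D _ W(2) *(3)] W(1) v by (simp add: fiber_def data_core_def)
  next
    fix c assume c: "c \<in> all_consts D" "in_R N (node 1 [prod_encode c])"
    let ?y = "pr (set_encode (vtype D W N (const_val D c))) 0"
    have y: "in_V N w ?y" using const_val_fiber(1)[OF D W(1) V c] .
    have "enc_range (DEnum [c]) \<in> vtype D W N (const_val D c)"
      using vtype_iff[of D "DEnum [c]" N W "const_val D c"] c by simp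
    hence "enc_range (DEnum [c]) \<in> vtype D W N (e ?y)"
      using e[OF y] by (simp add: fiber_def)
    hence "e ?y = const_val D c" using vtype_iff[of D "DEnum [c]" N W "e ?y"] c by simp
    thus "\<exists>y. (in_V N w y \<and> const_val D c = e y) \<and> (\<forall>y'. const_elem N w (prod_encode c) y' \<longrightarrow> y' = y)"
      using y const_val_fiber(2)[OF D W(1) V c] by (intro exI[of _ ?y]) auto
  next
    fix y v assume "in_V N w y \<and> v = e y"
    thus "in_V N w y \<and> v \<in> ddom I" using e W(2) by (auto simp: fiber_def)
  qed (use \<iota> \<iota>_inj e_inj in \<open>auto simp: fact truth_def AE in_V_le\<close>)
  thus ?thesis using that s by blast
qed


section \<open>From finite structures to interpretations\<close>

definition profile :: "nat \<Rightarrow> nat \<Rightarrow> nat \<Rightarrow> (nat \<times> nat) set" where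
  "profile N s y = {(n, a). n \<le> N \<and> a \<le> N \<and> fact_in s 3 n a y}"

text \<open>
  Only \<open>mult_bd N\<close> values of a type are represented. If there are more, then by the pigeonhole
  principle more than \<open>N\<close> of the representatives agree on all concrete roles, and any one of
  these can serve for all values of the type: no number restriction with a bound up to \<open>N\<close>
  notices the difference.
\<close>

lemma type_representatives:
  assumes V: "V_spec D W N w" and v0: "v0 \<in> W" and t: "t = set_encode (vtype D W N v0)"
  shows "\<exists>h. (\<forall>v\<in>fiber D W N t. in_V N w (h v) \<and> pr1 (h v) = t) \<and>
    (\<forall>v\<in>fiber D W N t. \<forall>v'\<in>fiber D W N t. h v = h v' \<longrightarrow> v \<noteq> v' \<longrightarrow>
      N \<le> card {y. in_V N w y \<and> pr1 y = t \<and> profile N s y = profile N s (h v)})"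
proof -
  let ?F = "fiber D W N t"
  have V': "in_V N w (pr t i)" if "i < mult_bd N" "A \<subseteq> ?F" "finite A" "card A = Suc i" for i A
    using V that candidate_vtype[of N D W v0 i] t unfolding V_spec_def by auto
  show ?thesis
  proof (cases "finite ?F \<and> card ?F \<le> mult_bd N")
    case True
    obtain b where b: "bij_betw b ?F {0..<card ?F}"
      using ex_bij_betw_finite_nat True by blast
    have "in_V N w (pr t (b v))" if "v \<in> ?F" for v
    proof -
      have lt: "b v < card ?F" using bij_betw_apply[OF b that] by simp
      then obtain A where "A \<subseteq> ?F" "card A = Suc (b v)" "finite A"
        using obtain_subset_with_card_n[of "Suc (b v)" ?F] by (metis Suc_leI)
      thus ?thesis using V' lt True by simp
    qed
    moreover have "v = v'" if "v \<in> ?F" "v' \<in> ?F" "pr t (b v) = pr t (b v')" for v v'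
      using inj_onD[OF bij_betw_imp_inj_on[OF b]] that by simp
    ultimately show ?thesis by (intro exI[of _ "\<lambda>v. pr t (b v)"]) auto
  next
    case False
    let ?Y = "pr t ` {..<mult_bd N}"
    have Y: "in_V N w y" if y: "y \<in> ?Y" for y
    proof -
      obtain i where i: "i < mult_bd N" "y = pr t i" using y by auto
      have "\<exists>A\<subseteq>?F. finite A \<and> card A = Suc i"
      proof (cases "finite ?F")
        case True
        hence "Suc i \<le> card ?F" using False i by simp
        thus ?thesis using obtain_subset_with_card_n by metis
      next
        case False
        thus ?thesis using infinite_arbitrarily_large[of ?F "Suc i"] by blast
      qed
      thus ?thesis using V' i by blast
    qed
    let ?P = "Pow ({..N} \<times> {..N})"
    have cY: "card ?Y = mult_bd N" by (simp add: card_image inj_on_def)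
    have "profile N s \<in> ?Y \<rightarrow> ?P" by (auto simp: profile_def)
    from pigeonhole_card[OF this]
    obtain p where p: "card ?Y \<le> card (profile N s -` {p} \<inter> ?Y) * card ?P" by fastforce
    have "mult_bd N = Suc (N * card ?P)"
      by (simp only: mult_bd_def card_Pow finite_cartesian_product finite_atMost card_cartesian_product card_atMost)
    \<comment> \<open>The extra 1 in \<open>mult_bd N\<close> makes the inequality strict, so that
      cancelling \<open>card ?P\<close> leaves more than \<open>N\<close> elements of profile
      \<open>p\<close>.\<close>
    hence "N * card ?P < card (profile N s -` {p} \<inter> ?Y) * card ?P"
      using p cY by linarith
    hence big: "N < card (profile N s -` {p} \<inter> ?Y)" unfolding mult_less_cancel2 by blast
    hence "profile N s -` {p} \<inter> ?Y \<noteq> {}" by (metis card.empty not_less_zero)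
    then obtain y0 where y0: "y0 \<in> ?Y" "profile N s y0 = p" by blast
    have "{y. in_V N w y \<and> pr1 y = t \<and> profile N s y = profile N s y0} \<subseteq> {..elem_bd N}"
      using in_V_le by auto
    hence fin: "finite {y. in_V N w y \<and> pr1 y = t \<and> profile N s y = profile N s y0}"
      using finite_subset by blast
    have "profile N s -` {p} \<inter> ?Y \<subseteq> {y. in_V N w y \<and> pr1 y = t \<and> profile N s y = profile N s y0}"
      using Y y0 by auto
    from card_mono[OF fin this]
    have "N \<le> card {y. in_V N w y \<and> pr1 y = t \<and> profile N s y = profile N s y0}"
      using big by simp
    thus ?thesis using Y[OF y0(1)] y0(1) by (intro exI[of _ "\<lambda>_. y0"]) auto
  qed
qed

text \<open>Individuals are placed outside \<open>W\<close> by an injection \<open>j\<close>, and a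
  value \<open>v\<close> inherits the concrete role facts of its representative \<open>h v\<close>.
  Every element with the type of \<open>v\<close> and the profile of \<open>h v\<close> is related
  to \<open>v\<close>, not only \<open>h v\<close> itself; this keeps interchangeable
  representatives available for counting.\<close>

lemma interpretation_of_structure:
  assumes D: "datatype_map D" and W: "data_core D W" "infinite (UNIV - W)" and V: "V_spec D W N w"
  obtains I relA relD where "corr_up S D I N w s relA relD"
proof -
  obtain j :: "nat \<Rightarrow> 'a" where j: "inj j" "range j \<subseteq> UNIV - W"
    using infinite_countable_subset[OF W(2)] by blast
  define ty where "ty = (\<lambda>v. set_encode (vtype D W N v))"
  have fib: "v \<in> fiber D W N (ty v)" if "v \<in> W" for v
    using fiber_vtype[OF that] by (simp add: ty_def)
  have ty: "ty v = t" if "v \<in> fiber D W N t" for v t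
    using that by (simp add: ty_def fiber_def)
  have "\<forall>t. \<exists>h. t \<in> ty ` W \<longrightarrow> (\<forall>v\<in>fiber D W N t. in_V N w (h v) \<and> pr1 (h v) = t) \<and>
    (\<forall>v\<in>fiber D W N t. \<forall>v'\<in>fiber D W N t. h v = h v' \<longrightarrow> v \<noteq> v' \<longrightarrow>
      N \<le> card {y. in_V N w y \<and> pr1 y = t \<and> profile N s y = profile N s (h v)})"
    (is "\<forall>t. \<exists>h. t \<in> ty ` W \<longrightarrow> ?Q t h")
  proof
    fix t
    show "\<exists>h. t \<in> ty ` W \<longrightarrow> ?Q t h"
    proof (cases "t \<in> ty ` W")
      case True
      then obtain v0 where v0: "v0 \<in> W" "t = set_encode (vtype D W N v0)" by (auto simp: ty_def)
      thus ?thesis using type_representatives[OF V v0, of s] by blast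
    qed blast
  qed
  then obtain h0 where h0: "\<forall>t. t \<in> ty ` W \<longrightarrow> ?Q t (h0 t)"
    by (rule choice[THEN exE])
  define h where "h = (\<lambda>v. h0 (ty v) v)"
  have h: "in_V N w (h v)" "pr1 (h v) = ty v" if "v \<in> W" for v
    using h0 fib[OF that] that by (auto simp: h_def)
  have h_inj: "N \<le> card {y. in_V N w y \<and> pr1 y = ty v \<and> profile N s y = profile N s (h v)}"
    if v: "v \<in> W" "v' \<in> W" "h v = h v'" "v \<noteq> v'" for v v'
  proof -
    have *: "ty v' = ty v" using h v by metis
    have "h0 (ty v) v = h0 (ty v) v'" using v(3) * by (simp add: h_def)
    moreover have "v' \<in> fiber D W N (ty v)" using fib[OF v(2)] * by simp
    ultimately show ?thesis using h0 fib[OF v(1)] v(1,4) unfolding h_def by blast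
  qed
  \<comment> \<open>Only names up to \<open>N\<close> are sure to lead into the domain; all others
    are sent to the individual of 0.\<close>
  define I where "I = \<lparr>adom = j ` {a. in_A N s a}, ddom = W,
    concept_int = (\<lambda>n. j ` {a. in_A N s a \<and> fact_in s 1 n a 0}),
    ind_int = (\<lambda>i. j (indv s (if i \<le> N then i else 0))),
    arole_int = (\<lambda>n. {(j a, j b) |a b. in_A N s a \<and> in_A N s b \<and> fact_in s 2 n a b}),
    crole_int = (\<lambda>n. {(j a, v) |a v. in_A N s a \<and> v \<in> W \<and> fact_in s 3 n a (h v)})\<rparr>"
  have inA: "in_A N s (indv s i)" if "i \<le> N" for i using that by (auto simp: in_A_def)
  have jinj: "j a = j b \<longleftrightarrow> a = b" for a b using j(1) by (simp add: inj_eq)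
  have "\<forall>d\<in>dtypes D. dtype_int D d \<subseteq> W" "W \<noteq> {}"
    using W(1) dtype_subset_data_values[of _ D] unfolding data_core_def by blast+
  hence I: "interpretation_of S D I"
    using inA[of 0] inA j(2)[THEN subsetD, OF rangeI] unfolding interpretation_of_def I_def by auto
  let ?relA = "\<lambda>a x. in_A N s a \<and> x = j a"
  let ?relD = "\<lambda>y v. in_V N w y \<and> v \<in> W \<and> pr1 y = ty v \<and> profile N s y = profile N s (h v)"
  have "corr_up S D I N w s ?relA ?relD"
  proof
    show "interpretation_of S D I" "datatype_map D" by fact+
  next
    fix n a x y v assume n: "n \<le> N" and *: "in_A N s a \<and> x = j a" "?relD y v"
    have "fact_in s 3 n a z \<longleftrightarrow> (n, a) \<in> profile N s z" for z
      using n in_A_le[of N s a] * by (simp add: profile_def)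
    hence "fact_in s 3 n a y \<longleftrightarrow> fact_in s 3 n a (h v)" using * by simp
    thus "fact_in s 3 n a y \<longleftrightarrow> (x, v) \<in> crole_int I n"
      using * by (auto simp: I_def jinj)
  next
    fix y v r assume *: "?relD y v" "in_R N (enc_range r)" "wf_range D r"
    thus "enc_range r \<in> set_decode (pr1 y) \<longleftrightarrow> v \<in> range_sem D (ddom I) r"
      using vtype_iff[OF *(3,2), of W v] by (simp add: ty_def I_def)
  next
    fix c assume c: "c \<in> all_consts D" "in_R N (node 1 [prod_encode c])"
    let ?y = "h (const_val D c)"
    have vW: "const_val D c \<in> W"
      using const_val_in_data_values[OF D c(1)] W(1) by (auto simp: data_core_def)
    have "enc_range (DEnum [c]) \<in> vtype D W N (const_val D c)"
      using vtype_iff[of D "DEnum [c]" N W "const_val D c"] c by simp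
    hence "const_elem N w (prod_encode c) ?y"
      using h[OF vW] by (simp add: const_elem_def ty_def)
    hence "\<forall>y'. const_elem N w (prod_encode c) y' \<longrightarrow> y' = ?y"
      using const_val_fiber(2)[OF D W(1) V c] by metis
    thus "\<exists>y. ?relD y (const_val D c) \<and> (\<forall>y'. const_elem N w (prod_encode c) y' \<longrightarrow> y' = y)"
      using h vW by blast
  next
    fix v assume "v \<in> ddom I"
    thus "\<exists>y. ?relD y v" using h by (auto simp: I_def)
  next
    fix P :: "nat \<Rightarrow> bool" and X n
    assume P: "\<And>y v. ?relD y v \<Longrightarrow> P y \<longleftrightarrow> v \<in> X" and X: "X \<subseteq> ddom I" and n: "n \<le> N" "infinite X \<or> n \<le> card X"
    have XW: "X \<subseteq> W" using X by (simp add: I_def)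
    let ?C = "{y. y < Suc (elem_bd N) \<and> in_V N w y \<and> P y}"
    \<comment> \<open>If \<open>h\<close> is injective on \<open>X\<close>, the representatives are
      counted themselves. Otherwise a shared representative comes with at least \<open>N\<close>
      interchangeable elements, and all of them satisfy \<open>P\<close>.\<close>
    show "n \<le> card_V N w P"
    proof (cases "inj_on h X")
      case True
      have "h v \<le> elem_bd N" if "v \<in> W" for v using in_V_le[OF h(1)[OF that]] .
      hence sub: "h ` X \<subseteq> ?C" using P h XW by (auto simp: less_Suc_eq_le)
      hence "finite (h ` X)" by (rule finite_subset) simp
      hence "n \<le> card (h ` X)" using n(2) True by (simp add: card_image finite_image_iff)
      also have "\<dots> \<le> card ?C" using sub by (intro card_mono) auto
      finally show ?thesis by (simp add: card_V_def)
    next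
      case False
      then obtain v v' where v: "v \<in> X" "v' \<in> X" "h v = h v'" "v \<noteq> v'" by (auto simp: inj_on_def)
      have "N \<le> card {y. in_V N w y \<and> pr1 y = ty v \<and> profile N s y = profile N s (h v)}"
        using h_inj[of v v'] v XW by blast
      also have "\<dots> \<le> card ?C"
        using P[of _ v] v XW by (intro card_mono) (auto simp: less_Suc_eq_le intro: in_V_le)
      finally show ?thesis using n(1) by (simp add: card_V_def)
    qed
  qed (use jinj inA in \<open>auto simp: I_def\<close>)
  thus ?thesis using that by blast
qed


section \<open>Queries\<close>

primrec atom_terms :: "atom \<Rightarrow> qterm set" where
  "atom_terms (ARole R v w) = {v, w}"
| "atom_terms (CRole P w u) = {w, u}"
| "atom_terms (Conc C w) = {w}"
| "atom_terms (Eq s t) = {s, t}"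

context corr
begin

lemma abs_obj:
  assumes "abs_term S (Obj x)" "enc_obj x \<le> N"
  shows "relA (indv s (arg0 (enc_obj x))) (qterm_val D I (Obj x))" "pr1 (enc_obj x) = 0"
proof -
  obtain i where i: "x = Ind i" "i \<in> inds S" using assms by (auto simp: abs_term_def)
  hence "i \<le> N" using assms(2) arg_le by simp
  thus "relA (indv s (arg0 (enc_obj x))) (qterm_val D I (Obj x))" "pr1 (enc_obj x) = 0"
    using i A_ind by simp_all
qed

lemma data_obj:
  assumes "data_term D (Obj x)" "enc_obj x \<le> N" "known 14 (enc_obj x)"
  shows "\<exists>c y. x = Const c \<and> c \<in> all_consts D \<and> pr1 (enc_obj x) = 1 \<and>
    relD y (const_val D c) \<and> const_elem N w (arg0 (enc_obj x)) y \<and>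
    (\<forall>Q. (\<exists>y'\<le>elem_bd N. const_elem N w (arg0 (enc_obj x)) y' \<and> Q y') \<longleftrightarrow> Q y) \<and>
    in_R N (node 1 [prod_encode c])"
proof -
  obtain c where c: "x = Const c" "c \<in> all_consts D" using assms by (auto simp: data_term_def)
  have le: "prod_encode c \<le> N" using assms(2) arg_le c by simp
  have kn: "known 6 (prod_encode c)" using assms(3) c by simp
  obtain y where "relD y (const_val D c)" "const_elem N w (prod_encode c) y"
    "\<And>Q. (\<exists>y'\<le>elem_bd N. const_elem N w (prod_encode c) y' \<and> Q y') \<longleftrightarrow> Q y"
    using const_elem_ex[OF c(2) kn le] by metis
  moreover have "in_R N (node 1 [prod_encode c])" using kn const_le_range_bd[OF le] by simp
  ultimately show ?thesis using c by (intro exI[of _ c] exI[of _ y]) simp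
qed

lemma atom_ok_iff:
  assumes wf: "wf_atom S D (subst_atom \<sigma> a)" and le: "enc_atom a \<le> N" and kn: "known 11 (enc_atom a)"
    and ob: "\<And>u. u \<in> atom_terms a \<Longrightarrow> \<exists>x. subst_qterm \<sigma> u = Obj x \<and>
      obj_of (subst_code N) (enc_qterm u) = enc_obj x \<and> enc_obj x \<le> N \<and> known 14 (enc_obj x)"
  shows "atom_ok N w s (enc_atom a) \<longleftrightarrow> sat_atom D I (subst_atom \<sigma> a)"
proof (cases a)
  case (ARole R u v)
  obtain x y where x: "subst_qterm \<sigma> u = Obj x" "obj_of (subst_code N) (enc_qterm u) = enc_obj x"
      "enc_obj x \<le> N" and y: "subst_qterm \<sigma> v = Obj y"
      "obj_of (subst_code N) (enc_qterm v) = enc_obj y" "enc_obj y \<le> N"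
    using ob[of u] ob[of v] ARole by auto
  have R: "wf_arole S D R" "enc_arole R \<le> N" "known 1 (enc_arole R)"
    and a: "abs_term S (Obj x)" "abs_term S (Obj y)"
    using wf le kn arg_le ARole x y by simp_all
  show ?thesis using hold_arole[OF R abs_obj(1)[OF a(1) x(3)] abs_obj(1)[OF a(2) y(3)]] ARole x y
    by (simp add: atom_ok_def Let_def)
next
  case (CRole P u v)
  obtain x y where x: "subst_qterm \<sigma> u = Obj x" "obj_of (subst_code N) (enc_qterm u) = enc_obj x"
      "enc_obj x \<le> N" and y: "subst_qterm \<sigma> v = Obj y"
      "obj_of (subst_code N) (enc_qterm v) = enc_obj y" "enc_obj y \<le> N" "known 14 (enc_obj y)"
    using ob[of u] ob[of v] CRole by auto
  have P: "wf_crole S D P" "enc_crole P \<le> N" "known 2 (enc_crole P)"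
    and a: "abs_term S (Obj x)" "data_term D (Obj y)"
    using wf le kn arg_le CRole x y by simp_all
  obtain c z where z: "y = Const c" "relD z (const_val D c)"
    "\<And>Q. (\<exists>y'\<le>elem_bd N. const_elem N w (arg0 (enc_obj y)) y' \<and> Q y') \<longleftrightarrow> Q z"
    using data_obj[OF a(2) y(3,4)] by blast
  have "atom_ok N w s (enc_atom a) \<longleftrightarrow> hold N w s 2 (enc_crole P) (indv s (arg0 (enc_obj x))) z"
    using CRole x y z(3) by (simp add: atom_ok_def Let_def)
  thus ?thesis using hold_crole[OF P abs_obj(1)[OF a(1) x(3)] z(2)] CRole x y z(1) by simp
next
  case (Conc C u)
  obtain x where x: "subst_qterm \<sigma> u = Obj x" "obj_of (subst_code N) (enc_qterm u) = enc_obj x"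
      "enc_obj x \<le> N"
    using ob[of u] Conc by auto
  have C: "wf_concept S D C" "enc_concept C \<le> N" "known 0 (enc_concept C)"
    and a: "abs_term S (Obj x)"
    using wf le kn arg_le Conc x by simp_all
  show ?thesis using hold_concept[OF C abs_obj(1)[OF a(1) x(3)]] Conc x
    by (simp add: atom_ok_def Let_def)
next
  case (Eq u v)
  obtain x y where x: "subst_qterm \<sigma> u = Obj x" "obj_of (subst_code N) (enc_qterm u) = enc_obj x"
      "enc_obj x \<le> N" "known 14 (enc_obj x)" and y: "subst_qterm \<sigma> v = Obj y"
      "obj_of (subst_code N) (enc_qterm v) = enc_obj y" "enc_obj y \<le> N" "known 14 (enc_obj y)"
    using ob[of u] ob[of v] Eq by auto
  consider "abs_term S (Obj x)" "abs_term S (Obj y)" | "data_term D (Obj x)" "data_term D (Obj y)"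
    using wf Eq x y by auto
  thus ?thesis
  proof cases
    case 1
    show ?thesis
      using A_inj[OF abs_obj(1)[OF 1(1) x(3)] abs_obj(1)[OF 1(2) y(3)]] abs_obj(2)[OF 1(1) x(3)] Eq x y
      by (simp add: atom_ok_def Let_def)
  next
    case 2
    obtain c z where z: "x = Const c" "c \<in> all_consts D" "pr1 (enc_obj x) = 1"
      "relD z (const_val D c)" "const_elem N w (arg0 (enc_obj x)) z"
      "\<And>Q. (\<exists>y'\<le>elem_bd N. const_elem N w (arg0 (enc_obj x)) y' \<and> Q y') \<longleftrightarrow> Q z"
      "in_R N (node 1 [prod_encode c])"
        using data_obj[OF 2(1) x(3,4)] by blast
    obtain d z' where z': "y = Const d" "d \<in> all_consts D" "relD z' (const_val D d)"
      "in_R N (node 1 [prod_encode d])"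
        using data_obj[OF 2(2) y(3,4)] by blast
    \<comment> \<open>Two constants are equal iff the element of the first has the singleton range
      of the second in its type.\<close>
    have "atom_ok N w s (enc_atom a) \<longleftrightarrow> const_elem N w (prod_encode d) z"
      using Eq x y z(3,6) z'(1) by (simp add: atom_ok_def Let_def)
    also have "\<dots> \<longleftrightarrow> const_val D c = const_val D d"
      using rng[OF z(4), of "DEnum [d]"] z' z(5) by (simp add: const_elem_def)
    finally show ?thesis using Eq x y z(1) z'(1) by simp
  qed
qed

end


section \<open>The occurring data ranges are well-formed\<close>

context
  fixes S :: signature and D :: "'u datatype_map" and R :: nat
begin

abbreviation wf_occs :: "nat \<Rightarrow> nat \<Rightarrow> bool" where
  "wf_occs k n \<equiv> occs R {enc_range r |r. wf_range D r} k n"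

lemma wf_occs_const: "c \<in> all_consts D \<Longrightarrow> node 1 [prod_encode c] \<in> {enc_range r |r. wf_range D r}"
  by (intro CollectI exI[of _ "DEnum [c]"]) simp

lemma wf_occs_dterm: "wf_dterm D t \<Longrightarrow> wf_occs 3 (enc_dterm t)"
  by (induction t) (use wf_occs_const in auto)

lemma wf_occs_sem:
  "wf_concept S D C \<Longrightarrow> wf_occs 0 (enc_concept C)"
  "wf_arole S D Q \<Longrightarrow> wf_occs 1 (enc_arole Q)"
  "wf_crole S D P \<Longrightarrow> wf_occs 2 (enc_crole P)"
  by (induction C and Q and P) (use wf_occs_const wf_occs_dterm in auto)

lemma wf_occs_rbox: "wf_rbox_ax S D x \<Longrightarrow> wf_occs 8 (enc_rbox_ax x)"
  by (cases x) (use wf_occs_sem in auto)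

lemma wf_occs_tbox: "wf_tbox_ax S D x \<Longrightarrow> wf_occs 9 (enc_tbox_ax x)"
  by (cases x) (use wf_occs_dterm wf_occs_sem in auto)

lemma wf_occs_abox: "wf_abox_as S D x \<Longrightarrow> wf_occs 10 (enc_abox_as x)"
  by (cases x) (use wf_occs_const wf_occs_dterm wf_occs_sem in auto)

lemma wf_occs_obj: "x \<in> objs S D \<Longrightarrow> wf_occs 14 (enc_obj x)"
  using wf_occs_const by (auto simp: objs_def)

lemma atom_terms_objs: "wf_atom S D a \<Longrightarrow> Obj x \<in> atom_terms a \<Longrightarrow> x \<in> objs S D"
  by (cases a) (auto simp: abs_term_def data_term_def objs_def)

lemma wf_occs_atom:
  assumes "wf_atom S D a" shows "wf_occs 11 (enc_atom a)"
proof -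
  have "wf_occs 13 (enc_qterm u)" if "u \<in> atom_terms a" for u
    using that atom_terms_objs[OF assms] wf_occs_obj by (cases u) auto
  thus ?thesis using assms wf_occs_sem by (cases a) auto
qed

end


section \<open>Correctness of the decision procedure\<close>

lemma member_list_code: "m \<in> set ms \<Longrightarrow> list_encode ms \<le> n \<Longrightarrow> m \<le> n"
  using member_le_list_encode[of m ms] by simp

lemma var_in_atom_iff: "var_in_atom v (enc_atom a) \<longleftrightarrow> v \<in> atom_vars a"
proof -
  have "enc_qterm u = node 0 [v] \<longleftrightarrow> v \<in> qterm_vars u" for u by (cases u) auto
  thus ?thesis by (cases a) (auto simp: var_in_atom_def)
qed

lemma atom_vars_terms: "atom_vars a = (\<Union>u\<in>atom_terms a. qterm_vars u)"
  by (cases a) auto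

lemma arg0_enc_lit [simp]: "arg0 (enc_lit l) = enc_atom (lit_atom l)"
  by (cases l) simp_all

lemma var_in_query_iff:
  assumes "query_code N = enc_query Q"
  shows "var_in_query N v \<longleftrightarrow> v \<in> query_vars Q"
  using assms by (auto simp: var_in_query_def enc_query_def query_vars_def var_in_atom_iff)

lemma query_vars_less:
  assumes "v \<in> query_vars Q" shows "v < enc_query Q"
proof -
  obtain l u where l: "l \<in> set Q" "u \<in> atom_terms (lit_atom l)" "v \<in> qterm_vars u"
    using assms by (auto simp: query_vars_def atom_vars_terms)
  have "v < enc_qterm u" using l(3) by (cases u) auto
  also have "\<dots> < enc_atom (lit_atom l)" using l(2) by (cases "lit_atom l") auto
  also have "\<dots> < enc_lit l" by (cases l) simp_all
  also have "\<dots> < enc_query Q" unfolding enc_query_def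
    using l(1) by (intro member_le_list_encode) simp
  finally show ?thesis .
qed

lemma finite_query_vars: "finite (query_vars Q)"
  by (rule finite_subset[of _ "{..<enc_query Q}"]) (auto simp: query_vars_less)

context
  fixes S :: signature and D :: "'u datatype_map" and Rb Tb Ab Q \<sigma> N
  assumes wf_kb: "wf_kb S D (Rb, Tb, Ab)" and wf_query: "wf_query S D Q"
    and subst: "substitution S D \<sigma>"
    and N: "N = list_encode [enc_kb (Rb, Tb, Ab), enc_query Q, enc_subst \<sigma>]"
begin

lemma codes:
  "list_decode (rbox_code N) = map enc_rbox_ax Rb"
  "list_decode (tbox_code N) = map enc_tbox_ax Tb"
  "list_decode (abox_code N) = map enc_abox_as Ab"
  "query_code N = enc_query Q"
  "subst_code N = enc_subst \<sigma>"
  by (simp_all add: N enc_kb_def rbox_code_def tbox_code_def abox_code_def query_code_def subst_code_def)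

lemma mem_subst_code:
  "pr v x \<in> set (list_decode (enc_subst \<sigma>)) \<longleftrightarrow> (\<exists>y. \<sigma> v = Some y \<and> x = enc_obj y)"
  using subst by (force simp: substitution_def enc_subst_def pr_def)

lemma code_le:
  "x \<in> set Rb \<Longrightarrow> enc_rbox_ax x \<le> N"
  "y \<in> set Tb \<Longrightarrow> enc_tbox_ax y \<le> N"
  "z \<in> set Ab \<Longrightarrow> enc_abox_as z \<le> N"
  "l \<in> set Q \<Longrightarrow> enc_atom (lit_atom l) \<le> N"
  "v \<in> query_vars Q \<Longrightarrow> v \<le> N"
  "\<sigma> v = Some u \<Longrightarrow> pr v (enc_obj u) \<le> N"
proof -
  have 1: "enc_kb (Rb, Tb, Ab) \<le> N" "enc_query Q \<le> N" "enc_subst \<sigma> \<le> N"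
    unfolding N by (rule member_list_code[OF _ order_refl], simp)+
  have 2: "list_encode (map enc_rbox_ax Rb) \<le> N" "list_encode (map enc_tbox_ax Tb) \<le> N"
    "list_encode (map enc_abox_as Ab) \<le> N"
    by (rule member_list_code[OF _ 1(1)[unfolded enc_kb_def prod.case]], simp)+
  show "x \<in> set Rb \<Longrightarrow> enc_rbox_ax x \<le> N" by (rule member_list_code[OF _ 2(1)]) simp
  show "y \<in> set Tb \<Longrightarrow> enc_tbox_ax y \<le> N" by (rule member_list_code[OF _ 2(2)]) simp
  show "z \<in> set Ab \<Longrightarrow> enc_abox_as z \<le> N" by (rule member_list_code[OF _ 2(3)]) simp
  show "enc_atom (lit_atom l) \<le> N" if "l \<in> set Q"
  proof -
    have "enc_lit l \<le> N" by (rule member_list_code[OF _ 1(2)[unfolded enc_query_def]]) (simp add: that)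
    moreover have "enc_atom (lit_atom l) < enc_lit l" by (cases l) simp_all
    ultimately show ?thesis by simp
  qed
  show "v \<in> query_vars Q \<Longrightarrow> v \<le> N" using query_vars_less 1(2) by fastforce
  show "\<sigma> v = Some u \<Longrightarrow> pr v (enc_obj u) \<le> N"
    using member_set_decode_list[of "pr v (enc_obj u)" "enc_subst \<sigma>"] mem_subst_code 1(3) by force
qed

lemma known_codes:
  "x \<in> set Rb \<Longrightarrow> occs (range_bd N) {r. in_R N r} 8 (enc_rbox_ax x)"
  "y \<in> set Tb \<Longrightarrow> occs (range_bd N) {r. in_R N r} 9 (enc_tbox_ax y)"
  "z \<in> set Ab \<Longrightarrow> occs (range_bd N) {r. in_R N r} 10 (enc_abox_as z)"
  "l \<in> set Q \<Longrightarrow> occs (range_bd N) {r. in_R N r} 11 (enc_atom (lit_atom l))"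
  "\<sigma> v = Some u \<Longrightarrow> occs (range_bd N) {r. in_R N r} 14 (enc_obj u)"
proof -
  show "x \<in> set Rb \<Longrightarrow> occs (range_bd N) {r. in_R N r} 8 (enc_rbox_ax x)"
    by (auto simp: occs_def in_R_def codes)
  show "y \<in> set Tb \<Longrightarrow> occs (range_bd N) {r. in_R N r} 9 (enc_tbox_ax y)"
    by (auto simp: occs_def in_R_def codes)
  show "z \<in> set Ab \<Longrightarrow> occs (range_bd N) {r. in_R N r} 10 (enc_abox_as z)"
    by (auto simp: occs_def in_R_def codes)
  have "occs (range_bd N) {r. in_R N r} 12 (enc_lit l)" if "l \<in> set Q"
    using that by (auto simp: occs_def in_R_def codes enc_query_def)
  thus "l \<in> set Q \<Longrightarrow> occs (range_bd N) {r. in_R N r} 11 (enc_atom (lit_atom l))"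
    by (cases l) simp_all
  show "occs (range_bd N) {r. in_R N r} 14 (enc_obj u)" if "\<sigma> v = Some u"
  proof -
    have "pr v (enc_obj u) \<in> set (list_decode (subst_code N))"
      using that mem_subst_code codes by simp
    thus ?thesis unfolding occs_def in_R_def by (metis (mono_tags, lifting) mem_Collect_eq pr2_pr)
  qed
qed

text \<open>Guarantees that the datatype procedure is asked about well-formed ranges only.\<close>

lemma in_R_wf: "in_R N r \<Longrightarrow> \<exists>r'. wf_range D r' \<and> r = enc_range r'"
proof -
  assume r: "in_R N r"
  let ?X = "{enc_range r |r. wf_range D r}"
  have "occs (range_bd N) ?X 12 (enc_lit l)" if "l \<in> set Q" for l
    using wf_occs_atom[of S D "lit_atom l"] that wf_query by (cases l) (auto simp: wf_query_def)
  moreover have "occs (range_bd N) ?X 14 (pr2 x)" if x: "x \<in> set (list_decode (subst_code N))" for x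
  proof -
    obtain y where "\<sigma> (pr1 x) = Some y" "pr2 x = enc_obj y"
      using x mem_subst_code[of "pr1 x" "pr2 x"] codes by auto
    moreover from this have "y \<in> objs S D" using subst by (auto simp: substitution_def ran_def)
    ultimately show ?thesis using wf_occs_obj by simp
  qed
  ultimately have "r \<in> ?X"
    using r wf_kb wf_occs_rbox[of S D] wf_occs_tbox[of S D] wf_occs_abox[of S D]
    unfolding in_R_def codes wf_kb_def enc_query_def by (auto simp: occs_def)
  thus ?thesis by blast
qed

lemma obj_of_Var:
  assumes "\<sigma> v = Some x" shows "obj_of (subst_code N) (enc_qterm (Var v)) = enc_obj x"
proof -
  \<comment> \<open>The fallback value in \<open>obj_of\<close> is thereby no smaller than the code
    of the bound object and cannot displace it.\<close>
  have "pr v (enc_obj x) < subst_code N"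
    using member_set_decode_list mem_subst_code assms codes by metis
  hence "enc_obj x \<le> subst_code N" using pr_ge2[of "enc_obj x" v] by simp
  thus ?thesis
    using assms unfolding obj_of_def codes by (auto simp: mem_subst_code codes intro!: Least_equality)
qed

lemma term_obj:
  assumes "l \<in> set Q" "u \<in> atom_terms (lit_atom l)" "query_vars Q \<subseteq> dom \<sigma>"
  shows "\<exists>x\<in>objs S D. subst_qterm \<sigma> u = Obj x \<and> obj_of (subst_code N) (enc_qterm u) = enc_obj x \<and>
    enc_obj x \<le> N \<and> occs (range_bd N) {r. in_R N r} 14 (enc_obj x)"
proof (cases u)
  case (Var v)
  hence "v \<in> query_vars Q" using assms(1,2) by (auto simp: query_vars_def atom_vars_terms intro!: bexI)
  then obtain x where x: "\<sigma> v = Some x" using assms(3) by blast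
  moreover have "x \<in> objs S D" using x subst by (auto simp: substitution_def ran_def)
  moreover have "enc_obj x \<le> N" using code_le(6)[OF x] pr_ge2[of "enc_obj x" v] by simp
  ultimately show ?thesis using Var known_codes(5)[OF x] obj_of_Var[OF x] by auto
next
  case (Obj x)
  have "wf_atom S D (lit_atom l)" using wf_query assms(1) by (simp add: wf_query_def)
  hence "x \<in> objs S D" using atom_terms_objs assms(2) Obj by blast
  moreover have "enc_obj x < enc_atom (lit_atom l)"
  proof -
    have "enc_obj x < enc_qterm u" using Obj by simp
    also have "\<dots> < enc_atom (lit_atom l)" using assms(2) by (cases "lit_atom l") auto
    finally show ?thesis .
  qed
  hence "enc_obj x \<le> N" using code_le(4)[OF assms(1)] by simp
  moreover have "occs (range_bd N) {r. in_R N r} 13 (enc_qterm u)"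
    using known_codes(4)[OF assms(1)] assms(2) by (cases "lit_atom l") auto
  hence "occs (range_bd N) {r. in_R N r} 14 (enc_obj x)" using Obj by simp
  ultimately show ?thesis using Obj by (auto simp: obj_of_def)
qed

lemma subst_ok_iff:
  "subst_ok N \<longleftrightarrow> dom \<sigma> = query_vars Q \<and> wf_query S D (subst_query \<sigma> Q)"
proof -
  have "(\<exists>x\<le>N. pr v x \<in> set (list_decode (subst_code N))) \<longleftrightarrow> v \<in> dom \<sigma>" for v
    using code_le(6)[of v] pr_ge2 le_trans unfolding codes mem_subst_code by blast
  moreover have "v \<le> N" if "v \<in> dom \<sigma>" for v
    using code_le(6)[of v] pr_ge1 le_trans that by blast
  ultimately have 1: "(\<forall>v\<le>N. (\<exists>x\<le>N. pr v x \<in> set (list_decode (subst_code N))) = var_in_query N v) \<longleftrightarrow>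
      dom \<sigma> = query_vars Q"
    using code_le(5) unfolding var_in_query_iff[OF codes(4)] by blast
  have 2: "sorts_ok (subst_code N) (enc_atom (lit_atom l)) \<longleftrightarrow> wf_atom S D (subst_atom \<sigma> (lit_atom l))"
    if d: "dom \<sigma> = query_vars Q" and l: "l \<in> set Q" for l
  proof -
    have ob: "\<exists>x. subst_qterm \<sigma> u = Obj x \<and> obj_of (subst_code N) (enc_qterm u) = enc_obj x \<and>
      (abs_term S (Obj x) \<longleftrightarrow> pr1 (enc_obj x) = 0) \<and> (data_term D (Obj x) \<longleftrightarrow> pr1 (enc_obj x) = 1) \<and>
      pr1 (enc_obj x) \<in> {0, 1}" if u: "u \<in> atom_terms (lit_atom l)" for u
    proof -
      obtain x where "x \<in> objs S D" "subst_qterm \<sigma> u = Obj x"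
        "obj_of (subst_code N) (enc_qterm u) = enc_obj x" using term_obj[OF l u] d by blast
      thus ?thesis by (intro exI[of _ x]) (auto simp: objs_def abs_term_def data_term_def)
    qed
    have wf: "wf_atom S D (lit_atom l)" using wf_query l by (simp add: wf_query_def)
    show ?thesis
    proof (cases "lit_atom l")
      case (ARole R u v)
      thus ?thesis using ob[of u] ob[of v] wf by (auto simp: sorts_ok_def Let_def)
    next
      case (CRole P u v)
      thus ?thesis using ob[of u] ob[of v] wf by (auto simp: sorts_ok_def Let_def)
    next
      case (Conc C u)
      thus ?thesis using ob[of u] wf by (auto simp: sorts_ok_def Let_def)
    next
      case (Eq u v)
      thus ?thesis using ob[of u] ob[of v] wf by (auto simp: sorts_ok_def Let_def)
    qed
  qed
  have la: "lit_atom (subst_lit \<sigma> l) = subst_atom \<sigma> (lit_atom l)" for l by (cases l) simp_all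
  show ?thesis
    unfolding subst_ok_def 1 wf_query_def subst_query_def codes(4) enc_query_def
    using 2 by (auto simp: la)
qed

lemma query_ok_iff:
  assumes "corr S D I N w s relA relD" "dom \<sigma> = query_vars Q" "wf_query S D (subst_query \<sigma> Q)"
  shows "(\<forall>l\<in>set (list_decode (query_code N)). atom_ok N w s (arg0 l) = (pr1 l = 0)) \<longleftrightarrow>
    sat_query D I (subst_query \<sigma> Q)"
proof -
  interpret corr S D I N w s relA relD by fact
  have "atom_ok N w s (enc_atom (lit_atom l)) = (pr1 (enc_lit l) = 0) \<longleftrightarrow> sat_lit D I (subst_lit \<sigma> l)"
    if l: "l \<in> set Q" for l
  proof -
    have "wf_atom S D (subst_atom \<sigma> (lit_atom l))"
      using assms(3) l by (cases l) (auto simp: wf_query_def subst_query_def)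
    hence "atom_ok N w s (enc_atom (lit_atom l)) \<longleftrightarrow> sat_atom D I (subst_atom \<sigma> (lit_atom l))"
      by (rule atom_ok_iff) (use code_le(4)[OF l] known_codes(4)[OF l] term_obj[OF l] assms(2) in blast)+
    thus ?thesis by (cases l) auto
  qed
  thus ?thesis by (simp add: sat_query_def subst_query_def codes enc_query_def)
qed

text \<open>Without data values the core is a singleton that depends on the interpretation, so one
  and the same \<open>w\<close> has to be right for all cores.\<close>

lemma solution_iff:
  assumes D: "datatype_map D" and inf: "infinite (UNIV - data_values D)"
    and V: "\<And>W. data_core D W \<Longrightarrow> V_spec D W N w"
  shows "solution S D (Rb, Tb, Ab) Q \<sigma> \<longleftrightarrow> answer_ok N w"
proof
  assume sol: "solution S D (Rb, Tb, Ab) Q \<sigma>"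
  then obtain I where Is: "interpretation_of S D I" "sat_kb D I (Rb, Tb, Ab)"
      "sat_query D I (subst_query \<sigma> Q)" and d: "dom \<sigma> = query_vars Q" "wf_query S D (subst_query \<sigma> Q)"
    by (auto simp: solution_def)
  obtain v where v: "v \<in> ddom I" using Is(1) by (auto simp: interpretation_of_def)
  \<comment> \<open>The data domain must stay nonempty, so without data values one of its elements
    is kept.\<close>
  define W where "W = (if data_values D = {} then {v} else data_values D)"
  have W: "data_core D W" "W \<subseteq> ddom I"
    using v Is(1) by (auto simp: W_def data_core_def data_values_def interpretation_of_def)
  obtain s relA relD where s: "s < 2 ^ fact_bd N" "corr_down S D I N w s relA relD"
    by (rule structure_of_interpretation[OF D Is(1) W V[OF W(1)]])
  interpret corr_down S D I N w s relA relD by fact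
  have "model_ok N w s"
    unfolding model_ok_def query_ok_iff[OF corr_axioms d] unfolding codes
    using Is(2,3) wf_kb code_le known_codes rbox_ok_down tbox_ok_down abox_ok_iff
    by (auto simp: wf_kb_def sat_kb_def)
  thus "answer_ok N w" using s(1) d subst_ok_iff by (auto simp: answer_ok_def)
next
  assume ans: "answer_ok N w"
  then obtain s where s: "model_ok N w s" and "subst_ok N" by (auto simp: answer_ok_def)
  hence d: "dom \<sigma> = query_vars Q" "wf_query S D (subst_query \<sigma> Q)" using subst_ok_iff by blast+
  define W where "W = (if data_values D = {} then {undefined} else data_values D)"
  have W: "data_core D W" "infinite (UNIV - W)"
    using inf by (auto simp: W_def data_core_def)
  obtain I relA relD where "corr_up S D I N w s relA relD"
    by (rule interpretation_of_structure[OF D W V[OF W(1)]])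
  then interpret corr_up S D I N w s relA relD .
  have "sat_query D I (subst_query \<sigma> Q)"
    using s query_ok_iff[OF corr_axioms d] by (simp add: model_ok_def)
  moreover have "sat_kb D I (Rb, Tb, Ab)"
    using s wf_kb code_le known_codes rbox_ok_up tbox_ok_up abox_ok_iff
    unfolding model_ok_def codes by (auto simp: wf_kb_def sat_kb_def)
  ultimately show "solution S D (Rb, Tb, Ab) Q \<sigma>" using I d subst by (auto simp: solution_def)
qed

end


section \<open>The algorithms\<close>

lemma decide_solution:
  fixes S :: signature and D :: "'u datatype_map"
  assumes D: "datatype_map D" "effective_datatype_map D" "infinite (UNIV - data_values D)"
  shows "\<exists>f. partrec f \<and>
    (\<forall>KB Q \<sigma>. wf_kb S D KB \<longrightarrow> wf_query S D Q \<longrightarrow> substitution S D \<sigma> \<longrightarrow>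
      f (list_encode [enc_kb KB, enc_query Q, enc_subst \<sigma>]) = Some (of_bool (solution S D KB Q \<sigma>)))"
proof -
  obtain f0 where f0: "partrec f0" "\<And>W ls. data_core D W \<Longrightarrow> (\<forall>l\<in>set ls. wf_data_lit D l) \<Longrightarrow>
      f0 (list_encode (map enc_data_lit ls)) = Some (of_bool (conj_sat_in D W ls))"
    using effective_data_core[OF D(1,2)] by metis
  have "partrec (\<lambda>n. f0 (pr2 n))" by (rule partrec_comp_recursive[OF f0(1)]) (intro rec_intros)
  then obtain h where h: "partrec h" "\<And>c l. (\<forall>m\<in>set l. f0 m \<in> {Some 0, Some 1}) \<Longrightarrow>
      h (pr c (list_encode l)) = Some (list_encode (rev (filter (\<lambda>m. f0 m = Some 1) l)))"
    using partrec_filter[of "\<lambda>n. f0 (pr2 n)"] by auto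
  define f where "f = (\<lambda>N. Option.bind (h (pr 0 (data_queries N))) (\<lambda>w. Some (of_bool (answer_ok N w) :: nat)))"
  have "partrec (\<lambda>N. h (pr 0 (data_queries N)))"
    by (rule partrec_comp_recursive[OF h(1)]) (intro rec_intros)
  from partrec.pair[OF recursive_id[unfolded recursive_def] this]
  have "partrec (\<lambda>N. Option.bind (h (pr 0 (data_queries N))) (\<lambda>w. Some (pr N w)))"
    by (simp add: pr_def)
  from recursive_comp_partrec[OF recursive_of_bool[OF decidable_answer_ok] this]
  have "partrec f" by (simp add: f_def)
  moreover have "f (list_encode [enc_kb KB, enc_query Q, enc_subst \<sigma>]) = Some (of_bool (solution S D KB Q \<sigma>))"
    if wf: "wf_kb S D KB" "wf_query S D Q" "substitution S D \<sigma>" for KB Q \<sigma>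
  proof -
    obtain Rb Tb Ab where KB: "KB = (Rb, Tb, Ab)" by (cases KB)
    define N where "N = list_encode [enc_kb KB, enc_query Q, enc_subst \<sigma>]"
    note R = in_R_wf[OF wf(1)[unfolded KB] wf(2,3) N_def[unfolded KB]]
    define w where "w = list_encode (rev (filter (\<lambda>m. f0 m = Some 1) (list_decode (data_queries N))))"
    have w: "set (list_decode w) = {q \<in> set (list_decode (data_queries N)). f0 q = Some 1}"
      by (simp add: w_def)
    have V: "V_spec D W N w" if W: "data_core D W" for W
      using V_specI(1)[OF f0(2)[OF W] _ R w] W by (simp add: data_core_def)
    have "\<exists>W. data_core D W" by (cases "data_values D = {}") (auto simp: data_core_def)
    then obtain W where W: "data_core D W" by blast
    have "\<forall>q\<in>set (list_decode (data_queries N)). f0 q \<in> {Some 0, Some 1}"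
      using V_specI(2)[OF f0(2)[OF W] _ R w] W by (simp add: data_core_def)
    from h(2)[OF this] have "h (pr 0 (data_queries N)) = Some w" by (simp add: w_def)
    hence "f N = Some (of_bool (answer_ok N w))" by (simp add: f_def)
    thus ?thesis
      using solution_iff[OF wf(1)[unfolded KB] wf(2,3) N_def[unfolded KB] D(1,3) V]
      by (simp add: KB N_def)
  qed
  ultimately show ?thesis by blast
qed


text \<open>With finitely many objects the substitutions of the query variables are finite sets of
  bindings below a computable bound. They can all be listed and tested with
  \<open>f\<close>.\<close>

lemma decide_answers:
  fixes S :: signature and D :: "'u datatype_map"
  assumes f: "partrec f"
    "\<And>KB Q \<sigma>. wf_kb S D KB \<Longrightarrow> wf_query S D Q \<Longrightarrow> substitution S D \<sigma> \<Longrightarrow>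
      f (list_encode [enc_kb KB, enc_query Q, enc_subst \<sigma>]) = Some (of_bool (solution S D KB Q \<sigma>))"
    and fin: "finite (objs S D)"
  shows "\<exists>g. partrec g \<and> (\<forall>KB Q. wf_kb S D KB \<longrightarrow> wf_query S D Q \<longrightarrow>
    (\<exists>\<sigma>s. set \<sigma>s = answer_set S D KB Q \<and>
      g (list_encode [enc_kb KB, enc_query Q]) = Some (list_encode (map enc_subst \<sigma>s))))"
proof -
  define X where "X = enc_obj ` objs S D"
  have finX: "finite X" using fin by (simp add: X_def)
  \<comment> \<open>Exceeds the codes of all objects and thus can signal a missing binding.\<close>
  define K where "K = Suc (Max (insert 0 X))"
  have X_less: "x < K" if "x \<in> X" for x
    using that finX by (auto simp: K_def less_Suc_eq_le intro: Max_ge)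
  define Z where "Z = (\<lambda>N. Suc (pr N K))"
  \<comment> \<open>The number \<open>s\<close> is read as a set of bindings. If it binds
    \<open>v\<close> repeatedly, the least object counts.\<close>
  define bind where "bind = (\<lambda>s v. LEAST x. x \<in> X \<and> pr v x \<in> set_decode s \<or> x = K)"
  define good where "good = (\<lambda>N s. \<forall>v<N. var_in_query N v \<longrightarrow> bind s v < K)"
  \<comment> \<open>Filtering \<open>[0..<N]\<close> lists the variables in increasing order, as
    \<open>enc_subst\<close> prescribes.\<close>
  define scode where "scode = (\<lambda>N s. list_encode (map (\<lambda>v. pr v (bind s v)) (filter (var_in_query N) [0..<N])))"
  define cands where "cands = (\<lambda>N. list_encode (map (scode N) (filter (good N) [0..<2 ^ Z N])))"
  have rec_bind [rec_intros]: "recursive (\<lambda>x. bind (a x) (b x))" if "recursive a" "recursive b" for a b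
  proof -
    have "recursive (\<lambda>x. bind (pr1 x) (pr2 x))"
      unfolding bind_def by (rule recursive_Least) (intro rec_intros finX, blast)
    from recursive_lift2[OF this that] show ?thesis .
  qed
  have rec_scode [rec_intros]: "recursive (\<lambda>x. scode (a x) (b x))" if "recursive a" "recursive b" for a b
    by (rule recursive_lift2[OF _ that]) (unfold scode_def, intro rec_intros)
  have dec_good [rec_intros]: "decidable (\<lambda>x. good (a x) (b x))" if "recursive a" "recursive b" for a b
    by (rule decidable_lift2[OF _ that]) (unfold good_def, intro rec_intros)
  have rec_cands: "recursive cands"
    unfolding cands_def[abs_def] Z_def by (intro rec_intros)
  have "partrec (\<lambda>n. f (list_encode [lhd (pr1 n), lhd (ltl (pr1 n)), pr2 n]))"
    by (rule partrec_comp_recursive[OF f(1)]) (intro rec_intros)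
  then obtain h where h: "partrec h"
    "\<And>c l. (\<forall>m\<in>set l. f (list_encode [lhd c, lhd (ltl c), m]) \<in> {Some 0, Some 1}) \<Longrightarrow>
      h (pr c (list_encode l)) =
        Some (list_encode (rev (filter (\<lambda>m. f (list_encode [lhd c, lhd (ltl c), m]) = Some 1) l)))"
    using partrec_filter[of "\<lambda>n. f (list_encode [lhd (pr1 n), lhd (ltl (pr1 n)), pr2 n])"] by auto
  have "partrec (\<lambda>N. h (pr N (cands N)))"
    by (rule partrec_comp_recursive[OF h(1)]) (intro rec_intros rec_cands)
  moreover have "\<exists>\<sigma>s. set \<sigma>s = answer_set S D KB Q \<and>
      h (pr N (cands N)) = Some (list_encode (map enc_subst \<sigma>s))"
    if wf: "wf_kb S D KB" "wf_query S D Q" and N: "N = list_encode [enc_kb KB, enc_query Q]" for KB Q N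
  proof -
    define \<tau> where "\<tau> = (\<lambda>s v. if v \<in> query_vars Q then Some (inv enc_obj (bind s v)) else None)"
    have inj: "inj enc_obj" by (rule injI) simp
    have vq: "var_in_query N v \<longleftrightarrow> v \<in> query_vars Q" for v
      by (rule var_in_query_iff) (simp add: query_code_def N)
    have vN: "v < N" if "v \<in> query_vars Q" for v
      using query_vars_less[OF that] member_le_list_encode[of "enc_query Q" "[enc_kb KB, enc_query Q]"]
      by (simp add: N)
    have sorted: "sorted_list_of_set (query_vars Q) = filter (var_in_query N) [0..<N]"
    proof -
      have "set (filter (var_in_query N) [0..<N]) = query_vars Q" using vq vN by auto
      thus ?thesis
        using sorted_list_of_set.idem_if_sorted_distinct[of "filter (var_in_query N) [0..<N]"]
        by (simp add: sorted_wrt_filter)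
    qed
    have dom: "dom (\<tau> s) = query_vars Q" for s by (auto simp: \<tau>_def split: if_splits)
    have bind: "bind s v \<in> X \<and> pr v (bind s v) \<in> set_decode s" if "bind s v < K" for s v
      using LeastI[of "\<lambda>x. x \<in> X \<and> pr v x \<in> set_decode s \<or> x = K" K] that unfolding bind_def by auto
    have good: "substitution S D (\<tau> s) \<and> scode N s = enc_subst (\<tau> s)" if s: "good N s" for s
    proof
      have b: "bind s v \<in> X" if "v \<in> query_vars Q" for v
        using s bind that vq vN unfolding good_def by blast
      have o: "inv enc_obj (bind s v) \<in> objs S D \<and> enc_obj (inv enc_obj (bind s v)) = bind s v"
        if "v \<in> query_vars Q" for v
        using b[OF that] inj by (auto simp: X_def)
      show "substitution S D (\<tau> s)"
        unfolding substitution_def dom using finite_query_vars o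
        by (auto simp: \<tau>_def ran_def split: if_splits)
      show "scode N s = enc_subst (\<tau> s)"
        unfolding scode_def enc_subst_def dom sorted using o vq
        by (auto simp: \<tau>_def pr_def list_encode_eq)
    qed
    have cov: "\<exists>s<2 ^ Z N. good N s \<and> \<tau> s = \<sigma>" if \<sigma>: "substitution S D \<sigma>" "dom \<sigma> = query_vars Q" for \<sigma>
    proof -
      let ?A = "{pr v (enc_obj x) |v x. \<sigma> v = Some x}"
      define s where "s = set_encode ?A"
      have x: "enc_obj x \<in> X" if "\<sigma> v = Some x" for v x
        using \<sigma>(1) that by (auto simp: substitution_def ran_def X_def)
      have "pr v (enc_obj x) < Z N" if "\<sigma> v = Some x" for v x
      proof -
        have "v \<in> query_vars Q" using \<sigma>(2) that by blast
        hence "v \<le> N" using vN by (simp add: less_imp_le)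
        thus ?thesis using X_less[OF x[OF that]] by (simp add: Z_def less_Suc_eq_le pr_mono)
      qed
      hence A: "?A \<subseteq> {..<Z N}" by auto
      hence sA: "set_decode s = ?A" unfolding s_def using finite_subset by (intro set_encode_inverse) blast
      have b: "bind s v = enc_obj x" if "\<sigma> v = Some x" for v x
        unfolding bind_def sA using that x[OF that] X_less by (intro Least_equality) (auto intro: less_imp_le)
      have "good N s" unfolding good_def vq
      proof (intro allI impI)
        fix v assume "v \<in> query_vars Q"
        then obtain x where "\<sigma> v = Some x" using \<sigma>(2) by blast
        thus "bind s v < K" using b x X_less by simp
      qed
      moreover have "\<tau> s = \<sigma>"
      proof
        fix v show "\<tau> s v = \<sigma> v"
          using \<sigma>(2) b inj by (cases "\<sigma> v") (auto simp: \<tau>_def)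
      qed
      moreover have "s < 2 ^ Z N" unfolding s_def using A by (rule set_encode_less)
      ultimately show ?thesis by blast
    qed
    define \<sigma>s where "\<sigma>s = map \<tau> (filter (good N) [0..<2 ^ Z N])"
    have cs: "cands N = list_encode (map enc_subst \<sigma>s)"
      using good by (simp add: cands_def \<sigma>s_def list_encode_eq)
    have sub: "substitution S D \<sigma>" if "\<sigma> \<in> set \<sigma>s" for \<sigma> using that good by (auto simp: \<sigma>s_def)
    have fv: "f (list_encode [lhd N, lhd (ltl N), enc_subst \<sigma>]) = Some (of_bool (solution S D KB Q \<sigma>))"
      if "\<sigma> \<in> set \<sigma>s" for \<sigma>
      using f(2)[OF wf sub[OF that]] by (simp add: N)
    have "h (pr N (cands N)) = Some (list_encode (rev (filter
        (\<lambda>m. f (list_encode [lhd N, lhd (ltl N), m]) = Some 1) (map enc_subst \<sigma>s))))"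
      unfolding cs by (rule h(2)) (use fv in auto)
    also have "filter (\<lambda>m. f (list_encode [lhd N, lhd (ltl N), m]) = Some 1) (map enc_subst \<sigma>s) =
        map enc_subst (filter (solution S D KB Q) \<sigma>s)"
      unfolding filter_map by (intro arg_cong[of _ _ "map enc_subst"] filter_cong) (auto simp: fv)
    finally have "h (pr N (cands N)) =
        Some (list_encode (map enc_subst (rev (filter (solution S D KB Q) \<sigma>s))))"
      by (simp add: rev_map)
    moreover have "set (rev (filter (solution S D KB Q) \<sigma>s)) = answer_set S D KB Q"
    proof -
      have "\<sigma> \<in> set \<sigma>s" if "solution S D KB Q \<sigma>" for \<sigma>
        using cov[of \<sigma>] that by (auto simp: \<sigma>s_def solution_def)
      thus ?thesis by (auto simp: answer_set_def)
    qed
    ultimately show ?thesis by blast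
  qed
  ultimately show ?thesis by blast
qed

theorem theorem1:
  fixes S :: signature and D :: "'u datatype_map"
  assumes "datatype_map D"
    and "effective_datatype_map D"
    and "infinite (UNIV - data_values D)"
  shows "(\<exists>f. partrec f \<and>
            (\<forall>KB Q \<sigma>. wf_kb S D KB \<longrightarrow> wf_query S D Q \<longrightarrow> substitution S D \<sigma> \<longrightarrow>
              f (list_encode [enc_kb KB, enc_query Q, enc_subst \<sigma>]) =
                Some (of_bool (\<sigma> \<in> answer_set S D KB Q)))) \<and>
         (finite (objs S D) \<longrightarrow>
            (\<exists>g. partrec g \<and>
              (\<forall>KB Q. wf_kb S D KB \<longrightarrow> wf_query S D Q \<longrightarrow>
                (\<exists>\<sigma>s. set \<sigma>s = answer_set S D KB Q \<and>
                  g (list_encode [enc_kb KB, enc_query Q]) =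
                    Some (list_encode (map enc_subst \<sigma>s))))))"
proof -
  obtain f where f: "partrec f"
    "\<forall>KB Q \<sigma>. wf_kb S D KB \<longrightarrow> wf_query S D Q \<longrightarrow> substitution S D \<sigma> \<longrightarrow>
      f (list_encode [enc_kb KB, enc_query Q, enc_subst \<sigma>]) = Some (of_bool (solution S D KB Q \<sigma>))"
    using decide_solution[OF assms] by blast
  show ?thesis
  proof (intro conjI impI)
    show "\<exists>f. partrec f \<and>
            (\<forall>KB Q \<sigma>. wf_kb S D KB \<longrightarrow> wf_query S D Q \<longrightarrow> substitution S D \<sigma> \<longrightarrow>
              f (list_encode [enc_kb KB, enc_query Q, enc_subst \<sigma>]) =
                Some (of_bool (\<sigma> \<in> answer_set S D KB Q)))"
      using f by (intro exI[of _ f]) (simp add: answer_set_def)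
  qed (rule decide_answers[OF f(1) f(2)[rule_format]])
qed

end
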